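(* There is an absolute constant $C>0$ such that the following holds. Let $N_1,N_2,L_1,L_2$ be dyadic numbers in $\{2^k:k\in\mathbb N,\ k\ge1\}\cup\{1\}$, and let $u_1,u_2$ be two functions in $L^2(\mathbb R^3)$, or two functions in $L^2(\mathbb R\times\mathbb T\times\mathbb R)$. Then $$\|(P_{N_1}Q_{L_1}u_1)(P_{N_2}Q_{L_2}u_2)\|_{L^2}\le C(L_1\wedge L_2)^{\frac12}(N_1\wedge N_2)\,\|P_{N_1}Q_{L_1}u_1\|_{L^2}\|P_{N_2}Q_{L_2}u_2\|_{L^2}.$$ Assume moreover that $N_2\ge4N_1$ or $N_1\ge4N_2$. Then $$\|(P_{N_1}Q_{L_1}u_1)(P_{N_2}Q_{L_2}u_2)\|_{L^2}\le C\,\frac{(N_1\wedge N_2)^{\frac12}}{N_1\vee N_2}(L_1\vee L_2)^{\frac12}(L_1\wedge L_2)^{\frac12}\,\|P_{N_1}Q_{L_1}u_1\|_{L^2}\|P_{N_2}Q_{L_2}u_2\|_{L^2}.$$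
   Context: $A\wedge B=\min(A,B)$, $A\vee B=\max(A,B)$. Functions depend on $(x,y,t)$ with $(x,y,t)\in\mathbb R^3$ or $(x,y,t)\in\mathbb R\times\mathbb T\times\mathbb R$ ($\mathbb T=\mathbb R/2\pi\mathbb Z$); the dual Fourier variables are $(\xi,\mu,\tau)$, with $\mu\in\mathbb R$ in the first case and $\mu\in\mathbb Z$ in the second. $|(\xi,\mu)|=\sqrt{3\xi^2+\mu^2}$, $w(\xi,\mu)=\xi^3+\xi\mu^2$. Fix $\eta\in C_0^\infty(\mathbb R)$ with $0\le\eta\le1$, $\eta=1$ on $[-5/4,5/4]$, $\mathrm{supp}\,\eta\subset[-8/5,8/5]$, and $\phi(r)=\eta(r)-\eta(2r)$. For $k\ge1$: $\phi_{2^k}(\xi,\mu)=\phi(2^{-k}|(\xi,\mu)|)$ and $\psi_{2^k}(\xi,\mu,\tau)=\phi(2^{-k}(\tau-w(\xi,\mu)))$; also $\phi_1(\xi,\mu)=\eta(|(\xi,\mu)|)$ and $\psi_1(\xi,\mu,\tau)=\eta(\tau-w(\xi,\mu))$. $P_N$ is the Fourier multiplier in $(x,y)$ with symbol $\phi_N$, and $Q_L$ is the space-time Fourier multiplier with symbol $\psi_L$. *)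

theory Defs
  imports "HOL-Analysis.Analysis"
begin

section \<open>Square-integrable functions\<close>

text \<open>Elements of \<open>L\<^sup>2\<close> are represented by measurable functions, not by classes modulo null sets.\<close>

definition L2_space :: "'a measure \<Rightarrow> ('a \<Rightarrow> complex) set" where
  "L2_space M = {f \<in> borel_measurable M. integrable M (\<lambda>z. (cmod (f z))\<^sup>2)}"

text \<open>The norm is meaningful only on \<^const>\<open>L2_space\<close>: a Bochner integral of a
  non-integrable function is 0.\<close>

definition L2_norm :: "'a measure \<Rightarrow> ('a \<Rightarrow> complex) \<Rightarrow> real" where
  "L2_norm M f = sqrt (\<integral>z. (cmod (f z))\<^sup>2 \<partial>M)"

definition L2_tendsto :: "'a measure \<Rightarrow> (nat \<Rightarrow> 'a \<Rightarrow> complex) \<Rightarrow> ('a \<Rightarrow> complex) \<Rightarrow> bool" where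
  "L2_tendsto M f g \<longleftrightarrow> (\<forall>n. f n \<in> L2_space M) \<and> g \<in> L2_space M \<and>
     (\<lambda>n. L2_norm M (\<lambda>z. f n z - g z)) \<longlonglongrightarrow> 0"

definition L2_lim :: "'a measure \<Rightarrow> (nat \<Rightarrow> 'a \<Rightarrow> complex) \<Rightarrow> 'a \<Rightarrow> complex" where
  "L2_lim M f = (SOME g. L2_tendsto M f g)"

section \<open>The two domains and their duals\<close>

text \<open>The variable \<open>y\<close> ranges over the line or over the circle \<open>\<real>/2\<pi>\<int>\<close>. Functions on the circle are
  functions on the fundamental domain \<open>[0,2\<pi>)\<close>, and the dual group \<open>\<int>\<close> of the circle, with
  counting measure, is taken inside the reals.\<close>

datatype y_domain = Line | Circle

primrec y_measure :: "y_domain \<Rightarrow> real measure" where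
  "y_measure Line = lborel"
| "y_measure Circle = restrict_space lborel {0..<2 * pi}"

primrec mu_measure :: "y_domain \<Rightarrow> real measure" where
  "mu_measure Line = lborel"
| "mu_measure Circle = count_space \<int>"

definition spacetime :: "y_domain \<Rightarrow> (real \<times> real \<times> real) measure" where
  "spacetime D = lborel \<Otimes>\<^sub>M (y_measure D \<Otimes>\<^sub>M lborel)"

text \<open>Carries both functions of \<open>(\<xi>,\<mu>,\<tau>)\<close> and, after a transform in \<open>(x,y)\<close> only,
  functions of \<open>(\<xi>,\<mu>,t)\<close>.\<close>

definition frequency :: "y_domain \<Rightarrow> (real \<times> real \<times> real) measure" where
  "frequency D = lborel \<Otimes>\<^sub>M (mu_measure D \<Otimes>\<^sub>M lborel)"

section \<open>Fourier transforms on \<open>L\<^sup>2\<close>\<close>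

text \<open>By Plancherel's theorem the transform of an \<open>L\<^sup>2\<close> function is the \<open>L\<^sup>2\<close>-limit of the
  transforms of its truncations to \<open>[-n,n]\<close> in each variable being transformed.\<close>

definition cube2 :: "nat \<Rightarrow> (real \<times> real) set" where
  "cube2 n = {-real n..real n} \<times> {-real n..real n}"

definition cube3 :: "nat \<Rightarrow> (real \<times> real \<times> real) set" where
  "cube3 n = {-real n..real n} \<times> {-real n..real n} \<times> {-real n..real n}"

definition fourier ::
  "y_domain \<Rightarrow> (real \<times> real \<times> real \<Rightarrow> complex) \<Rightarrow> real \<times> real \<times> real \<Rightarrow> complex" where
  "fourier D u = L2_lim (frequency D) (\<lambda>n (\<xi>, \<mu>, \<tau>).
     set_lebesgue_integral (spacetime D) (cube3 n)
       (\<lambda>(x, y, t). cis (- (x * \<xi> + y * \<mu> + t * \<tau>)) * u (x, y, t)))"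

definition inv_fourier ::
  "y_domain \<Rightarrow> (real \<times> real \<times> real \<Rightarrow> complex) \<Rightarrow> real \<times> real \<times> real \<Rightarrow> complex" where
  "inv_fourier D g = L2_lim (spacetime D) (\<lambda>n (x, y, t).
     complex_of_real (1 / (2 * pi) ^ 3) * set_lebesgue_integral (frequency D) (cube3 n)
       (\<lambda>(\<xi>, \<mu>, \<tau>). cis (x * \<xi> + y * \<mu> + t * \<tau>) * g (\<xi>, \<mu>, \<tau>)))"

definition fourier_xy ::
  "y_domain \<Rightarrow> (real \<times> real \<times> real \<Rightarrow> complex) \<Rightarrow> real \<times> real \<times> real \<Rightarrow> complex" where
  "fourier_xy D u = L2_lim (frequency D) (\<lambda>n (\<xi>, \<mu>, t).
     set_lebesgue_integral (lborel \<Otimes>\<^sub>M y_measure D) (cube2 n)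
       (\<lambda>(x, y). cis (- (x * \<xi> + y * \<mu>)) * u (x, y, t)))"

definition inv_fourier_xy ::
  "y_domain \<Rightarrow> (real \<times> real \<times> real \<Rightarrow> complex) \<Rightarrow> real \<times> real \<times> real \<Rightarrow> complex" where
  "inv_fourier_xy D g = L2_lim (spacetime D) (\<lambda>n (x, y, t).
     complex_of_real (1 / (2 * pi) ^ 2) * set_lebesgue_integral (lborel \<Otimes>\<^sub>M mu_measure D) (cube2 n)
       (\<lambda>(\<xi>, \<mu>). cis (x * \<xi> + y * \<mu>) * g (\<xi>, \<mu>, t)))"

definition multiplier ::
  "y_domain \<Rightarrow> (real \<Rightarrow> real \<Rightarrow> real \<Rightarrow> real) \<Rightarrow>
   (real \<times> real \<times> real \<Rightarrow> complex) \<Rightarrow> real \<times> real \<times> real \<Rightarrow> complex" where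
  "multiplier D m u =
     inv_fourier D (\<lambda>(\<xi>, \<mu>, \<tau>). complex_of_real (m \<xi> \<mu> \<tau>) * fourier D u (\<xi>, \<mu>, \<tau>))"

definition multiplier_xy ::
  "y_domain \<Rightarrow> (real \<Rightarrow> real \<Rightarrow> real) \<Rightarrow>
   (real \<times> real \<times> real \<Rightarrow> complex) \<Rightarrow> real \<times> real \<times> real \<Rightarrow> complex" where
  "multiplier_xy D m u =
     inv_fourier_xy D (\<lambda>(\<xi>, \<mu>, t). complex_of_real (m \<xi> \<mu>) * fourier_xy D u (\<xi>, \<mu>, t))"

section \<open>Dyadic localization\<close>

definition freq_size :: "real \<Rightarrow> real \<Rightarrow> real" where
  "freq_size \<xi> \<mu> = sqrt (3 * \<xi>\<^sup>2 + \<mu>\<^sup>2)"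

definition dispersion :: "real \<Rightarrow> real \<Rightarrow> real" where
  "dispersion \<xi> \<mu> = \<xi> ^ 3 + \<xi> * \<mu>\<^sup>2"

definition cutoff :: "(real \<Rightarrow> real) \<Rightarrow> bool" where
  "cutoff \<eta> \<longleftrightarrow>
     (\<forall>k r. (deriv ^^ k) \<eta> differentiable (at r)) \<and>
     (\<forall>r. 0 \<le> \<eta> r \<and> \<eta> r \<le> 1) \<and>
     (\<forall>r\<in>{-5/4..5/4}. \<eta> r = 1) \<and>
     closure {r. \<eta> r \<noteq> 0} \<subseteq> {-8/5..8/5}"

definition dyadic :: "real set" where
  "dyadic = {2 ^ k | k::nat. k \<ge> 1} \<union> {1}"

definition bump :: "(real \<Rightarrow> real) \<Rightarrow> real \<Rightarrow> real" where
  "bump \<eta> r = \<eta> r - \<eta> (2 * r)"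

definition phi :: "(real \<Rightarrow> real) \<Rightarrow> real \<Rightarrow> real \<Rightarrow> real \<Rightarrow> real" where
  "phi \<eta> N \<xi> \<mu> = (if N = 1 then \<eta> (freq_size \<xi> \<mu>) else bump \<eta> (freq_size \<xi> \<mu> / N))"

definition psi :: "(real \<Rightarrow> real) \<Rightarrow> real \<Rightarrow> real \<Rightarrow> real \<Rightarrow> real \<Rightarrow> real" where
  "psi \<eta> L \<xi> \<mu> \<tau> = (if L = 1 then \<eta> (\<tau> - dispersion \<xi> \<mu>) else bump \<eta> ((\<tau> - dispersion \<xi> \<mu>) / L))"

definition P_proj ::
  "(real \<Rightarrow> real) \<Rightarrow> y_domain \<Rightarrow> real \<Rightarrow>
   (real \<times> real \<times> real \<Rightarrow> complex) \<Rightarrow> real \<times> real \<times> real \<Rightarrow> complex" where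
  "P_proj \<eta> D N = multiplier_xy D (phi \<eta> N)"

definition Q_proj ::
  "(real \<Rightarrow> real) \<Rightarrow> y_domain \<Rightarrow> real \<Rightarrow>
   (real \<times> real \<times> real \<Rightarrow> complex) \<Rightarrow> real \<times> real \<times> real \<Rightarrow> complex" where
  "Q_proj \<eta> D L = multiplier D (psi \<eta> L)"

end

theory Submission imports Defs "HOL-Probability.Probability" begin

text \<open>
  Write \<open>v\<^sub>i = P Q u\<^sub>i\<close> for the two localized functions. The space-time Fourier transform of \<open>v\<^sub>i\<close>
  lives on the set \<open>S\<^sub>i\<close> of all \<open>(\<xi>,\<mu>,\<tau>)\<close> with \<open>|(\<xi>,\<mu>)|\<close> comparable to \<open>N\<^sub>i\<close>
  (at most 8/5, if \<open>N\<^sub>i = 1\<close>) and \<open>|\<tau> - w(\<xi>,\<mu>)| \<le> 8/5 L\<^sub>i\<close>. This set is bounded, so \<open>v\<^sub>i\<close> is an absolutely convergent inverse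
  transform of some \<open>g\<^sub>i\<close> supported in \<open>S\<^sub>i\<close> (\<open>PQ_representation\<close>), and \<open>v\<^sub>1 v\<^sub>2\<close> is the inverse transform
  of the convolution of \<open>g\<^sub>1\<close> and \<open>g\<^sub>2\<close>. The Cauchy-Schwarz inequality in the convolution integral and
  Plancherel's theorem give \<open>\<parallel>v\<^sub>1 v\<^sub>2\<parallel> \<le> K\<^sup>1\<^sup>/\<^sup>2 \<parallel>v\<^sub>1\<parallel> \<parallel>v\<^sub>2\<parallel>\<close> as soon as \<open>S\<^sub>1 \<inter> (\<zeta> - S\<^sub>2)\<close> has measure
  at most \<open>K\<close> for every \<open>\<zeta>\<close> (\<open>product_L2_bound\<close>).

  It remains to measure \<open>S\<^sub>1 \<inter> (\<zeta> - S\<^sub>2)\<close>. Over a fixed \<open>(\<xi>,\<mu>)\<close> the variable \<open>\<tau>\<close> is confined to two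
  intervals, the shorter of length comparable to \<open>L\<^sub>1 \<and> L\<^sub>2\<close>, and \<open>(\<xi>,\<mu>)\<close> is confined to a box of side
  comparable to \<open>N = N\<^sub>1 \<and> N\<^sub>2\<close>. Since \<open>N \<ge> 1\<close>, such a box has measure at most \<open>20 N\<^sup>2\<close> also when \<open>\<mu>\<close>
  runs over the integers (\<open>fibre_bound_box\<close>). If moreover \<open>4 N\<^sub>1 \<le> N\<^sub>2\<close>, the two conditions on \<open>\<tau>\<close> keep
  the resonance function \<open>w(\<xi>,\<mu>) + w(\<zeta> - (\<xi>,\<mu>))\<close> in an interval of length comparable to \<open>L\<^sub>1 \<or> L\<^sub>2\<close>. Its
  derivative in \<open>\<xi>\<close> is \<open>|(\<xi>,\<mu>)|\<^sup>2 - |\<zeta> - (\<xi>,\<mu>)|\<^sup>2\<close>, of size \<open>N\<^sub>2\<^sup>2\<close>, so for each \<open>\<mu>\<close> the variable \<open>\<xi>\<close>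
  is left with a set of measure at most a multiple of \<open>(L\<^sub>1 \<or> L\<^sub>2) / N\<^sub>2\<^sup>2\<close>
  (\<open>fibre_bound_separated\<close>), while \<open>\<mu>\<close> has room of measure at most \<open>5 N\<^sub>1\<close>.

  The operators \<open>P\<close> and \<open>Q\<close> compose two different Fourier transforms, one in all variables and one in
  \<open>(x,y)\<close> with \<open>t\<close> as a parameter, each defined as an \<open>L\<^sup>2\<close>-limit of truncated integrals. Both are handled
  by one abstract principle (locale \<open>isometry_adjoint\<close>). On truncated functions the inverse transform \<open>A\<close>
  multiplies norms by a constant and the forward transform \<open>B\<close> is its adjoint. Then \<open>B\<close> is bounded by
  duality, both limits exist by completeness of \<open>L\<^sup>2\<close>, and the transform of \<open>f\<close> is determined by its inner
  products with truncated functions, where it acts as the adjoint of \<open>A\<close>. The isometry of \<open>A\<close> is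
  orthogonality of the exponentials on the circle and a Gaussian summation argument on the line;
  Fubini's theorem extends it to several variables.
\<close>

section \<open>Square-integrable functions\<close>


text \<open>The squared norm as an extended real: unlike \<open>L2_norm\<close> it is meaningful before square integrability
  is known, so the estimates below bound it and conclude membership in \<open>L\<^sup>2\<close> afterwards.\<close>

abbreviation L2_mass :: "'a measure \<Rightarrow> ('a \<Rightarrow> complex) \<Rightarrow> ennreal" where
  "L2_mass M f \<equiv> \<integral>\<^sup>+z. ennreal ((cmod (f z))\<^sup>2) \<partial>M"

lemma L2_spaceD:
  assumes "f \<in> L2_space M"
  shows "f \<in> borel_measurable M" "integrable M (\<lambda>z. (cmod (f z))\<^sup>2)"
  using assms by (auto simp: L2_space_def)

lemma L2_norm_nonneg [simp]: "0 \<le> L2_norm M f"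
  by (simp add: L2_norm_def)

lemma L2_norm_power2: "(L2_norm M f)\<^sup>2 = (\<integral>z. (cmod (f z))\<^sup>2 \<partial>M)"
  by (simp add: L2_norm_def)

lemma nn_integral_L2:
  assumes "f \<in> L2_space M"
  shows "L2_mass M f = ennreal ((L2_norm M f)\<^sup>2)"
  unfolding L2_norm_power2 using L2_spaceD[OF assms] by (intro nn_integral_eq_integral) auto

lemma L2_spaceI:
  assumes "f \<in> borel_measurable M" "L2_mass M f \<le> ennreal C"
  shows "f \<in> L2_space M"
  using assms unfolding L2_space_def
  by (auto intro!: integrableI_bounded simp: le_less_trans[OF _ ennreal_less_top])

lemma L2_norm_leI:
  assumes "L2_mass M f \<le> ennreal (C\<^sup>2)" "f \<in> borel_measurable M" "0 \<le> C"
  shows "L2_norm M f \<le> C"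
proof -
  have "ennreal ((L2_norm M f)\<^sup>2) \<le> ennreal (C\<^sup>2)"
    using nn_integral_L2[OF L2_spaceI[OF assms(2,1)]] assms(1) by simp
  then show ?thesis using \<open>0 \<le> C\<close> by (auto intro: power2_le_imp_le)
qed

lemma L2_norm_eqI:
  assumes "L2_mass M f = ennreal (C\<^sup>2)" "f \<in> borel_measurable M" "0 \<le> C"
  shows "L2_norm M f = C"
proof -
  have "ennreal ((L2_norm M f)\<^sup>2) = ennreal (C\<^sup>2)"
    using nn_integral_L2[OF L2_spaceI[OF assms(2) order_eq_refl[OF assms(1)]]] assms(1) by simp
  then show ?thesis using \<open>0 \<le> C\<close> by (metis L2_norm_nonneg ennreal_inj power2_eq_imp_eq zero_le_power2)
qed

lemma L2_space_bounded:
  assumes "f \<in> L2_space M" "g \<in> borel_measurable M" "AE z in M. cmod (g z) \<le> C * cmod (f z)"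
  shows "g \<in> L2_space M"
proof -
  note [measurable] = L2_spaceD[OF assms(1)] assms(2)
  have "integrable M (\<lambda>z. C\<^sup>2 * (cmod (f z))\<^sup>2)" by (auto intro: L2_spaceD[OF assms(1)])
  then have "integrable M (\<lambda>z. (cmod (g z))\<^sup>2)"
  proof (rule Bochner_Integration.integrable_bound)
    show "AE z in M. norm ((cmod (g z))\<^sup>2) \<le> norm (C\<^sup>2 * (cmod (f z))\<^sup>2)"
      using assms(3)
    proof eventually_elim
      case (elim z)
      have "(cmod (g z))\<^sup>2 \<le> (C * cmod (f z))\<^sup>2" using elim by (intro power_mono) auto
      then show ?case by (simp add: power_mult_distrib)
    qed
  qed simp
  then show ?thesis using assms(2) by (simp add: L2_space_def)
qed

lemma L2_space_add:
  assumes "f \<in> L2_space M" "g \<in> L2_space M"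
  shows "(\<lambda>z. f z + g z) \<in> L2_space M"
proof -
  note [measurable] = L2_spaceD(1)[OF assms(1)] L2_spaceD(1)[OF assms(2)]
  have "integrable M (\<lambda>z. 2 * (cmod (f z))\<^sup>2 + 2 * (cmod (g z))\<^sup>2)"
    using L2_spaceD(2)[OF assms(1)] L2_spaceD(2)[OF assms(2)] by auto
  then have "integrable M (\<lambda>z. (cmod (f z + g z))\<^sup>2)"
  proof (rule Bochner_Integration.integrable_bound)
    have *: "(cmod (a + b))\<^sup>2 \<le> 2 * (cmod a)\<^sup>2 + 2 * (cmod b)\<^sup>2" for a b
    proof -
      have "(cmod (a + b))\<^sup>2 \<le> (cmod a + cmod b)\<^sup>2" by (intro power_mono norm_triangle_ineq) auto
      moreover have "0 \<le> (cmod a - cmod b)\<^sup>2" by simp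
      ultimately show ?thesis by (simp add: power2_eq_square algebra_simps)
    qed
    show "AE z in M. norm ((cmod (f z + g z))\<^sup>2) \<le> norm (2 * (cmod (f z))\<^sup>2 + 2 * (cmod (g z))\<^sup>2)"
      using * by (auto simp del: norm_add_rule_thm)
  qed simp
  then show ?thesis by (simp add: L2_space_def)
qed

lemma L2_space_cmult: "f \<in> L2_space M \<Longrightarrow> (\<lambda>z. a * f z) \<in> L2_space M"
  by (rule L2_space_bounded[of f M _ "cmod a"]) (auto simp: norm_mult dest: L2_spaceD)

lemma L2_norm_cmult: "L2_norm M (\<lambda>z. a * f z) = cmod a * L2_norm M f"
  by (simp add: L2_norm_def norm_mult power_mult_distrib real_sqrt_mult)

lemma L2_space_diff:
  assumes "f \<in> L2_space M" "g \<in> L2_space M"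
  shows "(\<lambda>z. f z - g z) \<in> L2_space M"
  using L2_space_add[OF assms(1) L2_space_cmult[OF assms(2), of "-1"]] by simp

lemma L2_space_zero: "(\<lambda>z. 0) \<in> L2_space M"
  by (simp add: L2_space_def)

lemma L2_space_indicator:
  assumes "f \<in> L2_space M" "S \<inter> space M \<in> sets M"
  shows "(\<lambda>z. indicator S z * f z) \<in> L2_space M"
proof (rule L2_space_bounded[OF assms(1), of _ 1])
  note [measurable] = L2_spaceD(1)[OF assms(1)]
  have [measurable]: "(indicator S :: _ \<Rightarrow> complex) \<in> borel_measurable M"
    using assms(2) by (subst borel_measurable_indicator_iff) auto
  show "(\<lambda>z. indicator S z * f z) \<in> borel_measurable M" by measurable
qed (auto simp: indicator_def)

lemma L2_norm_cong_AE:
  assumes "AE z in M. f z = g z" "f \<in> borel_measurable M" "g \<in> borel_measurable M"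
  shows "L2_norm M f = L2_norm M g"
  unfolding L2_norm_def using assms by (auto intro!: arg_cong[where f = sqrt] integral_cong_AE)

lemma L2_norm_zero_AE:
  assumes "f \<in> L2_space M" "L2_norm M f = 0"
  shows "AE z in M. f z = 0"
  using assms integral_nonneg_eq_0_iff_AE[OF L2_spaceD(2)[OF assms(1)]]
  by (auto simp: L2_norm_def)

definition L2_inner :: "'a measure \<Rightarrow> ('a \<Rightarrow> complex) \<Rightarrow> ('a \<Rightarrow> complex) \<Rightarrow> complex" where
  "L2_inner M f g = (\<integral>z. f z * cnj (g z) \<partial>M)"

lemma borel_measurable_cnj [measurable]:
  "f \<in> borel_measurable M \<Longrightarrow> (\<lambda>z. cnj (f z)) \<in> borel_measurable M"
  by (rule borel_measurable_continuous_on[of cnj]) (auto intro!: continuous_intros)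

lemma L2_inner_integrable_norm:
  assumes "f \<in> L2_space M" "g \<in> L2_space M"
  shows "integrable M (\<lambda>z. cmod (f z) * cmod (g z))"
proof -
  note [measurable] = L2_spaceD(1)[OF assms(1)] L2_spaceD(1)[OF assms(2)]
  have "integrable M (\<lambda>z. (cmod (f z))\<^sup>2 + (cmod (g z))\<^sup>2)"
    using L2_spaceD(2)[OF assms(1)] L2_spaceD(2)[OF assms(2)] by auto
  then show ?thesis
  proof (rule Bochner_Integration.integrable_bound)
    have *: "a * b \<le> a\<^sup>2 + b\<^sup>2" if "0 \<le> a" "0 \<le> b" for a b :: real
    proof -
      have "0 \<le> (a - b)\<^sup>2" "0 \<le> a * b" using that by auto
      then show ?thesis by (simp add: power2_eq_square algebra_simps)
    qed
    show "AE z in M. norm (cmod (f z) * cmod (g z)) \<le> norm ((cmod (f z))\<^sup>2 + (cmod (g z))\<^sup>2)"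
      using * by (auto simp del: norm_add_rule_thm)
  qed simp
qed

lemma L2_inner_integrable:
  assumes "f \<in> L2_space M" "g \<in> L2_space M"
  shows "integrable M (\<lambda>z. f z * cnj (g z))"
  by (rule Bochner_Integration.integrable_bound[OF L2_inner_integrable_norm[OF assms]])
     (use assms in \<open>auto simp: norm_mult dest!: L2_spaceD(1)\<close>)

lemma L2_Cauchy_Schwarz_norm:
  assumes "f \<in> L2_space M" "g \<in> L2_space M"
  shows "(\<integral>z. cmod (f z) * cmod (g z) \<partial>M) \<le> L2_norm M f * L2_norm M g"
proof -
  note [measurable] = L2_spaceD(1)[OF assms(1)] L2_spaceD(1)[OF assms(2)]
  have "ennreal ((\<integral>z. cmod (f z) * cmod (g z) \<partial>M)\<^sup>2) = (\<integral>\<^sup>+z. ennreal (cmod (f z)) * ennreal (cmod (g z)) \<partial>M)\<^sup>2"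
    using L2_inner_integrable_norm[OF assms]
    by (subst ennreal_power[symmetric], simp, subst nn_integral_eq_integral[symmetric]) (auto simp: ennreal_mult)
  also have "\<dots> \<le> (\<integral>\<^sup>+z. ennreal (cmod (f z)) ^ 2 \<partial>M) * (\<integral>\<^sup>+z. ennreal (cmod (g z)) ^ 2 \<partial>M)"
    by (rule Cauchy_Schwarz_nn_integral) auto
  also have "\<dots> = ennreal ((L2_norm M f * L2_norm M g)\<^sup>2)"
    using nn_integral_L2[OF assms(1)] nn_integral_L2[OF assms(2)]
    by (simp add: ennreal_power power_mult_distrib ennreal_mult)
  finally show ?thesis by (auto intro: power2_le_imp_le)
qed

lemma L2_Cauchy_Schwarz:
  assumes "f \<in> L2_space M" "g \<in> L2_space M"
  shows "cmod (L2_inner M f g) \<le> L2_norm M f * L2_norm M g"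
  using integral_norm_bound[of M "\<lambda>z. f z * cnj (g z)"] L2_Cauchy_Schwarz_norm[OF assms]
  by (simp add: L2_inner_def norm_mult)

lemma L2_inner_diff_right:
  assumes "f \<in> L2_space M" "g \<in> L2_space M" "h \<in> L2_space M"
  shows "L2_inner M h (\<lambda>z. f z - g z) = L2_inner M h f - L2_inner M h g"
  unfolding L2_inner_def
  by (subst Bochner_Integration.integral_diff[symmetric])
     (use assms in \<open>auto intro: L2_inner_integrable simp: algebra_simps\<close>)

lemma L2_inner_cmult_right: "L2_inner M f (\<lambda>z. a * h z) = cnj a * L2_inner M f h"
  unfolding L2_inner_def by (subst integral_mult_right_zero[symmetric]) (simp add: algebra_simps)

lemma L2_inner_self: "L2_inner M f f = complex_of_real ((L2_norm M f)\<^sup>2)"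
  unfolding L2_inner_def L2_norm_power2 complex_norm_square[symmetric]
  by (simp add: integral_complex_of_real[symmetric])

lemma L2_norm_add_power2:
  assumes "f \<in> L2_space M" "g \<in> L2_space M"
  shows "(L2_norm M (\<lambda>z. f z + g z))\<^sup>2 = (L2_norm M f)\<^sup>2 + (L2_norm M g)\<^sup>2 + 2 * Re (L2_inner M f g)"
proof -
  have *: "(cmod (a + b))\<^sup>2 = (cmod a)\<^sup>2 + (cmod b)\<^sup>2 + 2 * Re (a * cnj b)" for a b
    unfolding cmod_power2 by (simp add: power2_eq_square algebra_simps)
  have "(L2_norm M (\<lambda>z. f z + g z))\<^sup>2 = (\<integral>z. (cmod (f z))\<^sup>2 + (cmod (g z))\<^sup>2 + 2 * Re (f z * cnj (g z)) \<partial>M)"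
    unfolding L2_norm_power2 * ..
  also have "\<dots> = (L2_norm M f)\<^sup>2 + (L2_norm M g)\<^sup>2 + 2 * Re (L2_inner M f g)"
    unfolding L2_norm_power2 L2_inner_def
    using L2_spaceD(2)[OF assms(1)] L2_spaceD(2)[OF assms(2)] L2_inner_integrable[OF assms]
    by (simp only: integral_mult_right_zero integral_Re integrable_Re Bochner_Integration.integral_add
        Bochner_Integration.integrable_add integrable_mult_right)
  finally show ?thesis .
qed

lemma L2_norm_triangle:
  assumes "f \<in> L2_space M" "g \<in> L2_space M"
  shows "L2_norm M (\<lambda>z. f z + g z) \<le> L2_norm M f + L2_norm M g"
proof (rule power2_le_imp_le)
  have "Re (L2_inner M f g) \<le> L2_norm M f * L2_norm M g"
    using L2_Cauchy_Schwarz[OF assms] complex_Re_le_cmod order_trans by blast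
  then show "(L2_norm M (\<lambda>z. f z + g z))\<^sup>2 \<le> (L2_norm M f + L2_norm M g)\<^sup>2"
    unfolding L2_norm_add_power2[OF assms] by (simp add: power2_eq_square algebra_simps)
qed simp

lemma L2_norm_minus_commute: "L2_norm M (\<lambda>z. f z - g z) = L2_norm M (\<lambda>z. g z - f z)"
  by (simp add: L2_norm_def norm_minus_commute)

lemma L2_norm_triangle_diff:
  assumes "f \<in> L2_space M" "g \<in> L2_space M" "h \<in> L2_space M"
  shows "L2_norm M (\<lambda>z. f z - h z) \<le> L2_norm M (\<lambda>z. f z - g z) + L2_norm M (\<lambda>z. g z - h z)"
  using L2_norm_triangle[OF L2_space_diff[OF assms(1,2)] L2_space_diff[OF assms(2,3)]] by simp

lemma L2_norm_diff_bound:
  assumes "f \<in> L2_space M" "g \<in> L2_space M"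
  shows "\<bar>L2_norm M f - L2_norm M g\<bar> \<le> L2_norm M (\<lambda>z. f z - g z)"
  using L2_norm_triangle_diff[OF assms L2_space_zero] L2_norm_triangle_diff[OF assms(2,1) L2_space_zero]
  by (simp add: L2_norm_minus_commute[of M f g])

text \<open>Polarization. The norms of \<open>f + a g\<close> for \<open>a \<in> {1, -1, \<i>, -\<i>}\<close> determine the real and the imaginary
  part of the inner product of \<open>f\<close> and \<open>g\<close>.\<close>

lemma L2_isometry_inner:
  assumes "f \<in> L2_space M" "g \<in> L2_space M" "f' \<in> L2_space M'" "g' \<in> L2_space M'"
    and "\<And>a. (L2_norm M' (\<lambda>z. f' z + a * g' z))\<^sup>2 = c * (L2_norm M (\<lambda>z. f z + a * g z))\<^sup>2"
  shows "L2_inner M' f' g' = complex_of_real c * L2_inner M f g"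
proof -
  have f: "(L2_norm M' f')\<^sup>2 = c * (L2_norm M f)\<^sup>2" using assms(5)[of 0] by simp
  have A: "(L2_norm M' f')\<^sup>2 + (cmod a)\<^sup>2 * (L2_norm M' g')\<^sup>2 + 2 * Re (cnj a * L2_inner M' f' g') =
     c * ((L2_norm M f)\<^sup>2 + (cmod a)\<^sup>2 * (L2_norm M g)\<^sup>2 + 2 * Re (cnj a * L2_inner M f g))" for a
    using assms(5)[of a] L2_norm_add_power2[OF assms(1) L2_space_cmult[OF assms(2)], of a]
       L2_norm_add_power2[OF assms(3) L2_space_cmult[OF assms(4)], of a]
    by (simp add: L2_norm_cmult power_mult_distrib L2_inner_cmult_right)
  show ?thesis
  proof (rule complex_eqI)
    show "Re (L2_inner M' f' g') = Re (complex_of_real c * L2_inner M f g)"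
      using A[of 1] A[of "-1"] f by (simp add: algebra_simps)
    show "Im (L2_inner M' f' g') = Im (complex_of_real c * L2_inner M f g)"
      using A[of \<i>] A[of "-\<i>"] f by (simp add: algebra_simps)
  qed
qed

lemma L2_tendstoD:
  assumes "L2_tendsto M f g"
  shows "\<And>n. f n \<in> L2_space M" "g \<in> L2_space M" "(\<lambda>n. L2_norm M (\<lambda>z. f n z - g z)) \<longlonglongrightarrow> 0"
  using assms by (auto simp: L2_tendsto_def)

lemma L2_lim_tendsto: "L2_tendsto M f g \<Longrightarrow> L2_tendsto M f (L2_lim M f)"
  unfolding L2_lim_def by (rule someI[where P = "L2_tendsto M f"])

lemma L2_tendsto_cmult:
  assumes "L2_tendsto M f g" shows "L2_tendsto M (\<lambda>n z. a * f n z) (\<lambda>z. a * g z)"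
proof -
  have "L2_norm M (\<lambda>z. a * f n z - a * g z) = cmod a * L2_norm M (\<lambda>z. f n z - g z)" for n
    using L2_norm_cmult[of M a "\<lambda>z. f n z - g z"] by (simp add: right_diff_distrib)
  then show ?thesis
    using L2_tendstoD[OF assms] tendsto_mult_left[of _ 0 sequentially "cmod a"]
    by (simp add: L2_tendsto_def L2_space_cmult)
qed

lemma L2_tendsto_norm:
  assumes "L2_tendsto M f g" shows "(\<lambda>n. L2_norm M (f n)) \<longlonglongrightarrow> L2_norm M g"
proof (rule Lim_transform2[OF tendsto_const])
  note L = L2_tendstoD[OF assms]
  show "(\<lambda>n. L2_norm M g - L2_norm M (f n)) \<longlonglongrightarrow> 0"
    by (rule tendsto_0_le[OF L(3), of _ 1])
       (use L2_norm_diff_bound[OF L(2) L(1)] in \<open>auto simp: L2_norm_minus_commute[of M g]\<close>)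
qed

lemma L2_tendsto_inner_right:
  assumes "L2_tendsto M f g" "h \<in> L2_space M"
  shows "(\<lambda>n. L2_inner M h (f n)) \<longlonglongrightarrow> L2_inner M h g"
proof (rule Lim_transform2[OF tendsto_const])
  note L = L2_tendstoD[OF assms(1)]
  have "cmod (L2_inner M h g - L2_inner M h (f n)) \<le> L2_norm M (\<lambda>z. f n z - g z) * L2_norm M h" for n
    using L2_Cauchy_Schwarz[OF assms(2) L2_space_diff[OF L(2) L(1)], of n]
    unfolding L2_inner_diff_right[OF L(2) L(1) assms(2)] L2_norm_minus_commute[of M g] by (simp add: mult.commute)
  then show "(\<lambda>n. L2_inner M h g - L2_inner M h (f n)) \<longlonglongrightarrow> 0"
    by (intro tendsto_0_le[OF L(3), of _ "L2_norm M h"]) auto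
qed

text \<open>The Fourier transforms are chosen by description as some \<open>L\<^sup>2\<close>-limit. This identifies such a choice when
  the approximating functions are eventually constant up to null sets.\<close>

lemma L2_tendsto_eventually_AE:
  assumes "L2_tendsto M f g" "V \<in> borel_measurable M"
    and "eventually (\<lambda>n. AE z in M. f n z = V z) sequentially"
  shows "AE z in M. g z = V z"
proof -
  note L = L2_tendstoD[OF assms(1)]
  obtain n where n: "AE z in M. f n z = V z" using assms(3) eventually_happens' by fastforce
  have V: "V \<in> L2_space M" by (rule L2_space_bounded[OF L(1)[of n] assms(2), of 1]) (use n in auto)
  have "eventually (\<lambda>n. L2_norm M (\<lambda>z. f n z - g z) = L2_norm M (\<lambda>z. V z - g z)) sequentially"
    using assms(3)
  proof eventually_elim
    case (elim n)
    then show ?case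
      by (intro L2_norm_cong_AE) (use L2_spaceD(1)[OF L(1)[of n]] L2_spaceD(1)[OF L(2)] assms(2) in auto)
  qed
  then have "L2_norm M (\<lambda>z. V z - g z) = 0"
    using Lim_transform_eventually[OF L(3), of "\<lambda>_. L2_norm M (\<lambda>z. V z - g z)"] by (simp add: LIMSEQ_const_iff)
  from L2_norm_zero_AE[OF L2_space_diff[OF V L(2)] this] show ?thesis by eventually_elim simp
qed

lemma L2_truncation_tendsto:
  assumes "f \<in> L2_space M" "\<And>n. S n \<inter> space M \<in> sets M" "\<And>z. z \<in> space M \<Longrightarrow> eventually (\<lambda>n. z \<in> S n) sequentially"
  shows "L2_tendsto M (\<lambda>n z. indicator (S n) z * f z) f"
proof -
  note L = L2_space_indicator[OF assms(1,2)]
  note [measurable] = L2_spaceD(1)[OF assms(1)] L2_spaceD(1)[OF L]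
  have "(\<lambda>n. (\<integral>z. (cmod (indicator (S n) z * f z - f z))\<^sup>2 \<partial>M)) \<longlonglongrightarrow> (\<integral>z. 0 \<partial>M)"
  proof (rule integral_dominated_convergence)
    show "integrable M (\<lambda>z. (cmod (f z))\<^sup>2)" using L2_spaceD[OF assms(1)] by simp
    show "AE z in M. (\<lambda>n. (cmod (indicator (S n) z * f z - f z))\<^sup>2) \<longlonglongrightarrow> 0"
    proof (rule AE_I2)
      fix z assume "z \<in> space M"
      from assms(3)[OF this] have "eventually (\<lambda>n. (cmod (indicator (S n) z * f z - f z))\<^sup>2 = 0) sequentially"
        by eventually_elim simp
      then show "(\<lambda>n. (cmod (indicator (S n) z * f z - f z))\<^sup>2) \<longlonglongrightarrow> 0" by (rule tendsto_eventually)
    qed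
    show "AE z in M. norm ((cmod (indicator (S n) z * f z - f z))\<^sup>2) \<le> (cmod (f z))\<^sup>2" for n
      by (auto simp: indicator_def)
  qed auto
  then have "(\<lambda>n. sqrt (\<integral>z. (cmod (indicator (S n) z * f z - f z))\<^sup>2 \<partial>M)) \<longlonglongrightarrow> sqrt 0"
    by (intro tendsto_intros) simp
  then show ?thesis unfolding L2_tendsto_def L2_norm_def using L assms(1) by simp
qed

lemma L2_tendsto_AE_subseq:
  assumes "L2_tendsto M f g"
  shows "\<exists>r::nat \<Rightarrow> nat. strict_mono r \<and> (AE z in M. (\<lambda>n. f (r n) z - g z) \<longlonglongrightarrow> 0)"
proof -
  note L = L2_tendstoD[OF assms]
  have "(\<lambda>n. (L2_norm M (\<lambda>z. f n z - g z))\<^sup>2) \<longlonglongrightarrow> 0\<^sup>2" by (intro tendsto_intros L(3))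
  then have "(\<lambda>n. \<integral>z. norm ((cmod (f n z - g z))\<^sup>2) \<partial>M) \<longlonglongrightarrow> 0" unfolding L2_norm_power2 by simp
  from tendsto_L1_AE_subseq[OF _ this] L2_spaceD(2)[OF L2_space_diff[OF L(1) L(2)]]
  obtain r where r: "strict_mono r" "AE z in M. (\<lambda>n. (cmod (f (r n) z - g z))\<^sup>2) \<longlonglongrightarrow> 0" by auto
  have "AE z in M. (\<lambda>n. f (r n) z - g z) \<longlonglongrightarrow> 0"
    using r(2)
  proof eventually_elim
    case (elim z)
    have "(\<lambda>n. sqrt ((cmod (f (r n) z - g z))\<^sup>2)) \<longlonglongrightarrow> sqrt 0" by (intro tendsto_intros elim)
    then show ?case by (simp add: tendsto_norm_zero_iff)
  qed
  with r(1) show ?thesis by blast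
qed

text \<open>The Riesz-Fischer theorem. A subsequence with increments \<open>d k\<close> of norm at most \<open>2\<^sup>-\<^sup>k\<close> makes
  \<open>\<Sum>\<^sub>k 2\<^sup>k |d k|\<^sup>2\<close> integrable, so the increments are summable almost everywhere; Fatou's lemma then shows that
  the pointwise limit is also the limit in norm.\<close>

lemma L2_complete:
  assumes L: "\<And>n. f n \<in> L2_space M"
    and C: "\<And>e. e > 0 \<Longrightarrow> \<exists>N. \<forall>m\<ge>N. \<forall>n\<ge>N. L2_norm M (\<lambda>z. f m z - f n z) < e"
  shows "\<exists>g. L2_tendsto M f g"
proof -
  note [measurable] = L2_spaceD(1)[OF L]
  have "\<exists>N. \<forall>m\<ge>N. \<forall>n\<ge>N. L2_norm M (\<lambda>z. f m z - f n z) < (1/2)^k" for k :: nat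
    by (rule C) simp
  then obtain N where N: "\<And>k m n. m \<ge> N k \<Longrightarrow> n \<ge> N k \<Longrightarrow> L2_norm M (\<lambda>z. f m z - f n z) < (1/2)^k"
    by metis
  \<comment> \<open>Partial sums make both \<open>r k\<close> and \<open>r (Suc k)\<close> at least \<open>N k\<close>; the summand \<open>k\<close> sends \<open>r k\<close> to infinity.\<close>
  define r where "r k = (\<Sum>i\<le>k. N i) + k" for k
  have r1: "r k \<ge> N k" "r (Suc k) \<ge> N k" for k
    using member_le_sum[of k "{..k}" N] member_le_sum[of k "{..Suc k}" N] by (auto simp: r_def simp del: sum.atMost_Suc)
  have rk: "r k \<ge> k" for k by (simp add: r_def)
  define d where "d k z = f (r (Suc k)) z - f (r k) z" for k z
  have [measurable]: "d k \<in> borel_measurable M" for k unfolding d_def by measurable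
  have dL: "d k \<in> L2_space M" for k unfolding d_def by (intro L2_space_diff L)
  have dn: "L2_norm M (d k) \<le> (1/2)^k" for k
    unfolding d_def using N[OF r1(2) r1(1), of k] by simp
  have "(\<integral>\<^sup>+z. (\<Sum>k. ennreal (2^k * (cmod (d k z))\<^sup>2)) \<partial>M) = (\<Sum>k. \<integral>\<^sup>+z. ennreal (2^k * (cmod (d k z))\<^sup>2) \<partial>M)"
    by (rule nn_integral_suminf) measurable
  also have "\<dots> \<le> (\<Sum>k. ennreal ((1/2)^k))"
  proof (rule suminf_le)
    fix k
    have "(\<integral>\<^sup>+z. ennreal (2^k * (cmod (d k z))\<^sup>2) \<partial>M) = ennreal (2^k) * ennreal ((L2_norm M (d k))\<^sup>2)"
      unfolding nn_integral_L2[OF dL, symmetric] by (subst nn_integral_cmult[symmetric]) (auto simp: ennreal_mult)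
    also have "\<dots> \<le> ennreal (2^k * ((1/2)^k)\<^sup>2)"
      by (subst ennreal_mult[symmetric], simp, simp, rule ennreal_leI, rule mult_left_mono, rule power_mono[OF dn]) simp_all
    also have "2^k * ((1/2)^k)\<^sup>2 = ((1/2)^k :: real)" by (simp add: power2_eq_square power_divide)
    finally show "(\<integral>\<^sup>+z. ennreal (2^k * (cmod (d k z))\<^sup>2) \<partial>M) \<le> ennreal ((1/2)^k)" .
  qed auto
  also have "\<dots> = ennreal (\<Sum>k. (1/2)^k)" by (intro suminf_ennreal2) auto
  also have "\<dots> < \<infinity>" by simp
  finally have "AE z in M. (\<Sum>k. ennreal (2^k * (cmod (d k z))\<^sup>2)) \<noteq> \<infinity>"
    by (intro nn_integral_PInf_AE) auto
  then have conv: "AE z in M. convergent (\<lambda>k. f (r k) z)"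
  proof eventually_elim
    case (elim z)
    have s1: "summable (\<lambda>k. 2^k * (cmod (d k z))\<^sup>2)"
      using elim by (intro summable_suminf_not_top) auto
    have s2: "summable (\<lambda>k. (1/2::real)^k)" by simp
    have "summable (\<lambda>k. 2^k * (cmod (d k z))\<^sup>2 + (1/2::real)^k)" by (intro summable_add s1 s2)
    then have "summable (\<lambda>k. d k z)"
    proof (rule summable_comparison_test')
      fix k :: nat
      \<comment> \<open>The arithmetic-geometric mean inequality, weighted so that both terms on the right are summable.\<close>
      have "0 \<le> 2^k * (cmod (d k z) - (1/2)^k)\<^sup>2" by simp
      also have "\<dots> = 2^k * (cmod (d k z))\<^sup>2 - 2 * cmod (d k z) * (2^k * (1/2)^k) + (2^k * (1/2)^k) * (1/2)^k"
        by (simp add: power2_eq_square algebra_simps)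
      also have "2^k * (1/2)^k = (1::real)" by (simp add: power_mult_distrib[symmetric])
      finally show "norm (d k z) \<le> 2^k * (cmod (d k z))\<^sup>2 + (1/2)^k"
        by simp (smt (verit) norm_ge_zero)
    qed
    then have "convergent (\<lambda>n. f (r 0) z + (\<Sum>k<n. d k z))"
      by (intro convergent_add convergent_const) (simp add: summable_iff_convergent)
    moreover have "f (r 0) z + (\<Sum>k<n. d k z) = f (r n) z" for n
      unfolding d_def sum_lessThan_telescope[of "\<lambda>k. f (r k) z"] by simp
    ultimately show ?case by simp
  qed
  define g where "g z = lim (\<lambda>k. f (r k) z)" for z
  have [measurable]: "g \<in> borel_measurable M" unfolding g_def by measurable
  have lim: "AE z in M. (\<lambda>k. f (r k) z) \<longlonglongrightarrow> g z"
    using conv by eventually_elim (simp add: g_def convergent_LIMSEQ_iff)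
  have est: "L2_mass M (\<lambda>z. f n z - g z) \<le> ennreal (e\<^sup>2)"
    if e: "e > 0" and M: "\<And>m. m \<ge> K \<Longrightarrow> L2_norm M (\<lambda>z. f n z - f m z) < e" for e K n
  proof -
    have "L2_mass M (\<lambda>z. f n z - g z) = (\<integral>\<^sup>+z. liminf (\<lambda>k. ennreal ((cmod (f n z - f (r k) z))\<^sup>2)) \<partial>M)"
    proof (rule nn_integral_cong_AE, use lim in eventually_elim)
      case (elim z)
      then have "(\<lambda>k. ennreal ((cmod (f n z - f (r k) z))\<^sup>2)) \<longlonglongrightarrow> ennreal ((cmod (f n z - g z))\<^sup>2)"
        by (intro tendsto_intros)
      then show ?case by (intro lim_imp_Liminf[symmetric]) simp_all
    qed
    also have "\<dots> \<le> liminf (\<lambda>k. \<integral>\<^sup>+z. ennreal ((cmod (f n z - f (r k) z))\<^sup>2) \<partial>M)"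
      by (rule nn_integral_liminf) measurable
    also have "\<dots> \<le> ennreal (e\<^sup>2)"
    proof (rule Liminf_le)
      show "\<forall>\<^sub>F k in sequentially. L2_mass M (\<lambda>z. f n z - f (r k) z) \<le> ennreal (e\<^sup>2)"
        using eventually_ge_at_top[of K]
      proof eventually_elim
        case (elim k)
        have "L2_norm M (\<lambda>z. f n z - f (r k) z) < e" using elim rk[of k] by (intro M) simp
        then show ?case
          unfolding nn_integral_L2[OF L2_space_diff[OF L L]]
          by (intro ennreal_leI power_mono) auto
      qed
    qed simp
    finally show ?thesis .
  qed
  have "(\<lambda>z. f (N 0) z - g z) \<in> L2_space M"
    by (rule L2_spaceI, simp, rule est[of 1 "N 0"]) (use N[of 0] in auto)
  from L2_space_diff[OF L[of "N 0"] this] have gL: "g \<in> L2_space M" by simp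
  have "(\<lambda>n. L2_norm M (\<lambda>z. f n z - g z)) \<longlonglongrightarrow> 0"
  proof (rule LIMSEQ_I)
    fix e :: real assume "e > 0"
    then obtain K where K: "\<And>m n. m \<ge> K \<Longrightarrow> n \<ge> K \<Longrightarrow> L2_norm M (\<lambda>z. f m z - f n z) < e/2" using C[of "e/2"] by auto
    have "L2_norm M (\<lambda>z. f n z - g z) \<le> e/2" if "n \<ge> K" for n
      by (rule L2_norm_leI, rule est[of "e/2" K]) (use K that \<open>e > 0\<close> in auto)
    then show "\<exists>no. \<forall>n\<ge>no. norm (L2_norm M (\<lambda>z. f n z - g z) - 0) < e"
      using \<open>e > 0\<close> by (intro exI[of _ K] allI impI) (fastforce intro: le_less_trans[of _ "e/2"])
  qed
  then show ?thesis using L gL by (auto simp: L2_tendsto_def)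
qed

lemma L2_tendsto_Cauchy:
  assumes "L2_tendsto M f g" "e > 0"
  shows "\<exists>N. \<forall>m\<ge>N. \<forall>n\<ge>N. L2_norm M (\<lambda>z. f m z - f n z) < e"
proof -
  note L = L2_tendstoD[OF assms(1)]
  obtain N where N: "\<And>n. n \<ge> N \<Longrightarrow> L2_norm M (\<lambda>z. f n z - g z) < e/2"
    using LIMSEQ_D[OF L(3), of "e/2"] \<open>e > 0\<close> by auto
  have "L2_norm M (\<lambda>z. f m z - f n z) < e" if "m \<ge> N" "n \<ge> N" for m n
    using L2_norm_triangle_diff[OF L(1) L(2) L(1), of m n] N[OF that(1)] N[OF that(2)]
    by (simp add: L2_norm_minus_commute[of M g])
  then show ?thesis by blast
qed


section \<open>An isometry on truncated functions and its adjoint\<close>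

definition truncated :: "'a measure \<Rightarrow> (nat \<Rightarrow> 'a set) \<Rightarrow> ('a \<Rightarrow> complex) set" where
  "truncated M S = {f \<in> L2_space M. \<exists>n. \<forall>z. z \<notin> S n \<longrightarrow> f z = 0}"

definition exhausts :: "'a measure \<Rightarrow> (nat \<Rightarrow> 'a set) \<Rightarrow> bool" where
  "exhausts M S \<longleftrightarrow> incseq S \<and> (\<forall>n. S n \<inter> space M \<in> sets M) \<and>
     (\<forall>z\<in>space M. eventually (\<lambda>n. z \<in> S n) sequentially)"

lemma truncatedD:
  assumes "f \<in> truncated M S" shows "f \<in> L2_space M" "f \<in> borel_measurable M"
  using assms by (auto simp: truncated_def dest: L2_spaceD)

lemma truncated_indicator:
  assumes "exhausts M S" "f \<in> L2_space M"
  shows "(\<lambda>z. indicator (S n) z * f z) \<in> truncated M S"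
  using assms L2_space_indicator[of f M "S n"] by (auto simp: truncated_def exhausts_def intro!: exI[of _ n])

lemma truncated_add_cmult:
  assumes S: "exhausts M S" and f: "f \<in> truncated M S" and g: "g \<in> truncated M S"
  shows "(\<lambda>z. f z + a * g z) \<in> truncated M S"
proof -
  obtain m where m: "\<And>z. z \<notin> S m \<Longrightarrow> f z = 0" using f by (auto simp: truncated_def)
  obtain n where n: "\<And>z. z \<notin> S n \<Longrightarrow> g z = 0" using g by (auto simp: truncated_def)
  have "S m \<subseteq> S (max m n)" "S n \<subseteq> S (max m n)" using S by (auto simp: exhausts_def incseq_def)
  then have "\<forall>z. z \<notin> S (max m n) \<longrightarrow> f z + a * g z = 0" using m n by (metis add.right_neutral mult_zero_right subsetD)
  then show ?thesis
    using L2_space_add[OF truncatedD(1)[OF f] L2_space_cmult[OF truncatedD(1)[OF g]]]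
    unfolding truncated_def by blast
qed

lemma truncated_cmult:
  assumes "f \<in> truncated M S" shows "(\<lambda>z. a * f z) \<in> truncated M S"
proof -
  obtain n where "\<forall>z. z \<notin> S n \<longrightarrow> f z = 0" using assms by (auto simp: truncated_def)
  then have "\<forall>z. z \<notin> S n \<longrightarrow> a * f z = 0" by simp
  then show ?thesis using L2_space_cmult[OF truncatedD(1)[OF assms]] unfolding truncated_def by blast
qed

lemma truncated_tendsto:
  assumes "exhausts M S" "f \<in> L2_space M"
  shows "L2_tendsto M (\<lambda>n z. indicator (S n) z * f z) f"
  using assms by (intro L2_truncation_tendsto) (auto simp: exhausts_def)

text \<open>Testing the difference \<open>d = k - k'\<close> against its own truncations shows that all of them vanish.\<close>

lemma truncated_inner_unique:
  assumes S: "exhausts M S" and k: "k \<in> L2_space M" and k': "k' \<in> L2_space M"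
    and eq: "\<And>g. g \<in> truncated M S \<Longrightarrow> L2_inner M g k = L2_inner M g k'"
  shows "AE z in M. k z = k' z"
proof -
  define d where "d z = k z - k' z" for z
  have d: "d \<in> L2_space M" unfolding d_def by (intro L2_space_diff k k')
  have "L2_norm M (\<lambda>z. indicator (S n) z * d z) = 0" for n
  proof -
    define g where "g z = indicator (S n) z * d z" for z
    have g: "g \<in> truncated M S" unfolding g_def by (rule truncated_indicator[OF S d])
    have "L2_inner M g g = L2_inner M g d"
      unfolding L2_inner_def g_def by (intro Bochner_Integration.integral_cong) (auto simp: indicator_def)
    also have "\<dots> = 0" unfolding d_def using eq[OF g] by (subst L2_inner_diff_right[OF k k' truncatedD(1)[OF g]]) simp
    finally show ?thesis unfolding L2_inner_self g_def by simp
  qed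
  then have "L2_norm M d = 0"
    using L2_tendsto_norm[OF truncated_tendsto[OF S d]] by (simp add: LIMSEQ_const_iff)
  from L2_norm_zero_AE[OF d this] show ?thesis by eventually_elim (simp add: d_def)
qed

text \<open>The Fourier transforms are limits of this form: a bounded operator that is linear up to null sets, applied
  to truncations.\<close>

lemma bounded_extension_tendsto:
  assumes S: "exhausts M S" and f: "f \<in> L2_space M"
    and T: "\<And>g. g \<in> truncated M S \<Longrightarrow> T g \<in> L2_space M' \<and> L2_norm M' (T g) \<le> K * L2_norm M g"
    and lin: "\<And>g g' a. g \<in> truncated M S \<Longrightarrow> g' \<in> truncated M S \<Longrightarrow>
        AE z in M'. T (\<lambda>z. g z + a * g' z) z = T g z + a * T g' z"
    and K: "0 < K"
  shows "\<exists>G. L2_tendsto M' (\<lambda>n. T (\<lambda>z. indicator (S n) z * f z)) G"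
proof (rule L2_complete)
  define t where "t n z = indicator (S n) z * f z" for n z
  have t: "t n \<in> truncated M S" for n unfolding t_def by (rule truncated_indicator[OF S f])
  show "T (\<lambda>z. indicator (S n) z * f z) \<in> L2_space M'" for n
    using T[OF t[of n]] unfolding t_def by blast
  fix e :: real assume "e > 0"
  have "L2_norm M' (\<lambda>z. T (t m) z - T (t n) z) \<le> K * L2_norm M (\<lambda>z. t m z - t n z)" for m n
  proof -
    note d = truncated_add_cmult[OF S t t, of m "-1" n]
    have "L2_norm M' (\<lambda>z. T (t m) z - T (t n) z) = L2_norm M' (T (\<lambda>z. t m z + (-1) * t n z))"
    proof (rule L2_norm_cong_AE)
      show "AE z in M'. T (t m) z - T (t n) z = T (\<lambda>z. t m z + - 1 * t n z) z"
        using lin[OF t t, of m "-1" n] by eventually_elim simp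
      show "(\<lambda>z. T (t m) z - T (t n) z) \<in> borel_measurable M'"
        by (intro L2_spaceD(1)[OF L2_space_diff]) (use T t in auto)
    qed (use T[OF d] in \<open>auto dest: L2_spaceD\<close>)
    also have "\<dots> \<le> K * L2_norm M (\<lambda>z. t m z + (-1) * t n z)" using T[OF d] by blast
    finally show ?thesis by simp
  qed
  note bound = this
  obtain N where N: "\<And>m n. m\<ge>N \<Longrightarrow> n\<ge>N \<Longrightarrow> L2_norm M (\<lambda>z. t m z - t n z) < e / K"
    using L2_tendsto_Cauchy[OF truncated_tendsto[OF S f], of "e / K"] \<open>e > 0\<close> K unfolding t_def by auto
  have "\<forall>m\<ge>N. \<forall>n\<ge>N. L2_norm M' (\<lambda>z. T (t m) z - T (t n) z) < e"
  proof (intro allI impI)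
    fix m n assume "m \<ge> N" "n \<ge> N"
    from N[OF this] have "K * L2_norm M (\<lambda>z. t m z - t n z) < e" using K by (simp add: less_divide_eq mult.commute)
    with bound[of m n] show "L2_norm M' (\<lambda>z. T (t m) z - T (t n) z) < e" by simp
  qed
  then show "\<exists>N. \<forall>m\<ge>N. \<forall>n\<ge>N. L2_norm M' (\<lambda>z. T (\<lambda>z. indicator (S m) z * f z) z - T (\<lambda>z. indicator (S n) z * f z) z) < e"
    unfolding t_def by blast
qed

text \<open>The inverse transform \<open>A\<close> and the forward transform \<open>B\<close> on truncated functions. Linearity is required only
  almost everywhere, because for a transform with a parameter \<open>t\<close> the defining integrals may diverge for a
  null set of \<open>t\<close>. Only \<open>A\<close> is assumed to be bounded; for \<open>B\<close> local square integrability suffices to start the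
  duality argument in \<open>B_bounded\<close>.\<close>

locale isometry_adjoint =
  fixes MX :: "'a measure" and MF :: "'b measure"
    and A :: "('b \<Rightarrow> complex) \<Rightarrow> 'a \<Rightarrow> complex" and B :: "('a \<Rightarrow> complex) \<Rightarrow> 'b \<Rightarrow> complex"
    and XS :: "nat \<Rightarrow> 'a set" and FS :: "nat \<Rightarrow> 'b set" and c :: real
  assumes XS: "exhausts MX XS" and FS: "exhausts MF FS" and c_pos: "0 < c"
    and A_L2: "\<And>g. g \<in> truncated MF FS \<Longrightarrow> A g \<in> L2_space MX"
    and A_norm: "\<And>g. g \<in> truncated MF FS \<Longrightarrow> (L2_norm MX (A g))\<^sup>2 = c * (L2_norm MF g)\<^sup>2"
    and A_lin: "\<And>g g' a. g \<in> truncated MF FS \<Longrightarrow> g' \<in> truncated MF FS \<Longrightarrow>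
        AE z in MX. A (\<lambda>z. g z + a * g' z) z = A g z + a * A g' z"
    and B_meas: "\<And>f. f \<in> truncated MX XS \<Longrightarrow> B f \<in> borel_measurable MF"
    and B_loc: "\<And>f n. f \<in> truncated MX XS \<Longrightarrow> (\<lambda>z. indicator (FS n) z * B f z) \<in> L2_space MF"
    and B_lin: "\<And>g g' a. g \<in> truncated MX XS \<Longrightarrow> g' \<in> truncated MX XS \<Longrightarrow>
        AE z in MF. B (\<lambda>z. g z + a * g' z) z = B g z + a * B g' z"
    and adj: "\<And>f g. f \<in> truncated MX XS \<Longrightarrow> g \<in> truncated MF FS \<Longrightarrow> L2_inner MX (A g) f = L2_inner MF g (B f)"
begin

lemma A_norm_eq: "g \<in> truncated MF FS \<Longrightarrow> L2_norm MX (A g) = sqrt c * L2_norm MF g"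
  using A_norm[of g] c_pos by (metis L2_norm_nonneg real_sqrt_abs abs_of_nonneg real_sqrt_mult)

lemma A_tendsto:
  assumes "g \<in> L2_space MF"
  shows "\<exists>G. L2_tendsto MX (\<lambda>n. A (\<lambda>z. indicator (FS n) z * g z)) G"
  by (rule bounded_extension_tendsto[OF FS assms, of A MX "sqrt c"])
     (use A_L2 A_norm_eq A_lin c_pos in auto)

lemma A_inner:
  assumes "g \<in> truncated MF FS" "h \<in> truncated MF FS"
  shows "L2_inner MX (A g) (A h) = complex_of_real c * L2_inner MF g h"
proof (rule L2_isometry_inner)
  fix a
  note t = truncated_add_cmult[OF FS assms, of a]
  have "L2_norm MX (\<lambda>z. A g z + a * A h z) = L2_norm MX (A (\<lambda>z. g z + a * h z))"
  proof (rule L2_norm_cong_AE)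
    show "AE z in MX. A g z + a * A h z = A (\<lambda>z. g z + a * h z) z"
      using A_lin[OF assms, of a] by eventually_elim simp
    show "(\<lambda>z. A g z + a * A h z) \<in> borel_measurable MX"
      by (intro L2_spaceD(1)[OF L2_space_add] L2_space_cmult A_L2 assms)
  qed (use A_L2[OF t] in \<open>auto dest: L2_spaceD\<close>)
  then show "(L2_norm MX (\<lambda>z. A g z + a * A h z))\<^sup>2 = c * (L2_norm MF (\<lambda>z. g z + a * h z))\<^sup>2"
    using A_norm[OF t] by simp
qed (use assms A_L2 truncatedD in auto)

lemma A_cong_AE:
  assumes "g \<in> truncated MF FS" "h \<in> truncated MF FS" "AE z in MF. g z = h z"
  shows "AE z in MX. A g z = A h z"
proof -
  note t = truncated_add_cmult[OF FS assms(1,2), of "-1"]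
  have "L2_norm MF (\<lambda>z. g z + (-1) * h z) = L2_norm MF (\<lambda>z. 0)"
    by (rule L2_norm_cong_AE) (use assms(3) truncatedD[OF t] in auto)
  then have "L2_norm MX (A (\<lambda>z. g z + (-1) * h z)) = 0"
    using A_norm_eq[OF t] by (simp add: L2_norm_def)
  from L2_norm_zero_AE[OF A_L2[OF t] this] A_lin[OF assms(1,2), of "-1"]
  show ?thesis by eventually_elim simp
qed

text \<open>The adjoint is bounded by duality. For a truncation \<open>g\<close> of \<open>B f\<close> one has
  \<open>\<parallel>g\<parallel>\<^sup>2 = \<langle>g, B f\<rangle> = \<langle>A g, f\<rangle> \<le> c\<^sup>1\<^sup>/\<^sup>2 \<parallel>g\<parallel> \<parallel>f\<parallel>\<close>; dividing by \<open>\<parallel>g\<parallel>\<close> gives a bound that does not depend on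
  the truncation.\<close>

lemma B_bounded:
  assumes f: "f \<in> truncated MX XS"
  shows "B f \<in> L2_space MF" "L2_norm MF (B f) \<le> sqrt c * L2_norm MX f"
proof -
  note [measurable] = B_meas[OF f]
  let ?K = "sqrt c * L2_norm MX f"
  have loc: "L2_norm MF (\<lambda>z. indicator (FS n) z * B f z) \<le> ?K" for n
  proof -
    define g where "g z = indicator (FS n) z * B f z" for z
    have gL: "g \<in> L2_space MF" unfolding g_def by (rule B_loc[OF f])
    then have g: "g \<in> truncated MF FS" by (auto simp: truncated_def g_def intro!: exI[of _ n])
    have "L2_inner MF g g = L2_inner MF g (B f)"
      unfolding L2_inner_def g_def by (intro Bochner_Integration.integral_cong) (auto simp: indicator_def)
    also have "\<dots> = L2_inner MX (A g) f" by (rule adj[OF f g, symmetric])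
    finally have "(L2_norm MF g)\<^sup>2 = cmod (L2_inner MX (A g) f)"
      unfolding L2_inner_self by (metis abs_of_nonneg norm_of_real zero_le_power2)
    also have "\<dots> \<le> L2_norm MX (A g) * L2_norm MX f"
      by (rule L2_Cauchy_Schwarz[OF A_L2[OF g] truncatedD(1)[OF f]])
    also have "\<dots> = L2_norm MF g * ?K" unfolding A_norm_eq[OF g] by simp
    finally have "L2_norm MF g * L2_norm MF g \<le> L2_norm MF g * ?K" by (simp add: power2_eq_square)
    then have "L2_norm MF g \<le> ?K"
      using c_pos L2_norm_nonneg[of MF g] L2_norm_nonneg[of MX f]
      by (cases "L2_norm MF g = 0") (simp_all add: mult_le_cancel_left less_le)
    then show ?thesis unfolding g_def .
  qed
  have S: "incseq FS" "\<And>n. FS n \<inter> space MF \<in> sets MF" "\<And>z. z \<in> space MF \<Longrightarrow> eventually (\<lambda>n. z \<in> FS n) sequentially"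
    using FS by (auto simp: exhausts_def)
  have [measurable]: "(indicator (FS n) :: _ \<Rightarrow> ennreal) \<in> borel_measurable MF" for n
    using S(2) by (subst borel_measurable_indicator_iff) auto
  have "L2_mass MF (B f) =
     (\<integral>\<^sup>+z. (SUP n. indicator (FS n) z * ennreal ((cmod (B f z))\<^sup>2)) \<partial>MF)"
  proof (rule nn_integral_cong)
    fix z assume "z \<in> space MF"
    then obtain n where "z \<in> FS n" using S(3) eventually_happens' by fastforce
    then have "ennreal ((cmod (B f z))\<^sup>2) \<le> (SUP n. indicator (FS n) z * ennreal ((cmod (B f z))\<^sup>2))"
      by (intro SUP_upper2[of n]) auto
    moreover have "(SUP n. indicator (FS n) z * ennreal ((cmod (B f z))\<^sup>2)) \<le> ennreal ((cmod (B f z))\<^sup>2)"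
      by (intro SUP_least) (auto simp: indicator_def)
    ultimately show "ennreal ((cmod (B f z))\<^sup>2) = (SUP n. indicator (FS n) z * ennreal ((cmod (B f z))\<^sup>2))" by simp
  qed
  also have "\<dots> = (SUP n. \<integral>\<^sup>+z. indicator (FS n) z * ennreal ((cmod (B f z))\<^sup>2) \<partial>MF)"
  proof (rule nn_integral_monotone_convergence_SUP)
    show "incseq (\<lambda>n z. indicator (FS n) z * ennreal ((cmod (B f z))\<^sup>2))"
      using S(1) by (auto simp: incseq_def le_fun_def indicator_def)
  qed measurable
  also have "\<dots> \<le> ennreal (?K\<^sup>2)"
  proof (rule SUP_least)
    fix n
    have "(\<integral>\<^sup>+z. indicator (FS n) z * ennreal ((cmod (B f z))\<^sup>2) \<partial>MF) =
       L2_mass MF (\<lambda>z. indicator (FS n) z * B f z)"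
      by (intro nn_integral_cong) (auto simp: indicator_def)
    also have "\<dots> \<le> ennreal (?K\<^sup>2)"
      unfolding nn_integral_L2[OF B_loc[OF f]] by (intro ennreal_leI power_mono loc) auto
    finally show "(\<integral>\<^sup>+z. indicator (FS n) z * ennreal ((cmod (B f z))\<^sup>2) \<partial>MF) \<le> ennreal (?K\<^sup>2)" .
  qed
  finally have *: "L2_mass MF (B f) \<le> ennreal (?K\<^sup>2)" .
  show "B f \<in> L2_space MF" by (rule L2_spaceI[OF _ *]) simp
  show "L2_norm MF (B f) \<le> ?K" by (rule L2_norm_leI[OF *]) (use c_pos in auto)
qed

lemma B_tendsto:
  assumes "f \<in> L2_space MX"
  shows "\<exists>G. L2_tendsto MF (\<lambda>n. B (\<lambda>z. indicator (XS n) z * f z)) G"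
  by (rule bounded_extension_tendsto[OF XS assms, of B MF "sqrt c"])
     (use B_bounded B_lin c_pos in auto)

text \<open>This determines the forward transform \<open>k\<close> of \<open>f\<close> up to null sets, by \<open>truncated_inner_unique\<close>.\<close>

lemma B_lim_inner:
  assumes f: "f \<in> L2_space MX" and k: "L2_tendsto MF (\<lambda>n. B (\<lambda>z. indicator (XS n) z * f z)) k"
    and g: "g \<in> truncated MF FS"
  shows "L2_inner MF g k = L2_inner MX (A g) f"
proof (rule LIMSEQ_unique)
  show "(\<lambda>n. L2_inner MF g (B (\<lambda>z. indicator (XS n) z * f z))) \<longlonglongrightarrow> L2_inner MF g k"
    by (rule L2_tendsto_inner_right[OF k truncatedD(1)[OF g]])
  show "(\<lambda>n. L2_inner MF g (B (\<lambda>z. indicator (XS n) z * f z))) \<longlonglongrightarrow> L2_inner MX (A g) f"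
    using L2_tendsto_inner_right[OF truncated_tendsto[OF XS f] A_L2[OF g]]
    by (simp add: adj[OF truncated_indicator[OF XS f] g])
qed

end


section \<open>Integral transforms with a unimodular kernel\<close>

definition ktrans :: "'b measure \<Rightarrow> ('a \<Rightarrow> 'b \<Rightarrow> complex) \<Rightarrow> ('b \<Rightarrow> complex) \<Rightarrow> 'a \<Rightarrow> complex" where
  "ktrans F e g x = (\<integral>\<xi>. e x \<xi> * g \<xi> \<partial>F)"

lemma AE_snd:
  assumes "sigma_finite_measure N" "AE t in N. P t"
  shows "AE z in M \<Otimes>\<^sub>M N. P (snd z)"
proof -
  interpret N: sigma_finite_measure N by fact
  obtain Z where Z: "{t \<in> space N. \<not> P t} \<subseteq> Z" "Z \<in> sets N" "emeasure N Z = 0"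
    using assms(2) by (rule AE_E)
  show ?thesis
  proof (rule AE_I)
    show "{z \<in> space (M \<Otimes>\<^sub>M N). \<not> P (snd z)} \<subseteq> space M \<times> Z"
      using Z by (auto simp: space_pair_measure)
    show "emeasure (M \<Otimes>\<^sub>M N) (space M \<times> Z) = 0"
      using Z by (simp add: N.emeasure_pair_measure_Times)
    show "space M \<times> Z \<in> sets (M \<Otimes>\<^sub>M N)" using Z by auto
  qed
qed

text \<open>The Cauchy-Schwarz inequality against the indicator of the support.\<close>

lemma integrable_truncated_slice:
  assumes "f \<in> L2_space M" "S \<in> sets M" "emeasure M S < \<infinity>" "\<And>z. z \<in> space M \<Longrightarrow> z \<notin> S \<Longrightarrow> f z = 0"
  shows "integrable M f"
    "(\<integral>\<^sup>+z. ennreal (cmod (f z)) \<partial>M)\<^sup>2 \<le> emeasure M S * L2_mass M f"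
proof -
  note [measurable] = L2_spaceD(1)[OF assms(1)] assms(2)
  have "(\<integral>\<^sup>+z. ennreal (cmod (f z)) \<partial>M)\<^sup>2 = (\<integral>\<^sup>+z. indicator S z * ennreal (cmod (f z)) \<partial>M)\<^sup>2"
    by (rule arg_cong[where f = "\<lambda>x. x\<^sup>2"], rule nn_integral_cong) (use assms(4) in \<open>auto simp: indicator_def\<close>)
  also have "\<dots> \<le> (\<integral>\<^sup>+z. indicator S z ^ 2 \<partial>M) * (\<integral>\<^sup>+z. ennreal (cmod (f z)) ^ 2 \<partial>M)"
    by (rule Cauchy_Schwarz_nn_integral) auto
  also have "(\<integral>\<^sup>+z. indicator S z ^ 2 \<partial>M) = (\<integral>\<^sup>+z. indicator S z \<partial>M)"
    by (rule nn_integral_cong) (auto simp: indicator_def)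
  also have "\<dots> = emeasure M S" by simp
  finally show *: "(\<integral>\<^sup>+z. ennreal (cmod (f z)) \<partial>M)\<^sup>2 \<le> emeasure M S * L2_mass M f"
    by (simp add: ennreal_power)
  also have "\<dots> < \<infinity>"
    unfolding nn_integral_L2[OF assms(1)] using assms(3) by (simp add: ennreal_mult_less_top)
  finally have "(\<integral>\<^sup>+z. ennreal (cmod (f z)) \<partial>M) < \<infinity>"
    by (simp add: power2_eq_square ennreal_mult_less_top) (metis less_top top.not_eq_extremum ennreal_top_mult_left mult_eq_0_iff ennreal_mult_eq_top_iff)
  then show "integrable M f" by (intro integrableI_bounded) auto
qed

locale unimodular_kernel =
  fixes X :: "'a measure" and F :: "'b measure" and e :: "'a \<Rightarrow> 'b \<Rightarrow> complex"
  assumes sigma_X: "sigma_finite_measure X" and sigma_F: "sigma_finite_measure F"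
    and kernel_measurable: "(\<lambda>(x, \<xi>). e x \<xi>) \<in> borel_measurable (X \<Otimes>\<^sub>M F)"
    and kernel_norm: "\<And>x \<xi>. cmod (e x \<xi>) = 1"
begin

sublocale X: sigma_finite_measure X by (rule sigma_X)
sublocale F: sigma_finite_measure F by (rule sigma_F)
sublocale XF: pair_sigma_finite X F ..

lemma kernel_measurable' [measurable (raw)]:
  assumes [measurable]: "f \<in> measurable M X" "g \<in> measurable M F"
  shows "(\<lambda>z. e (f z) (g z)) \<in> borel_measurable M"
  using measurable_compose[OF measurable_Pair[OF assms] kernel_measurable] by simp

lemma ktrans_measurable [measurable (raw)]:
  assumes [measurable]: "(\<lambda>(z, \<xi>). g z \<xi>) \<in> borel_measurable (M \<Otimes>\<^sub>M F)" "h \<in> measurable M X"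
  shows "(\<lambda>z. ktrans F e (g z) (h z)) \<in> borel_measurable M"
  unfolding ktrans_def by measurable

lemma ktrans_adj_measurable [measurable (raw)]:
  assumes [measurable]: "(\<lambda>(z, x). f z x) \<in> borel_measurable (M \<Otimes>\<^sub>M X)" "h \<in> measurable M F"
  shows "(\<lambda>z. ktrans X (\<lambda>\<xi> x. cnj (e x \<xi>)) (f z) (h z)) \<in> borel_measurable M"
  unfolding ktrans_def by measurable

lemma integrable_kernel_mult: "integrable F g \<Longrightarrow> x \<in> space X \<Longrightarrow> integrable F (\<lambda>\<xi>. e x \<xi> * g \<xi>)"
  by (rule Bochner_Integration.integrable_bound[of F g]) (auto simp: norm_mult kernel_norm)

lemma integrable_kernel_adj_mult: "integrable X f \<Longrightarrow> \<xi> \<in> space F \<Longrightarrow> integrable X (\<lambda>x. cnj (e x \<xi>) * f x)"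
  by (rule Bochner_Integration.integrable_bound[of X f]) (auto simp: norm_mult kernel_norm)

lemma integrable_kernel_pair:
  assumes f: "integrable X f" and g: "integrable F g"
  shows "integrable (X \<Otimes>\<^sub>M F) (\<lambda>(x, \<xi>). e x \<xi> * g \<xi> * f x)"
proof (rule integrableI_bounded)
  note [measurable] = borel_measurable_integrable[OF f] borel_measurable_integrable[OF g]
  show "(\<lambda>(x, \<xi>). e x \<xi> * g \<xi> * f x) \<in> borel_measurable (X \<Otimes>\<^sub>M F)" by measurable
  have "(\<integral>\<^sup>+z. ennreal (norm (case z of (x, \<xi>) \<Rightarrow> e x \<xi> * g \<xi> * f x)) \<partial>(X \<Otimes>\<^sub>M F)) =
    (\<integral>\<^sup>+x. \<integral>\<^sup>+\<xi>. ennreal (cmod (f x)) * ennreal (cmod (g \<xi>)) \<partial>F \<partial>X)"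
    by (subst F.nn_integral_fst[symmetric]) (auto simp: norm_mult kernel_norm ennreal_mult mult.commute)
  also have "\<dots> = (\<integral>\<^sup>+x. ennreal (cmod (f x)) \<partial>X) * (\<integral>\<^sup>+\<xi>. ennreal (cmod (g \<xi>)) \<partial>F)"
    by (simp add: nn_integral_cmult nn_integral_multc)
  also have "\<dots> < \<infinity>"
    using f g by (auto simp: integrable_iff_bounded ennreal_mult_less_top)
  finally show "(\<integral>\<^sup>+z. ennreal (norm (case z of (x, \<xi>) \<Rightarrow> e x \<xi> * g \<xi> * f x)) \<partial>(X \<Otimes>\<^sub>M F)) < \<infinity>" .
qed

lemma ktrans_bound: "cmod (ktrans F e g x) \<le> (\<integral>\<xi>. cmod (g \<xi>) \<partial>F)"
  unfolding ktrans_def using integral_norm_bound[of F "\<lambda>\<xi>. e x \<xi> * g \<xi>"] by (simp add: norm_mult kernel_norm)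

text \<open>Fubini's theorem applies because the kernel is bounded and both functions are integrable.\<close>

lemma ktrans_adjoint:
  assumes f: "integrable X f" and g: "integrable F g"
  shows "L2_inner X (ktrans F e g) f = L2_inner F g (ktrans X (\<lambda>\<xi> x. cnj (e x \<xi>)) f)"
proof -
  have fc: "integrable X (\<lambda>x. cnj (f x))" using f by simp
  have "L2_inner X (ktrans F e g) f = (\<integral>x. \<integral>\<xi>. e x \<xi> * g \<xi> * cnj (f x) \<partial>F \<partial>X)"
    unfolding L2_inner_def ktrans_def by simp
  also have "\<dots> = (\<integral>\<xi>. \<integral>x. e x \<xi> * g \<xi> * cnj (f x) \<partial>X \<partial>F)"
    by (rule XF.Fubini_integral[symmetric]) (use integrable_kernel_pair[OF fc g] in simp)
  also have "\<dots> = L2_inner F g (ktrans X (\<lambda>\<xi> x. cnj (e x \<xi>)) f)"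
  proof -
    have "(\<integral>x. e x \<xi> * g \<xi> * cnj (f x) \<partial>X) = g \<xi> * cnj (\<integral>x. cnj (e x \<xi>) * f x \<partial>X)" for \<xi>
    proof -
      have "(\<integral>x. e x \<xi> * g \<xi> * cnj (f x) \<partial>X) = (\<integral>x. g \<xi> * cnj (cnj (e x \<xi>) * f x) \<partial>X)"
        by (rule Bochner_Integration.integral_cong) (simp_all add: mult_ac)
      also have "\<dots> = g \<xi> * cnj (\<integral>x. cnj (e x \<xi>) * f x \<partial>X)"
        by (simp only: integral_mult_right_zero Bochner_Integration.integral_cnj)
      finally show ?thesis .
    qed
    then show ?thesis unfolding L2_inner_def ktrans_def by simp
  qed
  finally show ?thesis .
qed

end

locale plancherel_kernel = unimodular_kernel +
  fixes c :: real
  assumes c_pos: "0 < c"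
    and plancherel: "\<And>g. integrable F g \<Longrightarrow> g \<in> L2_space F \<Longrightarrow>
      L2_mass X (ktrans F e g) = ennreal c * L2_mass F g"

text \<open>The transform in both variables is the composition of the transforms in each of them. After the first one,
  \<open>k y \<xi>\<close> is integrable in \<open>\<xi>\<close> for every \<open>y\<close>, being dominated by the integral of \<open>|g|\<close> over \<open>\<mu>\<close>, and square
  integrable in \<open>\<xi>\<close> for almost every \<open>y\<close>, so that the second isometry applies to it.\<close>

lemma plancherel_kernel_pair:
  assumes "plancherel_kernel X1 F1 e1 c1" "plancherel_kernel X2 F2 e2 c2"
  shows "plancherel_kernel (X1 \<Otimes>\<^sub>M X2) (F1 \<Otimes>\<^sub>M F2)
    (\<lambda>z \<zeta>. e1 (fst z) (fst \<zeta>) * e2 (snd z) (snd \<zeta>)) (c1 * c2)"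
proof -
  interpret K1: plancherel_kernel X1 F1 e1 c1 by fact
  interpret K2: plancherel_kernel X2 F2 e2 c2 by fact
  interpret X: pair_sigma_finite X1 X2 ..
  interpret F: pair_sigma_finite F1 F2 ..
  interpret FX: pair_sigma_finite F1 X2 ..
  let ?e = "\<lambda>z \<zeta>. e1 (fst z) (fst \<zeta>) * e2 (snd z) (snd \<zeta>)"
  show ?thesis
  proof (unfold_locales)
    show "(\<lambda>(x, \<xi>). ?e x \<xi>) \<in> borel_measurable ((X1 \<Otimes>\<^sub>M X2) \<Otimes>\<^sub>M (F1 \<Otimes>\<^sub>M F2))"
      unfolding case_prod_unfold by measurable
    show "0 < c1 * c2" using K1.c_pos K2.c_pos by simp
    show "cmod (?e x \<xi>) = 1" for x \<xi> by (simp add: norm_mult K1.kernel_norm K2.kernel_norm)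
    fix g :: "'b \<times> 'd \<Rightarrow> complex"
    assume g1: "integrable (F1 \<Otimes>\<^sub>M F2) g" and g2: "g \<in> L2_space (F1 \<Otimes>\<^sub>M F2)"
    note [measurable] = borel_measurable_integrable[OF g1]
    define k where "k y \<xi> = ktrans F2 e2 (\<lambda>\<mu>. g (\<xi>, \<mu>)) y" for y \<xi>
    have k_meas [measurable]: "(\<lambda>(y, \<xi>). k y \<xi>) \<in> borel_measurable (X2 \<Otimes>\<^sub>M F1)"
      unfolding k_def by measurable
    have "AE \<xi> in F1. L2_mass X2 (\<lambda>y. k y \<xi>) = ennreal c2 * L2_mass F2 (\<lambda>\<mu>. g (\<xi>, \<mu>))"
      using F.AE_integrable_fst'[OF g1] F.AE_integrable_fst'[OF L2_spaceD(2)[OF g2]]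
      unfolding k_def by eventually_elim (intro K2.plancherel, auto simp: L2_space_def)
    then have "(\<integral>\<^sup>+\<xi>. \<integral>\<^sup>+y. ennreal ((cmod (k y \<xi>))\<^sup>2) \<partial>X2 \<partial>F1) =
        (\<integral>\<^sup>+\<xi>. ennreal c2 * L2_mass F2 (\<lambda>\<mu>. g (\<xi>, \<mu>)) \<partial>F1)"
      by (rule nn_integral_cong_AE)
    also have "\<dots> = ennreal c2 * L2_mass (F1 \<Otimes>\<^sub>M F2) g"
      by (subst nn_integral_cmult) (auto simp: K2.F.nn_integral_fst[symmetric])
    finally have k2: "(\<integral>\<^sup>+\<xi>. \<integral>\<^sup>+y. ennreal ((cmod (k y \<xi>))\<^sup>2) \<partial>X2 \<partial>F1) =
        ennreal c2 * L2_mass (F1 \<Otimes>\<^sub>M F2) g" .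
    have k2': "(\<integral>\<^sup>+y. \<integral>\<^sup>+\<xi>. ennreal ((cmod (k y \<xi>))\<^sup>2) \<partial>F1 \<partial>X2) =
        (\<integral>\<^sup>+\<xi>. \<integral>\<^sup>+y. ennreal ((cmod (k y \<xi>))\<^sup>2) \<partial>X2 \<partial>F1)"
      by (rule FX.Fubini') measurable
    have fin: "AE y in X2. L2_mass F1 (k y) \<noteq> \<infinity>"
      by (rule nn_integral_PInf_AE)
         (measurable, unfold k2' k2 nn_integral_L2[OF g2], simp add: ennreal_mult_eq_top_iff)
    have split: "ktrans (F1 \<Otimes>\<^sub>M F2) ?e g (x, y) = ktrans F1 e1 (k y) x" if "x \<in> space X1" "y \<in> space X2" for x y
    proof -
      have "integrable (F1 \<Otimes>\<^sub>M F2) (\<lambda>\<zeta>. ?e (x, y) \<zeta> * g \<zeta>)"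
        by (rule Bochner_Integration.integrable_bound[OF g1])
           (use that in \<open>auto simp: norm_mult K1.kernel_norm K2.kernel_norm case_prod_unfold\<close>)
      from F.integral_fst'[OF this] show ?thesis
        unfolding ktrans_def k_def by (simp add: mult.assoc)
    qed
    have kint: "integrable F1 (k y)" if y: "y \<in> space X2" for y
    proof (rule Bochner_Integration.integrable_bound)
      show "integrable F1 (\<lambda>\<xi>. \<integral>\<mu>. cmod (g (\<xi>, \<mu>)) \<partial>F2)"
        using F.integrable_fst'[of "\<lambda>\<zeta>. cmod (g \<zeta>)"] g1 by simp
      show "k y \<in> borel_measurable F1" using y by measurable
      have "cmod (k y \<xi>) \<le> (\<integral>\<mu>. cmod (g (\<xi>, \<mu>)) \<partial>F2)" for \<xi>
        unfolding k_def ktrans_def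
        using integral_norm_bound[of F2 "\<lambda>\<mu>. e2 y \<mu> * g (\<xi>, \<mu>)"] by (simp add: norm_mult K2.kernel_norm)
      then show "AE \<xi> in F1. norm (k y \<xi>) \<le> norm (\<integral>\<mu>. cmod (g (\<xi>, \<mu>)) \<partial>F2)"
        by (auto intro!: AE_I2 order_trans[OF _ abs_ge_self])
    qed
    have [measurable]: "ktrans (F1 \<Otimes>\<^sub>M F2) ?e g \<in> borel_measurable (X1 \<Otimes>\<^sub>M X2)"
    proof -
      have "(\<lambda>z. \<integral>\<zeta>. e1 (fst z) (fst \<zeta>) * e2 (snd z) (snd \<zeta>) * g \<zeta> \<partial>(F1 \<Otimes>\<^sub>M F2)) \<in> borel_measurable (X1 \<Otimes>\<^sub>M X2)"
        by (rule sigma_finite_measure.borel_measurable_lebesgue_integral[OF F.sigma_finite_measure_axioms]) measurable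
      then show ?thesis by (simp add: ktrans_def[abs_def])
    qed
    have "L2_mass (X1 \<Otimes>\<^sub>M X2) (ktrans (F1 \<Otimes>\<^sub>M F2) ?e g) =
      (\<integral>\<^sup>+y. \<integral>\<^sup>+x. ennreal ((cmod (ktrans (F1 \<Otimes>\<^sub>M F2) ?e g (x, y)))\<^sup>2) \<partial>X1 \<partial>X2)"
      by (rule X.nn_integral_snd[symmetric]) measurable
    also have "\<dots> = (\<integral>\<^sup>+y. \<integral>\<^sup>+x. ennreal ((cmod (ktrans F1 e1 (k y) x))\<^sup>2) \<partial>X1 \<partial>X2)"
      by (intro nn_integral_cong) (simp add: split)
    also have "\<dots> = (\<integral>\<^sup>+y. ennreal c1 * L2_mass F1 (k y) \<partial>X2)"
    proof (rule nn_integral_cong_AE, use fin AE_space in eventually_elim)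
      case (elim y)
      have "k y \<in> borel_measurable F1" using elim(2) by measurable
      then have "k y \<in> L2_space F1"
        using elim by (auto simp: L2_space_def integrable_iff_bounded top.not_eq_extremum)
      then show ?case using K1.plancherel[OF kint[OF elim(2)]] by simp
    qed
    also have "\<dots> = ennreal c1 * (ennreal c2 * L2_mass (F1 \<Otimes>\<^sub>M F2) g)"
      unfolding k2[symmetric] k2'[symmetric] by (rule nn_integral_cmult) measurable
    finally show "L2_mass (X1 \<Otimes>\<^sub>M X2) (ktrans (F1 \<Otimes>\<^sub>M F2) ?e g) =
      ennreal (c1 * c2) * L2_mass (F1 \<Otimes>\<^sub>M F2) g"
      using K1.c_pos K2.c_pos by (simp add: ennreal_mult mult.assoc)
  qed
qed


text \<open>Against a finite measure the energy of a transform is a double integral of \<open>g\<close> with the correlation of two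
  kernels. The circle and the Gaussian measures on the line are both treated by computing that correlation.\<close>

context unimodular_kernel begin

lemma ktrans_energy:
  assumes X: "finite_measure X" and g: "integrable F g"
  shows "ktrans F e g \<in> L2_space X"
    "L2_inner X (ktrans F e g) (ktrans F e g) =
      (\<integral>\<xi>. g \<xi> * cnj (\<integral>\<zeta>. g \<zeta> * (\<integral>x. cnj (e x \<xi>) * e x \<zeta> \<partial>X) \<partial>F) \<partial>F)"
proof -
  interpret finX: finite_measure X by fact
  note [measurable] = borel_measurable_integrable[OF g]
  let ?K = "ktrans F e g"
  define C where "C = (\<integral>\<xi>. cmod (g \<xi>) \<partial>F)"
  have K: "integrable X ?K"
    by (rule finX.integrable_const_bound[of _ C]) (use ktrans_bound in \<open>auto simp: C_def\<close>)
  have "integrable X (\<lambda>x. (cmod (?K x))\<^sup>2)"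
    by (rule finX.integrable_const_bound[of _ "C\<^sup>2"])
       (auto intro!: AE_I2 power_mono simp: C_def ktrans_bound)
  then show "?K \<in> L2_space X" by (auto simp: L2_space_def)
  have one: "integrable X (\<lambda>x. cnj (e x \<xi>))" if "\<xi> \<in> space F" for \<xi>
    by (rule finX.integrable_const_bound[of _ 1]) (use that in \<open>auto simp: kernel_norm\<close>)
  have inner: "ktrans X (\<lambda>\<xi> x. cnj (e x \<xi>)) ?K \<xi> = (\<integral>\<zeta>. g \<zeta> * (\<integral>x. cnj (e x \<xi>) * e x \<zeta> \<partial>X) \<partial>F)"
    if \<xi>: "\<xi> \<in> space F" for \<xi>
  proof -
    have "ktrans X (\<lambda>\<xi> x. cnj (e x \<xi>)) ?K \<xi> = (\<integral>x. \<integral>\<zeta>. e x \<zeta> * g \<zeta> * cnj (e x \<xi>) \<partial>F \<partial>X)"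
      unfolding ktrans_def by (simp add: mult.commute)
    also have "\<dots> = (\<integral>\<zeta>. \<integral>x. e x \<zeta> * g \<zeta> * cnj (e x \<xi>) \<partial>X \<partial>F)"
      by (rule XF.Fubini_integral[symmetric]) (use integrable_kernel_pair[OF one[OF \<xi>] g] in simp)
    also have "\<dots> = (\<integral>\<zeta>. \<integral>x. g \<zeta> * (cnj (e x \<xi>) * e x \<zeta>) \<partial>X \<partial>F)"
      by (simp only: mult_ac)
    finally show ?thesis by simp
  qed
  show "L2_inner X ?K ?K = (\<integral>\<xi>. g \<xi> * cnj (\<integral>\<zeta>. g \<zeta> * (\<integral>x. cnj (e x \<xi>) * e x \<zeta> \<partial>X) \<partial>F) \<partial>F)"
    unfolding ktrans_adjoint[OF K g] unfolding L2_inner_def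
    by (rule Bochner_Integration.integral_cong) (simp_all add: inner)
qed

end

section \<open>The circle\<close>

lemma cis_measurable [measurable (raw)]:
  "f \<in> borel_measurable M \<Longrightarrow> (\<lambda>z. cis (f z)) \<in> borel_measurable M"
  by (rule borel_measurable_continuous_on[of cis]) (auto intro!: continuous_intros)

lemma integral_cis_period:
  assumes "m \<in> \<int>"
  shows "(\<integral>y. cis (y * m) \<partial>(restrict_space lborel {0..<2 * pi})) = (if m = 0 then complex_of_real (2 * pi) else 0)"
proof -
  have "(\<integral>y. cis (y * m) \<partial>(restrict_space lborel {0..<2 * pi})) = (\<integral>y. indicator {0..<2 * pi} y *\<^sub>R cis (y * m) \<partial>lborel)"
    by (subst integral_restrict_space) auto
  also have "\<dots> = (\<integral>y. indicator {0..2 * pi} y *\<^sub>R cis (y * m) \<partial>lborel)"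
  proof (rule integral_cong_AE)
    have "AE y in lborel. y \<noteq> 2 * pi" by (rule AE_lborel_singleton)
    then show "AE y in lborel. indicator {0..<2 * pi} y *\<^sub>R cis (y * m) = indicator {0..2 * pi} y *\<^sub>R cis (y * m)"
      by eventually_elim (auto simp: indicator_def)
  qed measurable
  also have "\<dots> = (if m = 0 then complex_of_real (2 * pi) else 0)"
  proof (cases "m = 0")
    case True
    then show ?thesis by (simp add: scaleR_conv_of_real)
  next
    case False
    obtain i where i: "m = of_int i" using assms by (auto elim: Ints_cases)
    have "(\<integral>y. indicator {0..2 * pi} y *\<^sub>R cis (y * m) \<partial>lborel) =
        cis (2 * pi * m) / (\<i> * m) - cis (0 * m) / (\<i> * m)"
    proof (rule integral_FTC_atLeastAtMost)
      fix y :: real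
      have "((\<lambda>z. exp (\<i> * (z * m)) / (\<i> * m)) has_field_derivative exp (\<i> * (of_real y * m))) (at (of_real y))"
        using False by (auto intro!: derivative_eq_intros simp: field_simps)
      from has_vector_derivative_real_field[OF this]
      show "((\<lambda>y. cis (y * m) / (\<i> * m)) has_vector_derivative cis (y * m)) (at y within {0..2 * pi})"
        unfolding cis_conv_exp by simp
    next
      show "continuous_on {0..2 * pi} (\<lambda>y. cis (y * m))" by (intro continuous_intros)
    qed simp
    also have "cis (2 * pi * m) = 1" unfolding i by (simp add: cis_multiple_2pi)
    finally show ?thesis using False by simp
  qed
  finally show ?thesis .
qed

lemma plancherel_kernel_circle:
  "plancherel_kernel (restrict_space lborel {0..<2 * pi}) (count_space \<int>) (\<lambda>y \<mu>. cis (y * \<mu>)) (2 * pi)"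
proof -
  let ?X = "restrict_space lborel {0..<2 * pi}" and ?F = "count_space (\<int> :: real set)"
  have X: "finite_measure ?X"
    by (rule finite_measureI) (simp add: emeasure_restrict_space space_restrict_space)
  interpret X: finite_measure ?X by fact
  interpret F: sigma_finite_measure ?F
    by (rule sigma_finite_measure_count_space_countable) (simp add: Ints_def)
  have idX: "(\<lambda>y. y) \<in> borel_measurable ?X"
    by (rule measurable_restrict_space1) simp
  interpret K: unimodular_kernel ?X ?F "\<lambda>y \<mu>. cis (y * \<mu>)"
  proof unfold_locales
    have [measurable]: "fst \<in> borel_measurable (?X \<Otimes>\<^sub>M ?F)" "snd \<in> borel_measurable (?X \<Otimes>\<^sub>M ?F)"
      using measurable_compose[OF measurable_fst idX, of ?F]
        measurable_compose[OF measurable_snd, of "\<lambda>x. x" ?F borel ?X] by simp_all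
    show "(\<lambda>(y, \<mu>). cis (y * \<mu>)) \<in> borel_measurable (?X \<Otimes>\<^sub>M ?F)" unfolding case_prod_unfold by measurable
  qed simp
  show ?thesis
  proof (unfold_locales)
    fix g :: "real \<Rightarrow> complex" assume g: "integrable ?F g" and gL: "g \<in> L2_space ?F"
    let ?K = "ktrans ?F (\<lambda>y \<mu>. cis (y * \<mu>)) g"
    note E = K.ktrans_energy[OF X g]
    have *: "(\<integral>\<zeta>. g \<zeta> * (\<integral>x. cnj (cis (x * \<xi>)) * cis (x * \<zeta>) \<partial>?X) \<partial>?F) = complex_of_real (2 * pi) * g \<xi>"
      if \<xi>: "\<xi> \<in> \<int>" for \<xi>
    proof -
      have "(\<integral>\<zeta>. g \<zeta> * (\<integral>x. cnj (cis (x * \<xi>)) * cis (x * \<zeta>) \<partial>?X) \<partial>?F) =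
        (\<integral>\<zeta>. indicator {\<xi>} \<zeta> *\<^sub>R (complex_of_real (2 * pi) * g \<xi>) \<partial>?F)"
      proof (rule Bochner_Integration.integral_cong)
        fix \<zeta> :: real assume "\<zeta> \<in> space ?F"
        then have "\<zeta> - \<xi> \<in> \<int>" using \<xi> by auto
        have "cnj (cis (x * \<xi>)) * cis (x * \<zeta>) = cis (x * (\<zeta> - \<xi>))" for x
          by (simp add: cis_cnj cis_mult algebra_simps)
        then show "g \<zeta> * (\<integral>x. cnj (cis (x * \<xi>)) * cis (x * \<zeta>) \<partial>?X) = indicator {\<xi>} \<zeta> *\<^sub>R (complex_of_real (2 * pi) * g \<xi>)"
          using integral_cis_period[OF \<open>\<zeta> - \<xi> \<in> \<int>\<close>] by (auto simp: indicator_def)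
      qed simp
      also have "\<dots> = complex_of_real (2 * pi) * g \<xi>"
        using has_bochner_integral_integral_eq[OF has_bochner_integral_indicator[of "{\<xi>}" ?F "complex_of_real (2 * pi) * g \<xi>"]] \<xi>
        by simp
      finally show ?thesis .
    qed
    have "complex_of_real ((L2_norm ?X ?K)\<^sup>2) = (\<integral>\<xi>. g \<xi> * cnj (complex_of_real (2 * pi) * g \<xi>) \<partial>?F)"
      unfolding L2_inner_self[symmetric] E(2)
      by (rule Bochner_Integration.integral_cong[OF refl]) (simp only: space_count_space *)
    also have "\<dots> = L2_inner ?F g (\<lambda>\<xi>. complex_of_real (2 * pi) * g \<xi>)" unfolding L2_inner_def ..
    also have "\<dots> = complex_of_real (2 * pi * (L2_norm ?F g)\<^sup>2)"
      unfolding L2_inner_cmult_right L2_inner_self by simp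
    finally have "(L2_norm ?X ?K)\<^sup>2 = 2 * pi * (L2_norm ?F g)\<^sup>2" by (simp only: of_real_eq_iff)
    then show "L2_mass ?X ?K = ennreal (2 * pi) * L2_mass ?F g"
      unfolding nn_integral_L2[OF E(1)] nn_integral_L2[OF gL] by (subst ennreal_mult[symmetric]) auto
  qed simp
qed

section \<open>The line\<close>

text \<open>Continuity is stated along sequences, the form in which dominated convergence uses it.\<close>

definition L1_translation_continuous :: "(real \<Rightarrow> complex) \<Rightarrow> bool" where
  "L1_translation_continuous f \<longleftrightarrow>
     (\<forall>h. h \<longlonglongrightarrow> 0 \<longrightarrow> (\<lambda>n. \<integral>x. cmod (f (x + h n) - f x) \<partial>lborel) \<longlonglongrightarrow> 0)"

lemma integrable_translate:
  fixes f :: "real \<Rightarrow> 'a::{banach,second_countable_topology}"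
  assumes "integrable lborel f" shows "integrable lborel (\<lambda>x. f (x + h))"
  using lborel_integrable_real_affine[OF assms, of 1 h] by (simp add: add.commute)

lemma integral_translate:
  fixes f :: "real \<Rightarrow> 'a::{banach,second_countable_topology}"
  shows "(\<integral>x. f (x + h) \<partial>lborel) = integral\<^sup>L lborel f"
  using lborel_integral_real_affine[of 1 f h] by (simp add: add.commute)

lemma L1_translation_continuous_approx:
  assumes f: "integrable lborel f"
    and A: "\<And>\<epsilon>. \<epsilon> > 0 \<Longrightarrow> \<exists>g. integrable lborel g \<and> L1_translation_continuous g \<and> (\<integral>x. cmod (f x - g x) \<partial>lborel) \<le> \<epsilon>"
  shows "L1_translation_continuous f"
  unfolding L1_translation_continuous_def
proof (intro allI impI LIMSEQ_I)
  fix h :: "nat \<Rightarrow> real" and e :: real assume h: "h \<longlonglongrightarrow> 0" and e: "0 < e"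
  obtain g where g: "integrable lborel g" "L1_translation_continuous g" "(\<integral>x. cmod (f x - g x) \<partial>lborel) \<le> e / 4"
    using A[of "e / 4"] e by auto
  obtain N where N: "\<And>n. n \<ge> N \<Longrightarrow> norm ((\<integral>x. cmod (g (x + h n) - g x) \<partial>lborel) - 0) < e / 4"
    using LIMSEQ_D[of "\<lambda>n. \<integral>x. cmod (g (x + h n) - g x) \<partial>lborel" 0 "e / 4"] g(2) h e
    unfolding L1_translation_continuous_def by auto
  have "norm ((\<integral>x. cmod (f (x + h n) - f x) \<partial>lborel) - 0) < e" if "n \<ge> N" for n
  proof -
    note i = integrable_translate[OF f, of "h n"] integrable_translate[OF g(1), of "h n"] f g(1)
    have "(\<integral>x. cmod (f (x + h n) - f x) \<partial>lborel) \<le>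
       (\<integral>x. (cmod (f (x + h n) - g (x + h n)) + cmod (g (x + h n) - g x)) + cmod (f x - g x) \<partial>lborel)"
    proof (rule integral_mono)
      fix x show "cmod (f (x + h n) - f x) \<le> cmod (f (x + h n) - g (x + h n)) + cmod (g (x + h n) - g x) + cmod (f x - g x)"
        using norm_triangle_ineq[of "(f (x + h n) - g (x + h n)) + (g (x + h n) - g x)" "g x - f x"] norm_triangle_ineq[of "f (x + h n) - g (x + h n)" "g (x + h n) - g x"] by (simp add: norm_minus_commute)
    qed (use i in auto)
    also have "\<dots> = (\<integral>x. cmod (f x - g x) \<partial>lborel) + (\<integral>x. cmod (g (x + h n) - g x) \<partial>lborel) + (\<integral>x. cmod (f x - g x) \<partial>lborel)"
      using i integral_translate[of "\<lambda>x. cmod (f x - g x)" "h n"] by simp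
    finally show ?thesis using N[OF that] g(3) e by simp
  qed
  then show "\<exists>no. \<forall>n\<ge>no. norm ((\<integral>x. cmod (f (x + h n) - f x) \<partial>lborel) - 0) < e" by blast
qed

text \<open>An open set contains a neighbourhood of each of its points, so the overlap of the set with
  its translates converges pointwise.\<close>

lemma L1_translation_continuous_open:
  assumes U: "open U" "emeasure lborel U < \<infinity>"
  shows "L1_translation_continuous (\<lambda>x. indicator U x *\<^sub>R c)"
  unfolding L1_translation_continuous_def
proof (intro allI impI)
  fix h :: "nat \<Rightarrow> real" assume h: "h \<longlonglongrightarrow> 0"
  have [measurable]: "U \<in> sets borel" using U by auto
  have iU: "integrable lborel (indicator U :: real \<Rightarrow> real)" using U by (simp add: integrable_indicator_iff)
  have iUh: "integrable lborel (\<lambda>x. indicator U x * indicator U (x + h n) :: real)" for n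
    by (rule Bochner_Integration.integrable_bound[OF iU]) (auto simp: indicator_def)
  have "(\<lambda>n. \<integral>x. indicator U x * indicator U (x + h n) \<partial>lborel) \<longlonglongrightarrow> (\<integral>x. indicator U x \<partial>lborel :: real)"
  proof (rule integral_dominated_convergence[OF _ _ iU])
    show "AE x in lborel. (\<lambda>n. indicator U x * indicator U (x + h n)) \<longlonglongrightarrow> (indicator U x :: real)"
    proof (rule AE_I2)
      fix x
      have "eventually (\<lambda>n. indicator U x * indicator U (x + h n) = (indicator U x :: real)) sequentially"
      proof (cases "x \<in> U")
        case True
        have "(\<lambda>n. x + h n) \<longlonglongrightarrow> x + 0" by (intro tendsto_intros h)
        then have "eventually (\<lambda>n. x + h n \<in> U) sequentially" using topological_tendstoD[of _ "x" _ U] U(1) True by simp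
        then show ?thesis by eventually_elim simp
      qed simp
      then show "(\<lambda>n. indicator U x * indicator U (x + h n)) \<longlonglongrightarrow> (indicator U x :: real)" by (rule tendsto_eventually)
    qed
  qed (auto simp: indicator_def)
  then have "(\<lambda>n. cmod c * (2 * (\<integral>x. indicator U x \<partial>lborel) - 2 * (\<integral>x. indicator U x * indicator U (x + h n) \<partial>lborel))) \<longlonglongrightarrow>
      cmod c * (2 * (\<integral>x. indicator U x \<partial>lborel) - 2 * (\<integral>x. indicator U x \<partial>lborel :: real))"
    by (intro tendsto_intros)
  moreover have "(\<integral>x. cmod (indicator U (x + h n) *\<^sub>R c - indicator U x *\<^sub>R c) \<partial>lborel) =
      cmod c * (2 * (\<integral>x. indicator U x \<partial>lborel) - 2 * (\<integral>x. indicator U x * indicator U (x + h n) \<partial>lborel))" for n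
  proof -
    have "(\<integral>x. cmod (indicator U (x + h n) *\<^sub>R c - indicator U x *\<^sub>R c) \<partial>lborel) =
      (\<integral>x. cmod c * (indicator U (x + h n) + indicator U x - 2 * (indicator U x * indicator U (x + h n))) \<partial>lborel)"
      by (rule Bochner_Integration.integral_cong) (auto simp: indicator_def)
    also have "\<dots> = cmod c * (2 * (\<integral>x. indicator U x \<partial>lborel) - 2 * (\<integral>x. indicator U x * indicator U (x + h n) \<partial>lborel))"
      using iU iUh[of n] integrable_translate[OF iU, of "h n"] integral_translate[of "indicator U :: real \<Rightarrow> real" "h n"]
      by (simp del: integral_indicator)
    finally show ?thesis .
  qed
  ultimately show "(\<lambda>n. \<integral>x. cmod (indicator U (x + h n) *\<^sub>R c - indicator U x *\<^sub>R c) \<partial>lborel) \<longlonglongrightarrow> 0" by simp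
qed

text \<open>The induction for integrable functions reduces the claim to indicators of sets of finite measure, and outer
  regularity of Lebesgue measure reduces these to open sets.\<close>

lemma L1_translation_continuous:
  assumes "integrable lborel f" shows "L1_translation_continuous f"
  using assms
proof (rule integrable_induct)
  fix A :: "real set" and c :: complex assume A: "A \<in> sets lborel" "emeasure lborel A < \<infinity>"
  show "L1_translation_continuous (\<lambda>x. indicator A x *\<^sub>R c)"
  proof (rule L1_translation_continuous_approx)
    show "integrable lborel (\<lambda>x. indicator A x *\<^sub>R c)" using A by auto
    fix \<epsilon> :: real assume "\<epsilon> > 0"
    then have "\<epsilon> / (1 + cmod c) > 0" by (auto intro!: divide_pos_pos add_pos_nonneg)
    obtain U where U: "open U" "A \<subseteq> U" "emeasure lebesgue (U - A) < ennreal (\<epsilon> / (1 + cmod c))"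
      by (rule sets_lebesgue_outer_open[OF sets_completionI_sets[OF A(1)] \<open>\<epsilon> / (1 + cmod c) > 0\<close>])
    have m: "U - A \<in> sets lborel" "U \<in> sets lborel" using U A by auto
    have UA: "emeasure lborel (U - A) < ennreal (\<epsilon> / (1 + cmod c))" using U(3) m by simp
    have "emeasure lborel U \<le> emeasure lborel A + emeasure lborel (U - A)"
      using emeasure_subadditive[of A lborel "U - A"] A m U(2) by (simp add: Un_absorb1)
    also have "\<dots> < \<infinity>" using A UA less_trans[OF UA ennreal_less_top] by (simp add: ennreal_add_eq_top less_top)
    finally have finU: "emeasure lborel U < \<infinity>" .
    have "(\<integral>x. cmod (indicator A x *\<^sub>R c - indicator U x *\<^sub>R c) \<partial>lborel) = (\<integral>x. cmod c * indicator (U - A) x \<partial>lborel)"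
      by (rule Bochner_Integration.integral_cong) (use U(2) in \<open>auto simp: indicator_def\<close>)
    also have "\<dots> = cmod c * measure lborel (U - A)" using m by simp
    also have "\<dots> \<le> cmod c * (\<epsilon> / (1 + cmod c))"
    proof (rule mult_left_mono)
      show "measure lborel (U - A) \<le> \<epsilon> / (1 + cmod c)"
        unfolding measure_def by (rule enn2real_leI[OF less_imp_le less_imp_le[OF UA]]) fact
    qed simp
    also have "\<dots> \<le> \<epsilon>" using \<open>\<epsilon> > 0\<close> by (simp add: field_simps add_pos_nonneg)
    finally show "\<exists>g. integrable lborel g \<and> L1_translation_continuous g \<and> (\<integral>x. cmod (indicator A x *\<^sub>R c - g x) \<partial>lborel) \<le> \<epsilon>"
      using L1_translation_continuous_open[OF U(1) finU, of c] finU m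
      by (intro exI[of _ "\<lambda>x. indicator U x *\<^sub>R c"]) auto
  qed
next
  fix f g :: "real \<Rightarrow> complex"
  assume f: "integrable lborel f" "L1_translation_continuous f" and g: "integrable lborel g" "L1_translation_continuous g"
  show "L1_translation_continuous (\<lambda>x. f x + g x)"
    unfolding L1_translation_continuous_def
  proof (intro allI impI)
    fix h :: "nat \<Rightarrow> real" assume h: "h \<longlonglongrightarrow> 0"
    have lim: "(\<lambda>n. (\<integral>x. cmod (f (x + h n) - f x) \<partial>lborel) + (\<integral>x. cmod (g (x + h n) - g x) \<partial>lborel)) \<longlonglongrightarrow> 0 + 0"
      using f(2) g(2) h unfolding L1_translation_continuous_def by (intro tendsto_add) auto
    have "(\<integral>x. cmod (f (x + h n) + g (x + h n) - (f x + g x)) \<partial>lborel) \<le>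
      (\<integral>x. cmod (f (x + h n) - f x) \<partial>lborel) + (\<integral>x. cmod (g (x + h n) - g x) \<partial>lborel)" for n
    proof -
      note i = integrable_translate[OF f(1), of "h n"] integrable_translate[OF g(1), of "h n"] f(1) g(1)
      have "(\<integral>x. cmod (f (x + h n) + g (x + h n) - (f x + g x)) \<partial>lborel) \<le>
        (\<integral>x. cmod (f (x + h n) - f x) + cmod (g (x + h n) - g x) \<partial>lborel)"
      proof (rule integral_mono)
        fix x show "cmod (f (x + h n) + g (x + h n) - (f x + g x)) \<le> cmod (f (x + h n) - f x) + cmod (g (x + h n) - g x)"
          by (rule norm_diff_triangle_ineq)
      qed (use i in auto)
      also have "\<dots> = (\<integral>x. cmod (f (x + h n) - f x) \<partial>lborel) + (\<integral>x. cmod (g (x + h n) - g x) \<partial>lborel)"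
        using i by simp
      finally show ?thesis .
    qed
    note bound = this
    show "(\<lambda>n. \<integral>x. cmod (f (x + h n) + g (x + h n) - (f x + g x)) \<partial>lborel) \<longlonglongrightarrow> 0"
    proof (rule Lim_null_comparison)
      show "\<forall>\<^sub>F n in sequentially. norm (\<integral>x. cmod (f (x + h n) + g (x + h n) - (f x + g x)) \<partial>lborel) \<le>
        (\<integral>x. cmod (f (x + h n) - f x) \<partial>lborel) + (\<integral>x. cmod (g (x + h n) - g x) \<partial>lborel)"
        using bound by (intro always_eventually allI) (simp add: abs_of_nonneg)
    qed (use lim in simp)
  qed
next
  fix f :: "real \<Rightarrow> complex" and s
  assume s: "\<And>i. integrable lborel (s i)" "\<And>i. L1_translation_continuous (s i)"
    "\<And>x. x \<in> space lborel \<Longrightarrow> (\<lambda>i. s i x) \<longlonglongrightarrow> f x"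
    "\<And>i x. x \<in> space lborel \<Longrightarrow> norm (s i x) \<le> 2 * norm (f x)" and f: "integrable lborel f"
  note [measurable] = borel_measurable_integrable[OF s(1)] borel_measurable_integrable[OF f]
  have lim: "(\<lambda>i. \<integral>x. cmod (f x - s i x) \<partial>lborel) \<longlonglongrightarrow> (\<integral>x. 0 \<partial>(lborel :: real measure))"
  proof (rule integral_dominated_convergence[where w = "\<lambda>x. 3 * cmod (f x)"])
    show "AE x in lborel. (\<lambda>i. cmod (f x - s i x)) \<longlonglongrightarrow> 0"
    proof (rule AE_I2)
      fix x :: real
      have "(\<lambda>i. cmod (f x - s i x)) \<longlonglongrightarrow> cmod (f x - f x)" by (intro tendsto_intros s(3)) simp
      then show "(\<lambda>i. cmod (f x - s i x)) \<longlonglongrightarrow> 0" by simp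
    qed
    show "AE x in lborel. norm (cmod (f x - s i x)) \<le> 3 * cmod (f x)" for i
      using s(4)[of _ i] by (intro AE_I2) (simp, smt (verit) norm_triangle_ineq4)
  qed (use f in auto)
  show "L1_translation_continuous f"
  proof (rule L1_translation_continuous_approx[OF f])
    fix \<epsilon> :: real assume "\<epsilon> > 0"
    then obtain i where "(\<integral>x. cmod (f x - s i x) \<partial>lborel) \<le> \<epsilon>"
      using LIMSEQ_D[OF lim, of \<epsilon>] by (auto intro: less_imp_le)
    then show "\<exists>g. integrable lborel g \<and> L1_translation_continuous g \<and> (\<integral>x. cmod (f x - g x) \<partial>lborel) \<le> \<epsilon>"
      using s(1,2) by blast
  qed
qed


lemma integral_cis_normal_density:
  assumes "\<sigma> > 0"
  shows "(\<integral>x. cis (x * s) \<partial>(density lborel (normal_density 0 \<sigma>))) = complex_of_real (exp (- (\<sigma> * s)\<^sup>2 / 2))"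
proof -
  have "(\<integral>x. cis (x * s) \<partial>(density lborel (normal_density 0 \<sigma>))) = (\<integral>x. normal_density 0 \<sigma> x *\<^sub>R cis (x * s) \<partial>lborel)"
    by (subst integral_density) (auto simp: normal_density_nonneg)
  also have "\<dots> = \<sigma> *\<^sub>R (\<integral>z. normal_density 0 \<sigma> (\<sigma> * z) *\<^sub>R cis (\<sigma> * z * s) \<partial>lborel)"
    using lborel_integral_real_affine[of \<sigma> "\<lambda>x. normal_density 0 \<sigma> x *\<^sub>R cis (x * s)" 0] assms by simp
  also have "\<dots> = (\<integral>z. std_normal_density z *\<^sub>R cis (\<sigma> * z * s) \<partial>lborel)"
  proof -
    have "\<sigma> * normal_density 0 \<sigma> (\<sigma> * z) = std_normal_density z" for z
      using assms by (simp add: normal_density_def real_sqrt_mult power_mult_distrib)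
    then show ?thesis unfolding integral_scaleR_right[symmetric] by simp
  qed
  also have "\<dots> = (\<integral>z. cis (\<sigma> * z * s) \<partial>std_normal_distribution)"
    by (subst integral_density) (auto simp: normal_density_nonneg)
  also have "\<dots> = char std_normal_distribution (\<sigma> * s)"
    unfolding char_def by (simp add: cis_conv_exp mult_ac)
  finally show ?thesis by (simp add: char_std_normal_distribution power_mult_distrib)
qed

lemma unimodular_kernel_line:
  assumes "sigma_finite_measure X" "sets X = sets borel"
  shows "unimodular_kernel X lborel (\<lambda>x \<xi>. cis (x * \<xi>))"
proof -
  note [measurable_cong] = assms(2)
  show ?thesis
  proof (unfold_locales)
    show "\<exists>A. countable A \<and> A \<subseteq> sets X \<and> \<Union> A = space X \<and> (\<forall>a\<in>A. emeasure X a \<noteq> \<infinity>)"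
      using assms(1) by (rule sigma_finite_measure.sigma_finite_countable)
    show "(\<lambda>(x, \<xi>). cis (x * \<xi>)) \<in> borel_measurable (X \<Otimes>\<^sub>M lborel)" by measurable
  qed simp
qed

abbreviation gaussian_mean :: "(real \<Rightarrow> complex) \<Rightarrow> real \<Rightarrow> real \<Rightarrow> complex" where
  "gaussian_mean g s \<xi> \<equiv> \<integral>z. std_normal_density z *\<^sub>R g (\<xi> + z / s) \<partial>lborel"

text \<open>The Gaussian weight makes the energy integral absolutely convergent in all variables, and the Fourier
  transform of the weight turns it into an average of the autocorrelation of \<open>g\<close> over distances of order
  \<open>1 / \<sigma>\<close>. As \<open>\<sigma>\<close> grows, the left-hand side increases to the energy of \<open>K\<close> and the average concentrates
  at distance 0.\<close>

lemma gaussian_energy: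
  fixes g :: "real \<Rightarrow> complex"
  assumes g: "integrable lborel g" and \<sigma>: "\<sigma> > 0"
  defines "K \<equiv> ktrans lborel (\<lambda>x \<xi>. cis (x * \<xi>)) g"
  shows "(\<integral>\<^sup>+x. ennreal (exp (- (x / \<sigma>)\<^sup>2 / 2)) * ennreal ((cmod (K x))\<^sup>2) \<partial>lborel) =
     ennreal (Re (2 * pi * (\<integral>\<xi>. g \<xi> * cnj (gaussian_mean g \<sigma> \<xi>) \<partial>lborel)))"
proof -
  note [measurable] = borel_measurable_integrable[OF g]
  let ?X = "density lborel (normal_density 0 \<sigma>)"
  have P: "prob_space ?X" using \<sigma> by (rule prob_space_normal_density)
  interpret X: prob_space ?X by fact
  interpret U: unimodular_kernel ?X lborel "\<lambda>x \<xi>. cis (x * \<xi>)"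
    by (rule unimodular_kernel_line) (auto intro: X.sigma_finite_measure_axioms)
  interpret U': unimodular_kernel lborel lborel "\<lambda>x \<xi>. cis (x * \<xi>)"
    by (rule unimodular_kernel_line) (auto intro: lborel.sigma_finite_measure_axioms)
  note E = U.ktrans_energy[OF X.finite_measure_axioms g, folded K_def]
  have [measurable]: "K \<in> borel_measurable borel"
  proof -
    have "(\<lambda>x. ktrans lborel (\<lambda>x \<xi>. cis (x * \<xi>)) g x) \<in> borel_measurable lborel" by measurable
    then show ?thesis unfolding K_def by simp
  qed
  define J where "J = (\<integral>\<xi>. g \<xi> * cnj (gaussian_mean g \<sigma> \<xi>) \<partial>lborel)"
  have inner: "(\<integral>\<zeta>. g \<zeta> * (\<integral>x. cnj (cis (x * \<xi>)) * cis (x * \<zeta>) \<partial>?X) \<partial>lborel) =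
    complex_of_real (sqrt (2 * pi) / \<sigma>) * gaussian_mean g \<sigma> \<xi>" for \<xi>
  proof -
    have "cnj (cis (x * \<xi>)) * cis (x * \<zeta>) = cis (x * (\<zeta> - \<xi>))" for x \<zeta>
      by (simp add: cis_cnj cis_mult algebra_simps)
    then have "(\<integral>\<zeta>. g \<zeta> * (\<integral>x. cnj (cis (x * \<xi>)) * cis (x * \<zeta>) \<partial>?X) \<partial>lborel) =
      (\<integral>\<zeta>. g \<zeta> * complex_of_real (exp (- (\<sigma> * (\<zeta> - \<xi>))\<^sup>2 / 2)) \<partial>lborel)"
      using integral_cis_normal_density[OF \<sigma>] by simp
    also have "\<dots> = (1 / \<sigma>) *\<^sub>R (\<integral>z. g (\<xi> + (1 / \<sigma>) * z) * complex_of_real (exp (- (\<sigma> * (\<xi> + (1 / \<sigma>) * z - \<xi>))\<^sup>2 / 2)) \<partial>lborel)"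
      using \<sigma> by (subst lborel_integral_real_affine[of "1 / \<sigma>" _ \<xi>]) auto
    also have "(\<integral>z. g (\<xi> + (1 / \<sigma>) * z) * complex_of_real (exp (- (\<sigma> * (\<xi> + (1 / \<sigma>) * z - \<xi>))\<^sup>2 / 2)) \<partial>lborel) =
       (\<integral>z. complex_of_real (sqrt (2 * pi)) * (std_normal_density z *\<^sub>R g (\<xi> + z / \<sigma>)) \<partial>lborel)"
    proof (rule Bochner_Integration.integral_cong)
      fix z
      have "exp (- (\<sigma> * (\<xi> + (1 / \<sigma>) * z - \<xi>))\<^sup>2 / 2) = sqrt (2 * pi) * std_normal_density z"
        using \<sigma> by (simp add: std_normal_density_def)
      then show "g (\<xi> + (1 / \<sigma>) * z) * complex_of_real (exp (- (\<sigma> * (\<xi> + (1 / \<sigma>) * z - \<xi>))\<^sup>2 / 2)) =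
        complex_of_real (sqrt (2 * pi)) * (std_normal_density z *\<^sub>R g (\<xi> + z / \<sigma>))"
        by (simp only: scaleR_conv_of_real) (simp add: mult_ac)
    qed simp
    also have "\<dots> = complex_of_real (sqrt (2 * pi)) * gaussian_mean g \<sigma> \<xi>"
      by (rule integral_mult_right_zero)
    finally show ?thesis by (simp add: scaleR_conv_of_real)
  qed
  have "complex_of_real ((L2_norm ?X K)\<^sup>2) = complex_of_real (sqrt (2 * pi) / \<sigma>) * J"
  proof -
    have "complex_of_real ((L2_norm ?X K)\<^sup>2) = (\<integral>\<xi>. complex_of_real (sqrt (2 * pi) / \<sigma>) *
        (g \<xi> * cnj (gaussian_mean g \<sigma> \<xi>)) \<partial>lborel)"
      unfolding L2_inner_self[symmetric] E(2) inner
      by (rule Bochner_Integration.integral_cong) (simp_all add: mult_ac)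
    also have "\<dots> = complex_of_real (sqrt (2 * pi) / \<sigma>) * J" unfolding J_def by (rule integral_mult_right_zero)
    finally show ?thesis .
  qed
  then have "complex_of_real (sqrt (2 * pi) * \<sigma> * (L2_norm ?X K)\<^sup>2) =
      complex_of_real (sqrt (2 * pi) * \<sigma> * (sqrt (2 * pi) / \<sigma>)) * J" by (simp only: of_real_mult mult.assoc)
  also have "sqrt (2 * pi) * \<sigma> * (sqrt (2 * pi) / \<sigma>) = 2 * pi" using \<sigma> by simp
  finally have J: "sqrt (2 * pi) * \<sigma> * (L2_norm ?X K)\<^sup>2 = Re (2 * pi * J)"
    by (metis Re_complex_of_real)
  have "(\<integral>\<^sup>+x. ennreal (exp (- (x / \<sigma>)\<^sup>2 / 2)) * ennreal ((cmod (K x))\<^sup>2) \<partial>lborel) =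
    (\<integral>\<^sup>+x. ennreal (sqrt (2 * pi) * \<sigma>) * (ennreal (normal_density 0 \<sigma> x) * ennreal ((cmod (K x))\<^sup>2)) \<partial>lborel)"
  proof (rule nn_integral_cong)
    fix x
    have "exp (- (x / \<sigma>)\<^sup>2 / 2) = sqrt (2 * pi) * \<sigma> * normal_density 0 \<sigma> x"
      using \<sigma> by (simp add: normal_density_def real_sqrt_mult power_divide)
    then show "ennreal (exp (- (x / \<sigma>)\<^sup>2 / 2)) * ennreal ((cmod (K x))\<^sup>2) =
      ennreal (sqrt (2 * pi) * \<sigma>) * (ennreal (normal_density 0 \<sigma> x) * ennreal ((cmod (K x))\<^sup>2))"
      using \<sigma> by (simp add: ennreal_mult normal_density_nonneg mult.assoc)
  qed
  also have "\<dots> = ennreal (sqrt (2 * pi) * \<sigma>) * L2_mass ?X K"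
    by (subst nn_integral_cmult, simp, subst nn_integral_density) auto
  also have "\<dots> = ennreal (Re (2 * pi * J))"
    unfolding nn_integral_L2[OF E(1)] J[symmetric] using \<sigma> by (subst ennreal_mult[symmetric]) auto
  finally show ?thesis unfolding J_def .
qed

text \<open>The difference from the limit is at most \<open>M\<close> times the Gaussian average of the modulus of continuity
  \<open>\<omega>(z / n)\<close> of \<open>g\<close> in \<open>L\<^sup>1\<close>, which tends to 0 by dominated convergence.\<close>

lemma gaussian_average_tendsto:
  fixes g :: "real \<Rightarrow> complex"
  assumes g: "integrable lborel g" and M: "\<And>x. cmod (g x) \<le> M"
  shows "(\<lambda>n. \<integral>\<xi>. g \<xi> * cnj (gaussian_mean g (real (Suc n)) \<xi>) \<partial>lborel)
     \<longlonglongrightarrow> complex_of_real ((L2_norm lborel g)\<^sup>2)"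
proof -
  note [measurable] = borel_measurable_integrable[OF g]
  have M0: "0 \<le> M" using order_trans[OF norm_ge_zero M] .
  define \<omega> where "\<omega> h = (\<integral>\<xi>. cmod (g (\<xi> + h) - g \<xi>) \<partial>lborel)" for h
  have \<omega>_meas [measurable]: "\<omega> \<in> borel_measurable borel"
  proof -
    have "(\<lambda>h. \<integral>\<xi>. cmod (g (\<xi> + h) - g \<xi>) \<partial>lborel) \<in> borel_measurable lborel" by measurable
    then show ?thesis unfolding \<omega>_def by simp
  qed
  have \<omega>0: "0 \<le> \<omega> h" for h by (simp add: \<omega>_def)
  have \<omega>_bound: "\<omega> h \<le> 2 * (\<integral>\<xi>. cmod (g \<xi>) \<partial>lborel)" for h
  proof -
    have "\<omega> h \<le> (\<integral>\<xi>. cmod (g (\<xi> + h)) + cmod (g \<xi>) \<partial>lborel)"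
      unfolding \<omega>_def using g integrable_translate[OF g, of h] by (intro integral_mono) (auto intro: norm_triangle_ineq4)
    also have "\<dots> = 2 * (\<integral>\<xi>. cmod (g \<xi>) \<partial>lborel)"
      using g integrable_translate[OF g, of h] integral_translate[of "\<lambda>x. cmod (g x)" h] by simp
    finally show ?thesis .
  qed
  have int_std: "integrable lborel std_normal_density" by simp
  have one_std: "(\<integral>z. std_normal_density z \<partial>lborel) = 1" by simp
  have int_inner: "integrable lborel (\<lambda>z. std_normal_density z *\<^sub>R g (\<xi> + z / s))" for \<xi> s
    by (rule Bochner_Integration.integrable_bound[of _ "\<lambda>z. M * std_normal_density z"])
       (use int_std M M0 in \<open>auto simp: normal_density_nonneg mult.commute[of M] intro!: mult_left_mono AE_I2\<close>)
  have lim: "(\<lambda>n. \<integral>z. std_normal_density z * \<omega> (z / real (Suc n)) \<partial>lborel) \<longlonglongrightarrow> (\<integral>z. 0 \<partial>(lborel :: real measure))"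
  proof (rule integral_dominated_convergence)
    show "integrable lborel (\<lambda>z. 2 * (\<integral>\<xi>. cmod (g \<xi>) \<partial>lborel) * std_normal_density z)" by simp
    show "AE z in lborel. (\<lambda>n. std_normal_density z * \<omega> (z / real (Suc n))) \<longlonglongrightarrow> 0"
    proof (rule AE_I2)
      fix z :: real
      have "(\<lambda>n. z / real (Suc n)) \<longlonglongrightarrow> 0" by (rule lim_const_over_n[THEN LIMSEQ_Suc])
      then have "(\<lambda>n. \<omega> (z / real (Suc n))) \<longlonglongrightarrow> 0"
        using L1_translation_continuous[OF g] unfolding L1_translation_continuous_def \<omega>_def by blast
      then show "(\<lambda>n. std_normal_density z * \<omega> (z / real (Suc n))) \<longlonglongrightarrow> 0" by (rule tendsto_mult_right_zero)
    qed
    show "AE z in lborel. norm (std_normal_density z * \<omega> (z / real (Suc n))) \<le> 2 * (\<integral>\<xi>. cmod (g \<xi>) \<partial>lborel) * std_normal_density z" for n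
      using \<omega>_bound \<omega>0 by (auto simp: normal_density_nonneg mult.commute[of _ "normal_density _ _ _"] intro!: AE_I2 mult_left_mono)
  qed measurable
  let ?G = "\<lambda>n \<xi>. gaussian_mean g (real (Suc n)) \<xi>"
  have G_bound: "cmod (?G n \<xi>) \<le> M" for n \<xi>
  proof -
    have "cmod (?G n \<xi>) \<le> (\<integral>z. cmod (std_normal_density z *\<^sub>R g (\<xi> + z / real (Suc n))) \<partial>lborel)"
      by (rule integral_norm_bound)
    also have "\<dots> \<le> (\<integral>z. M * std_normal_density z \<partial>lborel)"
    proof (rule integral_mono)
      show "integrable lborel (\<lambda>z. cmod (std_normal_density z *\<^sub>R g (\<xi> + z / real (Suc n))))"
        by (rule integrable_norm[OF int_inner])
      show "cmod (std_normal_density z *\<^sub>R g (\<xi> + z / real (Suc n))) \<le> M * std_normal_density z" for z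
        using mult_left_mono[OF M[of "\<xi> + z / real (Suc n)"] normal_density_nonneg[of 0 1 z]]
        by (simp add: normal_density_nonneg mult.commute[of M] del: of_nat_Suc)
    qed simp
    finally show ?thesis using one_std by simp
  qed
  have G_meas: "?G n \<in> borel_measurable lborel" for n by measurable
  have bound: "cmod ((\<integral>\<xi>. g \<xi> * cnj (?G n \<xi>) \<partial>lborel) - complex_of_real ((L2_norm lborel g)\<^sup>2)) \<le>
     M * (\<integral>z. std_normal_density z * \<omega> (z / real (Suc n)) \<partial>lborel)" for n
  proof -
    have i1: "integrable lborel (\<lambda>\<xi>. g \<xi> * cnj (?G n \<xi>))"
      by (rule Bochner_Integration.integrable_bound[of _ "\<lambda>\<xi>. M * cmod (g \<xi>)"])
         (use g G_meas[of n] M0 in \<open>auto simp: norm_mult mult.commute[of M] simp del: of_nat_Suc intro!: mult_left_mono G_bound AE_I2\<close>)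
    have i2: "integrable lborel (\<lambda>\<xi>. g \<xi> * cnj (g \<xi>))"
      by (rule Bochner_Integration.integrable_bound[of _ "\<lambda>\<xi>. M * cmod (g \<xi>)"])
         (use g M M0 in \<open>auto simp: norm_mult intro!: mult_right_mono\<close>)
    have D: "integrable (lborel \<Otimes>\<^sub>M lborel) (\<lambda>(z, \<xi>). std_normal_density z * cmod (g (\<xi> + z / real (Suc n)) - g \<xi>))"
    proof (rule lborel_pair.Fubini_integrable)
      have "(\<lambda>z. \<integral>\<xi>. norm (case (z, \<xi>) of (z, \<xi>) \<Rightarrow> std_normal_density z * cmod (g (\<xi> + z / real (Suc n)) - g \<xi>)) \<partial>lborel)
         = (\<lambda>z. std_normal_density z * \<omega> (z / real (Suc n)))"
        by (simp add: \<omega>_def normal_density_nonneg abs_mult)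
      moreover have "integrable lborel (\<lambda>z. std_normal_density z * \<omega> (z / real (Suc n)))"
        by (rule Bochner_Integration.integrable_bound[of _ "\<lambda>z. 2 * (\<integral>\<xi>. cmod (g \<xi>) \<partial>lborel) * std_normal_density z"])
           (use \<omega>_bound \<omega>0 in \<open>auto simp: normal_density_nonneg abs_mult mult.commute[of _ "normal_density _ _ _"] intro!: AE_I2 mult_left_mono\<close>)
      ultimately show "integrable lborel (\<lambda>z. \<integral>\<xi>. norm (case (z, \<xi>) of (z, \<xi>) \<Rightarrow> std_normal_density z * cmod (g (\<xi> + z / real (Suc n)) - g \<xi>)) \<partial>lborel)"
        by simp
      show "AE z in lborel. integrable lborel (\<lambda>\<xi>. case (z, \<xi>) of (z, \<xi>) \<Rightarrow> std_normal_density z * cmod (g (\<xi> + z / real (Suc n)) - g \<xi>))"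
        using integrable_translate[OF g] g by (intro AE_I2) auto
    qed measurable
    have "(\<integral>\<xi>. g \<xi> * cnj (?G n \<xi>) \<partial>lborel) - complex_of_real ((L2_norm lborel g)\<^sup>2) =
        (\<integral>\<xi>. g \<xi> * cnj (?G n \<xi>) - g \<xi> * cnj (g \<xi>) \<partial>lborel)"
      unfolding L2_inner_self[symmetric] L2_inner_def using i1 i2 by simp
    also have "cmod \<dots> \<le> (\<integral>\<xi>. cmod (g \<xi> * cnj (?G n \<xi>) - g \<xi> * cnj (g \<xi>)) \<partial>lborel)"
      by (rule integral_norm_bound)
    also have "\<dots> \<le> (\<integral>\<xi>. M * (\<integral>z. std_normal_density z * cmod (g (\<xi> + z / real (Suc n)) - g \<xi>) \<partial>lborel) \<partial>lborel)"
    proof (rule integral_mono)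
      show "integrable lborel (\<lambda>\<xi>. M * (\<integral>z. std_normal_density z * cmod (g (\<xi> + z / real (Suc n)) - g \<xi>) \<partial>lborel))"
        using lborel_pair.integrable_snd[OF D] by simp
      fix \<xi>
      have eq: "?G n \<xi> - g \<xi> = (\<integral>z. std_normal_density z *\<^sub>R g (\<xi> + z / real (Suc n)) - std_normal_density z *\<^sub>R g \<xi> \<partial>lborel)"
        using int_inner[of \<xi> "real (Suc n)"] one_std by simp
      have "cmod (?G n \<xi> - g \<xi>) \<le> (\<integral>z. cmod (std_normal_density z *\<^sub>R g (\<xi> + z / real (Suc n)) - std_normal_density z *\<^sub>R g \<xi>) \<partial>lborel)"
        unfolding eq by (rule integral_norm_bound)
      also have "\<dots> = (\<integral>z. std_normal_density z * cmod (g (\<xi> + z / real (Suc n)) - g \<xi>) \<partial>lborel)"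
        by (rule Bochner_Integration.integral_cong) (simp_all only: scaleR_diff_right[symmetric] norm_scaleR abs_of_nonneg[OF normal_density_nonneg])
      finally have *: "cmod (?G n \<xi> - g \<xi>) \<le> (\<integral>z. std_normal_density z * cmod (g (\<xi> + z / real (Suc n)) - g \<xi>) \<partial>lborel)" .
      have "cmod (g \<xi> * cnj (?G n \<xi>) - g \<xi> * cnj (g \<xi>)) = cmod (g \<xi>) * cmod (?G n \<xi> - g \<xi>)"
        unfolding right_diff_distrib[symmetric] complex_cnj_diff[symmetric] norm_mult complex_mod_cnj ..
      also have "\<dots> \<le> M * (\<integral>z. std_normal_density z * cmod (g (\<xi> + z / real (Suc n)) - g \<xi>) \<partial>lborel)"
        by (rule mult_mono[OF M *]) (use M0 in auto)
      finally show "cmod (g \<xi> * cnj (?G n \<xi>) - g \<xi> * cnj (g \<xi>)) \<le>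
        M * (\<integral>z. std_normal_density z * cmod (g (\<xi> + z / real (Suc n)) - g \<xi>) \<partial>lborel)" .
    qed (use i1 i2 in auto)
    also have "\<dots> = M * (\<integral>z. \<integral>\<xi>. std_normal_density z * cmod (g (\<xi> + z / real (Suc n)) - g \<xi>) \<partial>lborel \<partial>lborel)"
      using lborel_pair.Fubini_integral[OF D] by simp
    finally show ?thesis unfolding \<omega>_def by simp
  qed
  show ?thesis
  proof (rule Lim_transform2[OF tendsto_const])
    show "(\<lambda>n. complex_of_real ((L2_norm lborel g)\<^sup>2) - (\<integral>\<xi>. g \<xi> * cnj (?G n \<xi>) \<partial>lborel)) \<longlonglongrightarrow> 0"
    proof (rule Lim_null_comparison)
      show "\<forall>\<^sub>F n in sequentially. norm (complex_of_real ((L2_norm lborel g)\<^sup>2) - (\<integral>\<xi>. g \<xi> * cnj (?G n \<xi>) \<partial>lborel)) \<le>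
         M * (\<integral>z. std_normal_density z * \<omega> (z / real (Suc n)) \<partial>lborel)"
        by (rule always_eventually) (use bound in \<open>auto simp: norm_minus_commute\<close>)
      show "(\<lambda>n. M * (\<integral>z. std_normal_density z * \<omega> (z / real (Suc n)) \<partial>lborel)) \<longlonglongrightarrow> 0"
        using lim by (intro tendsto_mult_right_zero) simp
    qed
  qed
qed

lemma plancherel_line_bounded:
  fixes g :: "real \<Rightarrow> complex"
  assumes g: "integrable lborel g" and M: "\<And>x. cmod (g x) \<le> M"
  defines "K \<equiv> ktrans lborel (\<lambda>x \<xi>. cis (x * \<xi>)) g"
  shows "L2_mass lborel K = ennreal (2 * pi * (L2_norm lborel g)\<^sup>2)"
proof -
  note [measurable] = borel_measurable_integrable[OF g]
  interpret U': unimodular_kernel lborel lborel "\<lambda>x \<xi>. cis (x * \<xi>)"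
    by (rule unimodular_kernel_line) (auto intro: lborel.sigma_finite_measure_axioms)
  have [measurable]: "K \<in> borel_measurable borel"
  proof -
    have "(\<lambda>x. ktrans lborel (\<lambda>x \<xi>. cis (x * \<xi>)) g x) \<in> borel_measurable lborel" by measurable
    then show ?thesis unfolding K_def by simp
  qed
  let ?w = "\<lambda>n x. ennreal (exp (- (x / real (Suc n))\<^sup>2 / 2)) * ennreal ((cmod (K x))\<^sup>2)"
  have inc: "incseq ?w"
  proof (rule incseq_SucI, rule le_funI)
    fix n x
    have "\<bar>x / real (Suc (Suc n))\<bar> \<le> \<bar>x / real (Suc n)\<bar>"
      by (simp add: abs_divide frac_le)
    then have "(x / real (Suc (Suc n)))\<^sup>2 \<le> (x / real (Suc n))\<^sup>2" by (simp only: abs_le_square_iff)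
    then show "?w n x \<le> ?w (Suc n) x" by (intro mult_right_mono ennreal_leI) auto
  qed
  have "(\<lambda>n. \<integral>\<^sup>+x. ?w n x \<partial>lborel) \<longlonglongrightarrow> (\<integral>\<^sup>+x. (SUP n. ?w n x) \<partial>lborel)"
  proof (subst nn_integral_monotone_convergence_SUP[OF inc])
    show "(\<lambda>n. \<integral>\<^sup>+x. ?w n x \<partial>lborel) \<longlonglongrightarrow> (SUP n. \<integral>\<^sup>+x. ?w n x \<partial>lborel)"
    proof (rule LIMSEQ_SUP, unfold incseq_def, intro allI impI)
      fix m n :: nat assume "m \<le> n"
      show "(\<integral>\<^sup>+x. ?w m x \<partial>lborel) \<le> (\<integral>\<^sup>+x. ?w n x \<partial>lborel)"
        by (intro nn_integral_mono le_funD[OF incseqD[OF inc \<open>m \<le> n\<close>]])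
    qed
  qed measurable
  moreover have "(SUP n. ?w n x) = ennreal ((cmod (K x))\<^sup>2)" for x
  proof -
    have "(\<lambda>n. x / real (Suc n)) \<longlonglongrightarrow> 0" by (rule lim_const_over_n[THEN LIMSEQ_Suc])
    then have "(\<lambda>n. exp (- (x / real (Suc n))\<^sup>2 / 2)) \<longlonglongrightarrow> exp (- 0\<^sup>2 / 2)" by (intro tendsto_intros) auto
    then have "(\<lambda>n. ennreal (exp (- (x / real (Suc n))\<^sup>2 / 2) * (cmod (K x))\<^sup>2)) \<longlonglongrightarrow> ennreal (1 * (cmod (K x))\<^sup>2)"
      by (intro tendsto_intros) simp
    then have "(\<lambda>n. ?w n x) \<longlonglongrightarrow> ennreal ((cmod (K x))\<^sup>2)" by (simp add: ennreal_mult)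
    moreover have "(\<lambda>n. ?w n x) \<longlonglongrightarrow> (SUP n. ?w n x)"
      by (rule LIMSEQ_SUP) (use inc in \<open>auto simp: incseq_def le_fun_def\<close>)
    ultimately show ?thesis by (rule LIMSEQ_unique[symmetric])
  qed
  ultimately have "(\<lambda>n. \<integral>\<^sup>+x. ?w n x \<partial>lborel) \<longlonglongrightarrow> L2_mass lborel K" by simp
  moreover have "(\<lambda>n. \<integral>\<^sup>+x. ?w n x \<partial>lborel) \<longlonglongrightarrow> ennreal (Re (2 * pi * complex_of_real ((L2_norm lborel g)\<^sup>2)))"
  proof -
    have eq: "(\<integral>\<^sup>+x. ?w n x \<partial>lborel) = ennreal (Re (2 * pi *
        (\<integral>\<xi>. g \<xi> * cnj (gaussian_mean g (real (Suc n)) \<xi>) \<partial>lborel)))" for n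
      unfolding K_def by (rule gaussian_energy[OF g]) simp
    show ?thesis unfolding eq by (intro tendsto_intros gaussian_average_tendsto[OF g M])
  qed
  ultimately have "L2_mass lborel K = ennreal (Re (2 * pi * complex_of_real ((L2_norm lborel g)\<^sup>2)))"
    by (rule LIMSEQ_unique)
  then show ?thesis by simp
qed

text \<open>Functions with unbounded values are limits of their truncations \<open>t n\<close> to \<open>|g| \<le> n\<close>. The transforms of these
  converge both in \<open>L\<^sup>2\<close>, by the bounded case, and pointwise, by dominated convergence, and the two limits
  agree almost everywhere.\<close>

lemma plancherel_kernel_line: "plancherel_kernel lborel lborel (\<lambda>x \<xi>. cis (x * \<xi>)) (2 * pi)"
proof -
  interpret U: unimodular_kernel lborel lborel "\<lambda>x \<xi>. cis (x * \<xi>)"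
    by (rule unimodular_kernel_line) (auto intro: lborel.sigma_finite_measure_axioms)
  let ?K = "\<lambda>g. ktrans lborel (\<lambda>x \<xi>. cis (x * \<xi>)) g"
  show ?thesis
  proof unfold_locales
    fix g :: "real \<Rightarrow> complex" assume g: "integrable lborel g" and gL: "g \<in> L2_space lborel"
    note [measurable] = borel_measurable_integrable[OF g]
    define t where "t n \<xi> = indicator {\<xi>. cmod (g \<xi>) \<le> real n} \<xi> * g \<xi>" for n :: nat and \<xi>
    have t_meas [measurable]: "t n \<in> borel_measurable borel" for n unfolding t_def by measurable
    have t_le: "cmod (t n \<xi>) \<le> cmod (g \<xi>)" "cmod (t n \<xi>) \<le> real n" for n \<xi> by (auto simp: t_def indicator_def)
    have t_int: "integrable lborel (t n)" for n
      by (rule Bochner_Integration.integrable_bound[OF g]) (use t_le(1) in auto)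
    have tend: "L2_tendsto lborel t g"
      unfolding t_def[abs_def]
    proof (rule L2_truncation_tendsto[OF gL])
      show "eventually (\<lambda>n. \<xi> \<in> {\<xi>. cmod (g \<xi>) \<le> real n}) sequentially" for \<xi>
        using eventually_ge_at_top[of "nat \<lceil>cmod (g \<xi>)\<rceil>"] by eventually_elim (simp add: nat_le_iff ceiling_le_iff)
    qed auto
    note tL = L2_tendstoD(1)[OF tend]
    have Kt_meas: "?K h \<in> borel_measurable lborel" if [measurable]: "h \<in> borel_measurable borel" for h
    proof -
      have "(\<lambda>x. ?K h x) \<in> borel_measurable lborel" by measurable
      then show ?thesis by simp
    qed
    have norm_diff: "(\<lambda>x. ?K (t m) x - ?K (t n) x) \<in> L2_space lborel \<and>
       L2_norm lborel (\<lambda>x. ?K (t m) x - ?K (t n) x) = sqrt (2 * pi) * L2_norm lborel (\<lambda>x. t m x - t n x)" for m n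
    proof -
      have "(\<lambda>x. ?K (t m) x - ?K (t n) x) = ?K (\<lambda>x. t m x - t n x)"
        unfolding ktrans_def
        using U.integrable_kernel_mult[OF t_int[of m]] U.integrable_kernel_mult[OF t_int[of n]]
        by (auto simp: right_diff_distrib)
      moreover have "L2_mass lborel (\<lambda>x. ?K (\<lambda>x. t m x - t n x) x) =
         ennreal ((sqrt (2 * pi) * L2_norm lborel (\<lambda>x. t m x - t n x))\<^sup>2)"
        by (subst plancherel_line_bounded[of _ "real m + real n"])
           (use t_int t_le(2) in \<open>auto intro!: order_trans[OF norm_triangle_ineq4] add_mono simp: power_mult_distrib\<close>)
      ultimately show ?thesis
        by (auto intro!: L2_spaceI[OF _ order_eq_refl] L2_norm_eqI Kt_meas)
    qed
    have norm_t: "?K (t n) \<in> L2_space lborel \<and> L2_norm lborel (?K (t n)) = sqrt (2 * pi) * L2_norm lborel (t n)" for n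
    proof -
      have "L2_mass lborel (?K (t n)) = ennreal ((sqrt (2 * pi) * L2_norm lborel (t n))\<^sup>2)"
        by (subst plancherel_line_bounded[of _ "real n"]) (use t_int t_le(2) in \<open>auto simp: power_mult_distrib\<close>)
      then show ?thesis
        by (auto intro!: L2_spaceI[OF _ order_eq_refl] L2_norm_eqI Kt_meas)
    qed
    obtain G where G: "L2_tendsto lborel (\<lambda>n. ?K (t n)) G"
    proof -
      have "\<exists>G. L2_tendsto lborel (\<lambda>n. ?K (t n)) G"
      proof (rule L2_complete)
        fix e :: real assume "e > 0"
        then obtain N where "\<forall>m\<ge>N. \<forall>n\<ge>N. L2_norm lborel (\<lambda>z. t m z - t n z) < e / sqrt (2 * pi)"
          using L2_tendsto_Cauchy[OF tend, of "e / sqrt (2 * pi)"] by auto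
        then show "\<exists>N. \<forall>m\<ge>N. \<forall>n\<ge>N. L2_norm lborel (\<lambda>z. ?K (t m) z - ?K (t n) z) < e"
          using norm_diff by (intro exI[of _ N]) (simp add: less_divide_eq mult.commute)
      qed (use norm_t in auto)
      then show ?thesis using that by blast
    qed
    have GK: "AE x in lborel. G x = ?K g x"
    proof -
      have pw: "(\<lambda>n. ?K (t n) x) \<longlonglongrightarrow> ?K g x" for x
        unfolding ktrans_def
      proof (rule integral_dominated_convergence[where w = "\<lambda>\<xi>. cmod (g \<xi>)"])
        show "AE \<xi> in lborel. (\<lambda>n. cis (x * \<xi>) * t n \<xi>) \<longlonglongrightarrow> cis (x * \<xi>) * g \<xi>"
        proof (rule AE_I2, rule tendsto_eventually)
          fix \<xi> show "eventually (\<lambda>n. cis (x * \<xi>) * t n \<xi> = cis (x * \<xi>) * g \<xi>) sequentially"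
            using eventually_ge_at_top[of "nat \<lceil>cmod (g \<xi>)\<rceil>"]
            by eventually_elim (auto simp: t_def nat_le_iff ceiling_le_iff)
        qed
        show "AE \<xi> in lborel. norm (cis (x * \<xi>) * t n \<xi>) \<le> cmod (g \<xi>)" for n
          using t_le(1) by (auto simp: norm_mult)
      qed (use g in auto)
      obtain r :: "nat \<Rightarrow> nat" where r: "strict_mono r" "AE x in lborel. (\<lambda>n. ?K (t (r n)) x - G x) \<longlonglongrightarrow> 0"
        using L2_tendsto_AE_subseq[OF G] by blast
      from r(2) show ?thesis
      proof eventually_elim
        case (elim x)
        have "(\<lambda>n. ?K (t (r n)) x) \<longlonglongrightarrow> ?K g x" using LIMSEQ_subseq_LIMSEQ[OF pw r(1)] by (simp add: o_def)
        moreover have "(\<lambda>n. ?K (t (r n)) x) \<longlonglongrightarrow> G x" using elim by (simp add: LIM_zero_iff)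
        ultimately show ?case by (rule LIMSEQ_unique[symmetric])
      qed
    qed
    have "L2_norm lborel G = sqrt (2 * pi) * L2_norm lborel g"
      using L2_tendsto_norm[OF G] tendsto_mult_left[OF L2_tendsto_norm[OF tend], of "sqrt (2 * pi)"] norm_t
      by (intro LIMSEQ_unique[of "\<lambda>n. L2_norm lborel (?K (t n))"]) simp_all
    then have "L2_mass lborel G = ennreal (2 * pi * (L2_norm lborel g)\<^sup>2)"
      unfolding nn_integral_L2[OF L2_tendstoD(2)[OF G]] by (simp add: power_mult_distrib)
    moreover have "L2_mass lborel G = L2_mass lborel (?K g)"
      by (rule nn_integral_cong_AE) (use GK in eventually_elim, simp)
    ultimately show "L2_mass lborel (?K g) = ennreal (2 * pi) * L2_mass lborel g"
      unfolding nn_integral_L2[OF gL] by (simp add: ennreal_mult)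
  qed simp
qed


section \<open>Transforms with a parameter and changes of coordinates\<close>

lemma L2_slice:
  assumes M: "sigma_finite_measure M" and N: "sigma_finite_measure N" and f: "f \<in> L2_space (M \<Otimes>\<^sub>M N)"
  shows "AE t in N. (\<lambda>x. f (x, t)) \<in> L2_space M"
    "(\<integral>\<^sup>+t. \<integral>\<^sup>+x. ennreal ((cmod (f (x, t)))\<^sup>2) \<partial>M \<partial>N) = L2_mass (M \<Otimes>\<^sub>M N) f"
proof -
  interpret M: sigma_finite_measure M by fact
  interpret N: sigma_finite_measure N by fact
  interpret P: pair_sigma_finite M N ..
  note [measurable] = L2_spaceD(1)[OF f]
  have "integrable (M \<Otimes>\<^sub>M N) (\<lambda>(x, t). (cmod (f (x, t)))\<^sup>2)"
    using L2_spaceD(2)[OF f] by (simp add: case_prod_unfold)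
  from P.AE_integrable_snd[OF this] AE_space[of N]
  show "AE t in N. (\<lambda>x. f (x, t)) \<in> L2_space M"
    by eventually_elim (auto simp: L2_space_def)
  show "(\<integral>\<^sup>+t. \<integral>\<^sup>+x. ennreal ((cmod (f (x, t)))\<^sup>2) \<partial>M \<partial>N) = L2_mass (M \<Otimes>\<^sub>M N) f"
    by (rule P.nn_integral_snd) measurable
qed

definition finitely_exhausts :: "'a measure \<Rightarrow> (nat \<Rightarrow> 'a set) \<Rightarrow> bool" where
  "finitely_exhausts M S \<longleftrightarrow> exhausts M S \<and> (\<forall>n. emeasure M (S n \<inter> space M) < \<infinity>)"

lemma finitely_exhaustsD:
  assumes "finitely_exhausts M S"
  shows "exhausts M S" "S n \<inter> space M \<in> sets M" "emeasure M (S n \<inter> space M) < \<infinity>"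
  using assms by (auto simp: finitely_exhausts_def exhausts_def)

lemma exhausts_Times_UNIV:
  assumes "exhausts M S" shows "exhausts (M \<Otimes>\<^sub>M N) (\<lambda>n. S n \<times> UNIV)"
proof -
  have "(S n \<times> UNIV) \<inter> space (M \<Otimes>\<^sub>M N) = (S n \<inter> space M) \<times> space N" for n
    by (auto simp: space_pair_measure)
  moreover have "S n \<inter> space M \<in> sets M" for n using assms by (auto simp: exhausts_def)
  ultimately show ?thesis using assms by (auto simp: exhausts_def incseq_def space_pair_measure) blast
qed

lemma truncated_slice_integrable:
  assumes "sigma_finite_measure M" "sigma_finite_measure N" "finitely_exhausts M S"
    and f: "f \<in> truncated (M \<Otimes>\<^sub>M N) (\<lambda>n. S n \<times> UNIV)"
  shows "AE t in N. (\<lambda>x. f (x, t)) \<in> L2_space M \<and> integrable M (\<lambda>x. f (x, t))"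
proof -
  obtain n where n: "\<And>z. z \<notin> S n \<times> UNIV \<Longrightarrow> f z = 0" using f by (auto simp: truncated_def)
  from L2_slice(1)[OF assms(1,2) truncatedD(1)[OF f]] show ?thesis
  proof eventually_elim
    case (elim t)
    have "integrable M (\<lambda>x. f (x, t))"
      by (rule integrable_truncated_slice(1)[OF elim finitely_exhaustsD(2,3)[OF assms(3), of n]]) (use n in auto)
    with elim show ?case by simp
  qed
qed

text \<open>For almost every parameter value \<open>t\<close> the slice of a truncated function is square integrable on a set of
  finite measure, hence integrable, and the properties of the kernel apply to that slice.\<close>

lemma isometry_adjoint_parametric:
  assumes K: "plancherel_kernel X F e c" and T: "sigma_finite_measure T"
    and XS: "finitely_exhausts X XS" and FS: "finitely_exhausts F FS"
  shows "isometry_adjoint (X \<Otimes>\<^sub>M T) (F \<Otimes>\<^sub>M T)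
     (\<lambda>g z. ktrans F e (\<lambda>\<xi>. g (\<xi>, snd z)) (fst z))
     (\<lambda>f z. ktrans X (\<lambda>\<xi> x. cnj (e x \<xi>)) (\<lambda>x. f (x, snd z)) (fst z))
     (\<lambda>n. XS n \<times> UNIV) (\<lambda>n. FS n \<times> UNIV) c"
proof -
  interpret K: plancherel_kernel X F e c by fact
  interpret T: sigma_finite_measure T by fact
  interpret XT: pair_sigma_finite X T ..
  interpret FT: pair_sigma_finite F T ..
  let ?A = "\<lambda>g z. ktrans F e (\<lambda>\<xi>. g (\<xi>, snd z)) (fst z)"
  let ?B = "\<lambda>f z. ktrans X (\<lambda>\<xi> x. cnj (e x \<xi>)) (\<lambda>x. f (x, snd z)) (fst z)"
  let ?TF = "truncated (F \<Otimes>\<^sub>M T) (\<lambda>n. FS n \<times> UNIV)"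
  let ?TX = "truncated (X \<Otimes>\<^sub>M T) (\<lambda>n. XS n \<times> UNIV)"
  note sF = truncated_slice_integrable[OF K.sigma_F T FS]
  note sX = truncated_slice_integrable[OF K.sigma_X T XS]
  have A_meas: "?A g \<in> borel_measurable (X \<Otimes>\<^sub>M T)" if "g \<in> ?TF" for g
  proof -
    note [measurable] = truncatedD(2)[OF that]
    show ?thesis by measurable
  qed
  have B_meas: "?B f \<in> borel_measurable (F \<Otimes>\<^sub>M T)" if "f \<in> ?TX" for f
  proof -
    note [measurable] = truncatedD(2)[OF that]
    show ?thesis by measurable
  qed
  have A_norm: "L2_mass (X \<Otimes>\<^sub>M T) (?A g) = ennreal (c * (L2_norm (F \<Otimes>\<^sub>M T) g)\<^sup>2)"
    if g: "g \<in> ?TF" for g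
  proof -
    note [measurable] = A_meas[OF g] truncatedD(2)[OF g]
    have "L2_mass (X \<Otimes>\<^sub>M T) (?A g) = (\<integral>\<^sup>+t. \<integral>\<^sup>+x. ennreal ((cmod (?A g (x, t)))\<^sup>2) \<partial>X \<partial>T)"
      by (rule XT.nn_integral_snd[symmetric]) measurable
    also have "\<dots> = (\<integral>\<^sup>+t. ennreal c * L2_mass F (\<lambda>\<xi>. g (\<xi>, t)) \<partial>T)"
    proof (rule nn_integral_cong_AE, use sF[OF g] in eventually_elim)
      case (elim t) then show ?case using K.plancherel[of "\<lambda>\<xi>. g (\<xi>, t)"] by simp
    qed
    also have "\<dots> = ennreal c * (\<integral>\<^sup>+t. \<integral>\<^sup>+\<xi>. ennreal ((cmod (g (\<xi>, t)))\<^sup>2) \<partial>F \<partial>T)"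
      by (rule nn_integral_cmult) measurable
    finally show ?thesis
      unfolding L2_slice(2)[OF K.sigma_F T truncatedD(1)[OF g]] nn_integral_L2[OF truncatedD(1)[OF g]]
      using K.c_pos by (simp add: ennreal_mult)
  qed
  have A_L2: "?A g \<in> L2_space (X \<Otimes>\<^sub>M T)" if "g \<in> ?TF" for g
    by (rule L2_spaceI[OF A_meas[OF that] order_eq_refl[OF A_norm[OF that]]])
  have B_loc: "(\<lambda>z. indicator (FS m \<times> UNIV) z * ?B f z) \<in> L2_space (F \<Otimes>\<^sub>M T)" if f: "f \<in> ?TX" for f m
  proof -
    note [measurable] = B_meas[OF f] truncatedD(2)[OF f]
    have [measurable]: "FS m \<inter> space F \<in> sets F" by (rule finitely_exhaustsD(2)[OF FS])
    obtain n where n: "\<And>z. z \<notin> XS n \<times> UNIV \<Longrightarrow> f z = 0" using f by (auto simp: truncated_def)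
    define a where "a = emeasure F (FS m \<inter> space F)"
    define b where "b = emeasure X (XS n \<inter> space X)"
    have ab: "a < \<infinity>" "b < \<infinity>" unfolding a_def b_def using finitely_exhaustsD(3)[OF FS] finitely_exhaustsD(3)[OF XS] by blast+
    have ind: "(indicator (FS m \<times> UNIV) z :: complex) = indicator ((FS m \<inter> space F) \<times> space T) z" if "z \<in> space (F \<Otimes>\<^sub>M T)" for z
      using that by (auto simp: indicator_def space_pair_measure)
    have meas: "(\<lambda>z. indicator (FS m \<times> UNIV) z * ?B f z) \<in> borel_measurable (F \<Otimes>\<^sub>M T)"
      by (subst measurable_cong[OF arg_cong2[where f = "(*)", OF ind refl]]) measurable
    have "L2_mass (F \<Otimes>\<^sub>M T) (\<lambda>z. indicator (FS m \<times> UNIV) z * ?B f z) =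
        (\<integral>\<^sup>+t. \<integral>\<^sup>+\<xi>. ennreal ((cmod (indicator (FS m \<times> UNIV) (\<xi>, t) * ?B f (\<xi>, t)))\<^sup>2) \<partial>F \<partial>T)"
      by (rule FT.nn_integral_snd[symmetric]) (use meas in measurable)
    also have "\<dots> \<le> (\<integral>\<^sup>+t. a * b * L2_mass X (\<lambda>x. f (x, t)) \<partial>T)"
    proof (rule nn_integral_mono_AE, use sX[OF f] in eventually_elim)
      case (elim t)
      then have fL: "(\<lambda>x. f (x, t)) \<in> L2_space X" and fi: "integrable X (\<lambda>x. f (x, t))" by auto
      let ?I = "\<integral>\<^sup>+x. ennreal (cmod (f (x, t))) \<partial>X"
      have "L2_mass F (\<lambda>\<xi>. indicator (FS m \<times> UNIV) (\<xi>, t) * ?B f (\<xi>, t)) \<le> (\<integral>\<^sup>+\<xi>. ?I\<^sup>2 * indicator (FS m \<inter> space F) \<xi> \<partial>F)"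
      proof (rule nn_integral_mono)
        fix \<xi> assume \<xi>: "\<xi> \<in> space F"
        have "ennreal (cmod (?B f (\<xi>, t))) \<le> (\<integral>\<^sup>+x. ennreal (cmod (cnj (e x \<xi>) * f (x, t))) \<partial>X)"
          unfolding ktrans_def using integral_norm_bound_ennreal[OF K.integrable_kernel_adj_mult[OF fi \<xi>]] by simp
        also have "\<dots> = ?I" by (simp add: norm_mult K.kernel_norm)
        finally have "ennreal ((cmod (?B f (\<xi>, t)))\<^sup>2) \<le> ?I\<^sup>2"
          unfolding ennreal_power[OF norm_ge_zero, symmetric] by (rule power_mono) simp
        then show "ennreal ((cmod (indicator (FS m \<times> UNIV) (\<xi>, t) * ?B f (\<xi>, t)))\<^sup>2) \<le> ?I\<^sup>2 * indicator (FS m \<inter> space F) \<xi>"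
          using \<xi> by (auto simp: indicator_def)
      qed
      also have "\<dots> = ?I\<^sup>2 * a" unfolding a_def by (rule nn_integral_cmult_indicator) simp
      also have "\<dots> \<le> (b * L2_mass X (\<lambda>x. f (x, t))) * a"
        unfolding b_def using n
        by (intro mult_right_mono integrable_truncated_slice(2)[OF fL finitely_exhaustsD(2,3)[OF XS]]) auto
      finally show "L2_mass F (\<lambda>\<xi>. indicator (FS m \<times> UNIV) (\<xi>, t) * ?B f (\<xi>, t)) \<le>
        a * b * L2_mass X (\<lambda>x. f (x, t))" by (simp add: mult_ac)
    qed
    also have "\<dots> = a * b * (\<integral>\<^sup>+t. \<integral>\<^sup>+x. ennreal ((cmod (f (x, t)))\<^sup>2) \<partial>X \<partial>T)"
      by (rule nn_integral_cmult) measurable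
    also have "\<dots> = a * b * ennreal ((L2_norm (X \<Otimes>\<^sub>M T) f)\<^sup>2)"
      unfolding L2_slice(2)[OF K.sigma_X T truncatedD(1)[OF f]] nn_integral_L2[OF truncatedD(1)[OF f]] ..
    also have "\<dots> < \<infinity>" using ab by (simp add: ennreal_mult_less_top)
    finally show ?thesis using meas unfolding L2_space_def by (auto intro!: integrableI_bounded)
  qed
  have adj: "L2_inner (X \<Otimes>\<^sub>M T) (?A g) f = L2_inner (F \<Otimes>\<^sub>M T) g (?B f)" if f: "f \<in> ?TX" and g: "g \<in> ?TF" for f g
  proof -
    note [measurable] = A_meas[OF g] truncatedD(2)[OF g] B_meas[OF f] truncatedD(2)[OF f]
    obtain m where m: "\<And>z. z \<notin> FS m \<times> UNIV \<Longrightarrow> g z = 0" using g by (auto simp: truncated_def)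
    have i1: "integrable (X \<Otimes>\<^sub>M T) (\<lambda>(x, t). ?A g (x, t) * cnj (f (x, t)))"
      using L2_inner_integrable[OF A_L2[OF g] truncatedD(1)[OF f]] by (simp add: case_prod_unfold)
    have i2: "integrable (F \<Otimes>\<^sub>M T) (\<lambda>(\<xi>, t). g (\<xi>, t) * cnj (?B f (\<xi>, t)))"
    proof -
      have "(\<lambda>z. g z * cnj (indicator (FS m \<times> UNIV) z * ?B f z)) = (\<lambda>z. g z * cnj (?B f z))"
        using m by (auto simp: indicator_def fun_eq_iff)
      then show ?thesis
        using L2_inner_integrable[OF truncatedD(1)[OF g] B_loc[OF f, of m]] by (simp add: case_prod_unfold)
    qed
    have "L2_inner (X \<Otimes>\<^sub>M T) (?A g) f = (\<integral>t. \<integral>x. ?A g (x, t) * cnj (f (x, t)) \<partial>X \<partial>T)"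
      unfolding L2_inner_def using XT.integral_snd[OF i1] by (simp add: case_prod_unfold)
    also have "\<dots> = (\<integral>t. \<integral>\<xi>. g (\<xi>, t) * cnj (?B f (\<xi>, t)) \<partial>F \<partial>T)"
    proof (rule integral_cong_AE)
      show "AE t in T. (\<integral>x. ?A g (x, t) * cnj (f (x, t)) \<partial>X) = (\<integral>\<xi>. g (\<xi>, t) * cnj (?B f (\<xi>, t)) \<partial>F)"
        using sX[OF f] sF[OF g]
      proof eventually_elim
        case (elim t)
        then show ?case
          using K.ktrans_adjoint[of "\<lambda>x. f (x, t)" "\<lambda>\<xi>. g (\<xi>, t)"] by (simp add: L2_inner_def)
      qed
    qed measurable
    also have "\<dots> = L2_inner (F \<Otimes>\<^sub>M T) g (?B f)"
      unfolding L2_inner_def using FT.integral_snd[OF i2] by (simp add: case_prod_unfold)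
    finally show ?thesis .
  qed
  show ?thesis
  proof
    show "exhausts (X \<Otimes>\<^sub>M T) (\<lambda>n. XS n \<times> UNIV)" "exhausts (F \<Otimes>\<^sub>M T) (\<lambda>n. FS n \<times> UNIV)"
      by (auto intro: exhausts_Times_UNIV finitely_exhaustsD(1) XS FS)
    show "0 < c" by (rule K.c_pos)
    show "(L2_norm (X \<Otimes>\<^sub>M T) (?A g))\<^sup>2 = c * (L2_norm (F \<Otimes>\<^sub>M T) g)\<^sup>2" if "g \<in> ?TF" for g
      using A_norm[OF that] nn_integral_L2[OF A_L2[OF that]] K.c_pos by simp
    show "AE z in X \<Otimes>\<^sub>M T. ktrans F e (\<lambda>\<xi>. g (\<xi>, snd z) + a * g' (\<xi>, snd z)) (fst z) = ?A g z + a * ?A g' z"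
      if g: "g \<in> ?TF" and g': "g' \<in> ?TF" for g g' a
    proof -
      have "AE t in T. \<forall>x\<in>space X. ktrans F e (\<lambda>\<xi>. g (\<xi>, t) + a * g' (\<xi>, t)) x = ?A g (x, t) + a * ?A g' (x, t)"
        using sF[OF g] sF[OF g']
      proof eventually_elim
        case (elim t)
        show ?case
        proof
          fix x assume x: "x \<in> space X"
          have "integrable F (\<lambda>\<xi>. e x \<xi> * g (\<xi>, t))" "integrable F (\<lambda>\<xi>. a * (e x \<xi> * g' (\<xi>, t)))"
            using elim K.integrable_kernel_mult[OF _ x] by auto
          from Bochner_Integration.integral_add[OF this]
          show "ktrans F e (\<lambda>\<xi>. g (\<xi>, t) + a * g' (\<xi>, t)) x = ?A g (x, t) + a * ?A g' (x, t)"
            by (simp add: ktrans_def algebra_simps)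
        qed
      qed
      from AE_snd[OF T this, of X] AE_space[of "X \<Otimes>\<^sub>M T"] show ?thesis
        by eventually_elim (auto simp: space_pair_measure)
    qed
    show "AE z in F \<Otimes>\<^sub>M T. ktrans X (\<lambda>\<xi> x. cnj (e x \<xi>)) (\<lambda>x. g (x, snd z) + a * g' (x, snd z)) (fst z) = ?B g z + a * ?B g' z"
      if g: "g \<in> ?TX" and g': "g' \<in> ?TX" for g g' a
    proof -
      have "AE t in T. \<forall>\<xi>\<in>space F. ktrans X (\<lambda>\<xi> x. cnj (e x \<xi>)) (\<lambda>x. g (x, t) + a * g' (x, t)) \<xi> = ?B g (\<xi>, t) + a * ?B g' (\<xi>, t)"
        using sX[OF g] sX[OF g']
      proof eventually_elim
        case (elim t)
        show ?case
        proof
          fix \<xi> assume \<xi>: "\<xi> \<in> space F"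
          have "integrable X (\<lambda>x. cnj (e x \<xi>) * g (x, t))" "integrable X (\<lambda>x. a * (cnj (e x \<xi>) * g' (x, t)))"
            using elim K.integrable_kernel_adj_mult[OF _ \<xi>] by auto
          from Bochner_Integration.integral_add[OF this]
          show "ktrans X (\<lambda>\<xi> x. cnj (e x \<xi>)) (\<lambda>x. g (x, t) + a * g' (x, t)) \<xi> = ?B g (\<xi>, t) + a * ?B g' (\<xi>, t)"
            by (simp add: ktrans_def algebra_simps)
        qed
      qed
      from AE_snd[OF T this, of F] AE_space[of "F \<Otimes>\<^sub>M T"] show ?thesis
        by eventually_elim (auto simp: space_pair_measure)
    qed
  qed (fact A_L2 B_meas B_loc adj)+
qed

text \<open>The maps \<open>p\<close> and \<open>j\<close> are inverse to each other on the whole types, not only on the spaces of the measures, so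
  that a function can be transported without changing its values off the space.\<close>

definition measure_iso :: "'a measure \<Rightarrow> 'b measure \<Rightarrow> ('a \<Rightarrow> 'b) \<Rightarrow> ('b \<Rightarrow> 'a) \<Rightarrow> bool" where
  "measure_iso M N p j \<longleftrightarrow> p \<in> measurable M N \<and> j \<in> measurable N M \<and>
     (\<forall>z. j (p z) = z) \<and> (\<forall>w. p (j w) = w) \<and> distr N M j = M"

lemma measure_isoD:
  assumes "measure_iso M N p j"
  shows "p \<in> measurable M N" "j \<in> measurable N M" "j (p z) = z" "p (j w) = w" "distr N M j = M"
  using assms by (auto simp: measure_iso_def)

lemma measure_iso_AE:
  assumes I: "measure_iso M N p j" and P: "AE w in N. P w" shows "AE z in M. P (p z)"
proof -
  note D = measure_isoD[OF I]
  obtain Z where Z: "{w \<in> space N. \<not> P w} \<subseteq> Z" "Z \<in> sets N" "emeasure N Z = 0"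
    using P by (rule AE_E)
  show ?thesis
  proof (rule AE_I)
    show "{z \<in> space M. \<not> P (p z)} \<subseteq> p -` Z \<inter> space M"
      using Z(1) measurable_space[OF D(1)] by auto
    show "p -` Z \<inter> space M \<in> sets M" by (rule measurable_sets[OF D(1) Z(2)])
    have "emeasure M (p -` Z \<inter> space M) = emeasure (distr N M j) (p -` Z \<inter> space M)" by (simp only: D(5))
    also have "\<dots> = emeasure N (j -` (p -` Z \<inter> space M) \<inter> space N)"
      by (rule emeasure_distr[OF D(2) measurable_sets[OF D(1) Z(2)]])
    also have "j -` (p -` Z \<inter> space M) \<inter> space N = Z"
      using D(4) measurable_space[OF D(2)] sets.sets_into_space[OF Z(2)] by auto
    finally show "emeasure M (p -` Z \<inter> space M) = 0" using Z(3) by simp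
  qed
qed

lemma measure_iso_L2_iff:
  assumes I: "measure_iso M N p j"
  shows "f \<circ> j \<in> L2_space N \<longleftrightarrow> f \<in> L2_space M"
    "f \<in> borel_measurable M \<Longrightarrow> L2_norm N (f \<circ> j) = L2_norm M f"
    "f \<in> borel_measurable M \<Longrightarrow> g \<in> borel_measurable M \<Longrightarrow> L2_inner N (f \<circ> j) (g \<circ> j) = L2_inner M f g"
proof -
  note D = measure_isoD[OF I]
  have m: "f \<circ> j \<in> borel_measurable N \<longleftrightarrow> f \<in> borel_measurable M" for f :: "_ \<Rightarrow> complex"
  proof
    assume "f \<circ> j \<in> borel_measurable N"
    from measurable_comp[OF D(1) this] show "f \<in> borel_measurable M" by (simp add: o_def D(3))
  qed (rule measurable_comp[OF D(2)])
  have i: "integrable N (\<lambda>w. h (j w)) \<longleftrightarrow> integrable M h" if "h \<in> borel_measurable M" for h :: "_ \<Rightarrow> real"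
    using integrable_distr_eq[OF D(2) that] by (simp add: D(5))
  show "f \<circ> j \<in> L2_space N \<longleftrightarrow> f \<in> L2_space M"
    unfolding L2_space_def using m[of f] i[of "\<lambda>z. (cmod (f z))\<^sup>2"] by auto
  show "L2_norm N (f \<circ> j) = L2_norm M f" if [measurable]: "f \<in> borel_measurable M"
    unfolding L2_norm_def using integral_distr[OF D(2), of "\<lambda>z. (cmod (f z))\<^sup>2"] by (simp add: D(5))
  show "L2_inner N (f \<circ> j) (g \<circ> j) = L2_inner M f g"
    if [measurable]: "f \<in> borel_measurable M" "g \<in> borel_measurable M"
    unfolding L2_inner_def using integral_distr[OF D(2), of "\<lambda>z. f z * cnj (g z)"] by (simp add: D(5))
qed

lemma measure_iso_L2_p:
  assumes I: "measure_iso M N p j"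
  shows "f \<circ> p \<in> L2_space M \<longleftrightarrow> f \<in> L2_space N"
    "f \<in> borel_measurable N \<Longrightarrow> L2_norm M (f \<circ> p) = L2_norm N f"
proof -
  note D = measure_isoD[OF I]
  have *: "(f \<circ> p) \<circ> j = f" by (auto simp: o_def D(4))
  show "f \<circ> p \<in> L2_space M \<longleftrightarrow> f \<in> L2_space N" using measure_iso_L2_iff(1)[OF I, of "f \<circ> p"] * by simp
  show "L2_norm M (f \<circ> p) = L2_norm N f" if "f \<in> borel_measurable N"
    using measure_iso_L2_iff(2)[OF I measurable_comp[OF D(1) that]] * by simp
qed

lemma measure_iso_exhausts:
  assumes I: "measure_iso M N p j" and S: "exhausts N S" shows "exhausts M (\<lambda>n. p -` S n)"
proof -
  note D = measure_isoD[OF I]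
  have "p -` S n \<inter> space M = p -` (S n \<inter> space N) \<inter> space M" for n using measurable_space[OF D(1)] by auto
  moreover have "p -` (S n \<inter> space N) \<inter> space M \<in> sets M" for n
    by (rule measurable_sets[OF D(1)]) (use S in \<open>auto simp: exhausts_def\<close>)
  ultimately show ?thesis using S measurable_space[OF D(1)] by (auto simp: exhausts_def incseq_def) blast
qed

lemma measure_iso_truncated:
  assumes I: "measure_iso M N p j" and f: "f \<in> truncated M (\<lambda>n. p -` S n)"
  shows "f \<circ> j \<in> truncated N S"
proof -
  obtain n where "\<And>z. z \<notin> p -` S n \<Longrightarrow> f z = 0" using f by (auto simp: truncated_def)
  then have "\<forall>w. w \<notin> S n \<longrightarrow> (f \<circ> j) w = 0" by (simp add: measure_isoD(4)[OF I])
  then show ?thesis using measure_iso_L2_iff(1)[OF I, of f] f by (auto simp: truncated_def)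
qed

lemma isometry_adjoint_transport:
  assumes O: "isometry_adjoint MX' MF' A' B' XS' FS' c"
    and IX: "measure_iso MX MX' pX jX" and IF: "measure_iso MF MF' pF jF"
  shows "isometry_adjoint MX MF (\<lambda>g. A' (g \<circ> jF) \<circ> pX) (\<lambda>f. B' (f \<circ> jX) \<circ> pF) (\<lambda>n. pX -` XS' n) (\<lambda>n. pF -` FS' n) c"
proof -
  interpret O: isometry_adjoint MX' MF' A' B' XS' FS' c by fact
  note DX = measure_isoD[OF IX] and DF = measure_isoD[OF IF]
  note tX = measure_iso_truncated[OF IX] and tF = measure_iso_truncated[OF IF]
  show ?thesis
  proof
    show "exhausts MX (\<lambda>n. pX -` XS' n)" "exhausts MF (\<lambda>n. pF -` FS' n)" "0 < c"
      using measure_iso_exhausts IX IF O.XS O.FS O.c_pos by blast+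
    fix g assume g: "g \<in> truncated MF (\<lambda>n. pF -` FS' n)"
    show "A' (g \<circ> jF) \<circ> pX \<in> L2_space MX"
      using O.A_L2[OF tF[OF g]] measure_iso_L2_p(1)[OF IX] by blast
    show "(L2_norm MX (A' (g \<circ> jF) \<circ> pX))\<^sup>2 = c * (L2_norm MF g)\<^sup>2"
      using O.A_norm[OF tF[OF g]] measure_iso_L2_p(2)[OF IX L2_spaceD(1)[OF O.A_L2[OF tF[OF g]]]]
        measure_iso_L2_iff(2)[OF IF truncatedD(2)[OF g]] by simp
    show "AE z in MX. (A' ((\<lambda>z. g z + a * g' z) \<circ> jF) \<circ> pX) z = (A' (g \<circ> jF) \<circ> pX) z + a * (A' (g' \<circ> jF) \<circ> pX) z"
      if g': "g' \<in> truncated MF (\<lambda>n. pF -` FS' n)" for g' a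
      using measure_iso_AE[OF IX O.A_lin[OF tF[OF g] tF[OF g'], of a]] by (simp add: o_def)
    show "L2_inner MX (A' (g \<circ> jF) \<circ> pX) f = L2_inner MF g (B' (f \<circ> jX) \<circ> pF)"
      if f: "f \<in> truncated MX (\<lambda>n. pX -` XS' n)" for f
    proof -
      have "L2_inner MX (A' (g \<circ> jF) \<circ> pX) f = L2_inner MX' ((A' (g \<circ> jF) \<circ> pX) \<circ> jX) (f \<circ> jX)"
        by (rule measure_iso_L2_iff(3)[OF IX _ truncatedD(2)[OF f], symmetric])
           (rule measurable_comp[OF DX(1) L2_spaceD(1)[OF O.A_L2[OF tF[OF g]]]])
      also have "(A' (g \<circ> jF) \<circ> pX) \<circ> jX = A' (g \<circ> jF)" by (auto simp: o_def DX(4))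
      also have "L2_inner MX' (A' (g \<circ> jF)) (f \<circ> jX) = L2_inner MF' (g \<circ> jF) (B' (f \<circ> jX))"
        by (rule O.adj[OF tX[OF f] tF[OF g]])
      also have "B' (f \<circ> jX) = (B' (f \<circ> jX) \<circ> pF) \<circ> jF" by (auto simp: o_def DF(4))
      also have "L2_inner MF' (g \<circ> jF) ((B' (f \<circ> jX) \<circ> pF) \<circ> jF) = L2_inner MF g (B' (f \<circ> jX) \<circ> pF)"
        by (rule measure_iso_L2_iff(3)[OF IF truncatedD(2)[OF g]])
           (rule measurable_comp[OF DF(1) O.B_meas[OF tX[OF f]]])
      finally show ?thesis .
    qed
  next
    fix f assume f: "f \<in> truncated MX (\<lambda>n. pX -` XS' n)"
    show "B' (f \<circ> jX) \<circ> pF \<in> borel_measurable MF"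
      by (rule measurable_comp[OF DF(1) O.B_meas[OF tX[OF f]]])
    show "(\<lambda>z. indicator (pF -` FS' n) z * (B' (f \<circ> jX) \<circ> pF) z) \<in> L2_space MF" for n
    proof -
      have "(\<lambda>z. indicator (pF -` FS' n) z * (B' (f \<circ> jX) \<circ> pF) z) = (\<lambda>w. indicator (FS' n) w * B' (f \<circ> jX) w) \<circ> pF"
        by (auto simp: indicator_def fun_eq_iff)
      then show ?thesis using measure_iso_L2_p(1)[OF IF] O.B_loc[OF tX[OF f], of n] by simp
    qed
    show "AE z in MF. (B' ((\<lambda>z. f z + a * f' z) \<circ> jX) \<circ> pF) z = (B' (f \<circ> jX) \<circ> pF) z + a * (B' (f' \<circ> jX) \<circ> pF) z"
      if f': "f' \<in> truncated MX (\<lambda>n. pX -` XS' n)" for f' a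
      using measure_iso_AE[OF IF O.B_lin[OF tX[OF f] tX[OF f'], of a]] by (simp add: o_def)
  qed
qed

text \<open>The nesting of the coordinates \<open>(x, y, t)\<close> puts \<open>y\<close> and \<open>t\<close> together, while the transform in \<open>(x, y)\<close> needs
  \<open>t\<close> separated as a parameter.\<close>

lemma measure_iso_assoc:
  assumes "sigma_finite_measure A" "sigma_finite_measure B" "sigma_finite_measure C"
  shows "measure_iso (A \<Otimes>\<^sub>M (B \<Otimes>\<^sub>M C)) ((A \<Otimes>\<^sub>M B) \<Otimes>\<^sub>M C)
    (\<lambda>z. ((fst z, fst (snd z)), snd (snd z))) (\<lambda>w. (fst (fst w), snd (fst w), snd w))"
proof -
  interpret A: sigma_finite_measure A by fact
  interpret B: sigma_finite_measure B by fact
  interpret C: sigma_finite_measure C by fact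
  interpret BC: pair_sigma_finite B C ..
  let ?j = "\<lambda>w. (fst (fst w), snd (fst w), snd w)"
  have j: "?j \<in> measurable ((A \<Otimes>\<^sub>M B) \<Otimes>\<^sub>M C) (A \<Otimes>\<^sub>M (B \<Otimes>\<^sub>M C))" by measurable
  have "distr ((A \<Otimes>\<^sub>M B) \<Otimes>\<^sub>M C) (A \<Otimes>\<^sub>M (B \<Otimes>\<^sub>M C)) ?j = A \<Otimes>\<^sub>M (B \<Otimes>\<^sub>M C)"
  proof (rule measure_eqI)
    fix S assume "S \<in> sets (distr ((A \<Otimes>\<^sub>M B) \<Otimes>\<^sub>M C) (A \<Otimes>\<^sub>M (B \<Otimes>\<^sub>M C)) ?j)"
    then have S [measurable]: "S \<in> sets (A \<Otimes>\<^sub>M (B \<Otimes>\<^sub>M C))" by simp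
    have [measurable]: "(\<lambda>w. indicator S (?j w) :: ennreal) \<in> borel_measurable ((A \<Otimes>\<^sub>M B) \<Otimes>\<^sub>M C)"
      by (rule measurable_compose[OF j borel_measurable_indicator[OF S]])
    have "(\<lambda>u. \<integral>\<^sup>+t. indicator S (?j (u, t)) \<partial>C) \<in> borel_measurable (A \<Otimes>\<^sub>M B)" by measurable
    then have [measurable]: "(\<lambda>u. \<integral>\<^sup>+t. indicator S (fst u, snd u, t) \<partial>C) \<in> borel_measurable (A \<Otimes>\<^sub>M B)" by simp
    have "emeasure (distr ((A \<Otimes>\<^sub>M B) \<Otimes>\<^sub>M C) (A \<Otimes>\<^sub>M (B \<Otimes>\<^sub>M C)) ?j) S =
       (\<integral>\<^sup>+z. indicator S z \<partial>(distr ((A \<Otimes>\<^sub>M B) \<Otimes>\<^sub>M C) (A \<Otimes>\<^sub>M (B \<Otimes>\<^sub>M C)) ?j))" using S by simp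
    also have "\<dots> = (\<integral>\<^sup>+w. indicator S (?j w) \<partial>((A \<Otimes>\<^sub>M B) \<Otimes>\<^sub>M C))"
      by (rule nn_integral_distr[OF j]) measurable
    also have "\<dots> = (\<integral>\<^sup>+u. \<integral>\<^sup>+t. indicator S (fst u, snd u, t) \<partial>C \<partial>(A \<Otimes>\<^sub>M B))"
      by (subst C.nn_integral_fst[symmetric]) simp_all
    also have "\<dots> = (\<integral>\<^sup>+x. \<integral>\<^sup>+y. \<integral>\<^sup>+t. indicator S (x, y, t) \<partial>C \<partial>B \<partial>A)"
      by (subst B.nn_integral_fst[symmetric]) simp_all
    also have "\<dots> = (\<integral>\<^sup>+x. \<integral>\<^sup>+w. indicator S (x, w) \<partial>(B \<Otimes>\<^sub>M C) \<partial>A)"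
      by (intro nn_integral_cong C.nn_integral_fst) measurable
    also have "\<dots> = emeasure (A \<Otimes>\<^sub>M (B \<Otimes>\<^sub>M C)) S"
      using sigma_finite_measure.nn_integral_fst[OF BC.sigma_finite_measure_axioms, of "indicator S" A] S by simp
    finally show "emeasure (distr ((A \<Otimes>\<^sub>M B) \<Otimes>\<^sub>M C) (A \<Otimes>\<^sub>M (B \<Otimes>\<^sub>M C)) ?j) S = emeasure (A \<Otimes>\<^sub>M (B \<Otimes>\<^sub>M C)) S" .
  qed simp
  then show ?thesis using j unfolding measure_iso_def by auto
qed

text \<open>A one-point parameter space makes the transform in all variables an instance of the transform with a
  parameter.\<close>

lemma measure_iso_unit:
  assumes "sigma_finite_measure M"
  shows "measure_iso M (M \<Otimes>\<^sub>M count_space {()}) (\<lambda>z. (z, ())) fst"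
proof -
  interpret U: sigma_finite_measure "count_space {()}" by (rule sigma_finite_measure_count_space_finite) simp
  have "distr (M \<Otimes>\<^sub>M count_space {()}) M fst = M"
  proof (rule measure_eqI)
    fix S assume "S \<in> sets (distr (M \<Otimes>\<^sub>M count_space {()}) M fst)"
    then have S: "S \<in> sets M" by simp
    have "fst -` S \<inter> space (M \<Otimes>\<^sub>M count_space {()}) = S \<times> {()}"
      using sets.sets_into_space[OF S] by (auto simp: space_pair_measure)
    then show "emeasure (distr (M \<Otimes>\<^sub>M count_space {()}) M fst) S = emeasure M S"
      using S by (simp add: emeasure_distr U.emeasure_pair_measure_Times)
  qed simp
  then show ?thesis unfolding measure_iso_def by auto
qed


section \<open>The two domains\<close>

lemma coordinate_mu: "(\<lambda>\<mu>. \<mu>) \<in> borel_measurable (mu_measure D)"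
  by (cases D) auto

lemma plancherel_kernel_y: "plancherel_kernel (y_measure D) (mu_measure D) (\<lambda>y \<mu>. cis (y * \<mu>)) (2 * pi)"
  by (cases D) (simp_all add: plancherel_kernel_line plancherel_kernel_circle)

lemma sigma_finite_y: "sigma_finite_measure (y_measure D)" and sigma_finite_mu: "sigma_finite_measure (mu_measure D)"
proof -
  interpret plancherel_kernel "y_measure D" "mu_measure D" "\<lambda>y \<mu>. cis (y * \<mu>)" "2 * pi" by (rule plancherel_kernel_y)
  show "sigma_finite_measure (y_measure D)" "sigma_finite_measure (mu_measure D)" by (rule sigma_X, rule sigma_F)
qed

definition xy_measure :: "y_domain \<Rightarrow> (real \<times> real) measure" where
  "xy_measure D = lborel \<Otimes>\<^sub>M y_measure D"

definition ximu_measure :: "y_domain \<Rightarrow> (real \<times> real) measure" where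
  "ximu_measure D = lborel \<Otimes>\<^sub>M mu_measure D"

definition char2 :: "real \<times> real \<Rightarrow> real \<times> real \<Rightarrow> complex" where
  "char2 z \<zeta> = cis (fst z * fst \<zeta>) * cis (snd z * snd \<zeta>)"

definition char3 :: "real \<times> real \<times> real \<Rightarrow> real \<times> real \<times> real \<Rightarrow> complex" where
  "char3 z \<zeta> = cis (fst z * fst \<zeta>) * (cis (fst (snd z) * fst (snd \<zeta>)) * cis (snd (snd z) * snd (snd \<zeta>)))"

lemma plancherel_kernel2: "plancherel_kernel (xy_measure D) (ximu_measure D) char2 (2 * pi * (2 * pi))"
  using plancherel_kernel_pair[OF plancherel_kernel_line plancherel_kernel_y]
  unfolding xy_measure_def ximu_measure_def char2_def[abs_def] .

lemma plancherel_kernel3: "plancherel_kernel (spacetime D) (frequency D) char3 (2 * pi * (2 * pi * (2 * pi)))"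
  using plancherel_kernel_pair[OF plancherel_kernel_line plancherel_kernel_pair[OF plancherel_kernel_y plancherel_kernel_line]]
  unfolding spacetime_def frequency_def char3_def[abs_def] .

lemma sigma_finite_lborel: "sigma_finite_measure lborel"
  by (rule lborel.sigma_finite_measure_axioms)

lemma sigma_finite_pair:
  assumes "sigma_finite_measure M" "sigma_finite_measure N" shows "sigma_finite_measure (M \<Otimes>\<^sub>M N)"
proof -
  interpret M: sigma_finite_measure M by fact
  interpret N: sigma_finite_measure N by fact
  interpret pair_sigma_finite M N ..
  show ?thesis by (rule sigma_finite_measure_axioms)
qed

lemma finitely_exhausts_Times:
  assumes "sigma_finite_measure N" and S: "finitely_exhausts M S" and T: "finitely_exhausts N T"
  shows "finitely_exhausts (M \<Otimes>\<^sub>M N) (\<lambda>n. S n \<times> T n)"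
proof -
  interpret N: sigma_finite_measure N by fact
  have eq: "(S n \<times> T n) \<inter> space (M \<Otimes>\<^sub>M N) = (S n \<inter> space M) \<times> (T n \<inter> space N)" for n
    by (auto simp: space_pair_measure)
  note s = finitely_exhaustsD(2)[OF S] finitely_exhaustsD(2)[OF T]
  have "incseq (\<lambda>n. S n \<times> T n)"
    using finitely_exhaustsD(1)[OF S] finitely_exhaustsD(1)[OF T] by (auto simp: exhausts_def incseq_def) blast+
  moreover have "\<forall>z\<in>space (M \<Otimes>\<^sub>M N). eventually (\<lambda>n. z \<in> S n \<times> T n) sequentially"
    using finitely_exhaustsD(1)[OF S] finitely_exhaustsD(1)[OF T]
    by (auto simp: exhausts_def space_pair_measure eventually_conj_iff)
  moreover have "emeasure (M \<Otimes>\<^sub>M N) ((S n \<times> T n) \<inter> space (M \<Otimes>\<^sub>M N)) < \<infinity>" for n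
    using finitely_exhaustsD(3)[OF S, of n] finitely_exhaustsD(3)[OF T, of n] s
    unfolding eq by (simp add: N.emeasure_pair_measure_Times ennreal_mult_less_top)
  ultimately show ?thesis using s by (auto simp: finitely_exhausts_def exhausts_def eq)
qed

lemma eventually_mem_interval: "eventually (\<lambda>n. (x::real) \<in> {-real n..real n}) sequentially"
  using eventually_ge_at_top[of "nat \<lceil>\<bar>x\<bar>\<rceil>"] by eventually_elim (auto simp: nat_le_iff ceiling_le_iff abs_le_iff)

lemma finitely_exhausts_line: "finitely_exhausts lborel (\<lambda>n. {-real n..real n})"
  using eventually_mem_interval by (auto simp: finitely_exhausts_def exhausts_def incseq_def)

lemma finitely_exhausts_y: "finitely_exhausts (y_measure D) (\<lambda>n. {-real n..real n})"
proof (cases D)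
  case Circle
  have "emeasure (restrict_space lborel {0..<2 * pi}) ({-real n..real n} \<inter> {0..<2 * pi}) < \<infinity>" for n
  proof -
    have "emeasure lborel ({-real n..real n} \<inter> {0..<2 * pi}) \<le> emeasure lborel {-real n..real n}"
      by (rule emeasure_mono) auto
    also have "\<dots> < \<infinity>" by simp
    finally show ?thesis by (simp add: emeasure_restrict_space)
  qed
  then show ?thesis using Circle eventually_mem_interval
    by (auto simp: finitely_exhausts_def exhausts_def incseq_def space_restrict_space sets_restrict_space Int_commute eventually_conj_iff)
qed (simp add: finitely_exhausts_line)

lemma finite_Ints_interval: "finite ({a..b} \<inter> (\<int> :: real set))"
proof -
  have "{a..b} \<inter> \<int> \<subseteq> real_of_int ` {\<lceil>a\<rceil>..\<lfloor>b\<rfloor>}"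
    by (auto elim!: Ints_cases simp: ceiling_le_iff le_floor_iff)
  then show ?thesis by (rule finite_subset) auto
qed

lemma finitely_exhausts_mu: "finitely_exhausts (mu_measure D) (\<lambda>n. {-real n..real n})"
proof (cases D)
  case Circle
  have "emeasure (count_space \<int>) ({-real n..real n} \<inter> \<int>) < \<infinity>" for n
    using finite_Ints_interval[of "-real n" "real n"] by (subst emeasure_count_space) (auto simp: of_nat_less_top)
  then show ?thesis using Circle eventually_mem_interval
    by (auto simp: finitely_exhausts_def exhausts_def incseq_def)
qed (simp add: finitely_exhausts_line)

lemma finitely_exhausts_cube2:
  "finitely_exhausts (xy_measure D) cube2" "finitely_exhausts (ximu_measure D) cube2"
  unfolding xy_measure_def ximu_measure_def cube2_def[abs_def]
  by (intro finitely_exhausts_Times finitely_exhausts_line finitely_exhausts_y finitely_exhausts_mu sigma_finite_y sigma_finite_mu)+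

lemma finitely_exhausts_cube3:
  "finitely_exhausts (spacetime D) cube3" "finitely_exhausts (frequency D) cube3"
  unfolding spacetime_def frequency_def cube3_def[abs_def]
  by (intro finitely_exhausts_Times finitely_exhausts_line finitely_exhausts_y finitely_exhausts_mu
      sigma_finite_y sigma_finite_mu sigma_finite_pair sigma_finite_lborel)+

text \<open>The inverse (synthesis) and forward (analysis) transforms, up to powers of \<open>2 pi\<close>, in all three variables
  and in the first two.\<close>

definition synth3 where "synth3 D g = ktrans (frequency D) char3 g"
definition anal3 where "anal3 D f = ktrans (spacetime D) (\<lambda>\<zeta> z. cnj (char3 z \<zeta>)) f"

definition synth2 where
  "synth2 D g z = ktrans (ximu_measure D) char2 (\<lambda>\<xi>. g (fst \<xi>, snd \<xi>, snd (snd z))) (fst z, fst (snd z))"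
definition anal2 where
  "anal2 D f \<zeta> = ktrans (xy_measure D) (\<lambda>\<zeta> z. cnj (char2 z \<zeta>)) (\<lambda>z. f (fst z, snd z, snd (snd \<zeta>))) (fst \<zeta>, fst (snd \<zeta>))"

definition slab :: "nat \<Rightarrow> (real \<times> real \<times> real) set" where
  "slab n = {z. (fst z, fst (snd z)) \<in> cube2 n}"

lemma isometry_adjoint3:
  "isometry_adjoint (spacetime D) (frequency D) (synth3 D) (anal3 D) cube3 cube3 (2 * pi * (2 * pi * (2 * pi)))"
proof -
  interpret K: plancherel_kernel "spacetime D" "frequency D" char3 "2 * pi * (2 * pi * (2 * pi))"
    by (rule plancherel_kernel3)
  have U: "sigma_finite_measure (count_space {()})" by (rule sigma_finite_measure_count_space_finite) simp
  note I = isometry_adjoint_transport[OF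
    isometry_adjoint_parametric[OF plancherel_kernel3 U finitely_exhausts_cube3]
    measure_iso_unit[OF K.sigma_X] measure_iso_unit[OF K.sigma_F]]
  have v: "(\<lambda>n. (\<lambda>z. (z, ())) -` (cube3 n \<times> UNIV)) = cube3" by (auto simp: fun_eq_iff)
  show ?thesis
    using I unfolding v synth3_def[abs_def] anal3_def[abs_def] by (simp add: o_def)
qed

lemma measure_iso_spacetime:
  "measure_iso (spacetime D) (xy_measure D \<Otimes>\<^sub>M lborel) (\<lambda>z. ((fst z, fst (snd z)), snd (snd z))) (\<lambda>w. (fst (fst w), snd (fst w), snd w))"
  unfolding spacetime_def xy_measure_def
  by (intro measure_iso_assoc sigma_finite_lborel sigma_finite_y)

lemma measure_iso_frequency:
  "measure_iso (frequency D) (ximu_measure D \<Otimes>\<^sub>M lborel) (\<lambda>z. ((fst z, fst (snd z)), snd (snd z))) (\<lambda>w. (fst (fst w), snd (fst w), snd w))"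
  unfolding frequency_def ximu_measure_def
  by (intro measure_iso_assoc sigma_finite_lborel sigma_finite_mu)

lemma isometry_adjoint2:
  "isometry_adjoint (spacetime D) (frequency D) (synth2 D) (anal2 D) slab slab (2 * pi * (2 * pi))"
proof -
  note I = isometry_adjoint_transport[OF
    isometry_adjoint_parametric[OF plancherel_kernel2 sigma_finite_lborel finitely_exhausts_cube2]
    measure_iso_spacetime measure_iso_frequency]
  have v: "(\<lambda>n. (\<lambda>z. ((fst z, fst (snd z)), snd (snd z))) -` (cube2 n \<times> UNIV)) = slab"
    by (auto simp: fun_eq_iff slab_def)
  show ?thesis
    using I unfolding v synth2_def[abs_def] anal2_def[abs_def] by (simp add: o_def)
qed

interpretation I3: isometry_adjoint "spacetime D" "frequency D" "synth3 D" "anal3 D" cube3 cube3 "2 * pi * (2 * pi * (2 * pi))" for D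
  by (rule isometry_adjoint3)

interpretation I2: isometry_adjoint "spacetime D" "frequency D" "synth2 D" "anal2 D" slab slab "2 * pi * (2 * pi)" for D
  by (rule isometry_adjoint2)

lemma fourier_eq: "fourier D u = L2_lim (frequency D) (\<lambda>n. anal3 D (\<lambda>z. indicator (cube3 n) z * u z))"
proof -
  have "set_lebesgue_integral (spacetime D) (cube3 n) (\<lambda>(x, y, t). cis (- (x * \<xi> + y * \<mu> + t * \<tau>)) * u (x, y, t)) =
     anal3 D (\<lambda>z. indicator (cube3 n) z * u z) (\<xi>, \<mu>, \<tau>)" for n \<xi> \<mu> \<tau>
    unfolding set_lebesgue_integral_def anal3_def ktrans_def char3_def
    by (rule Bochner_Integration.integral_cong)
       (auto simp: indicator_def cis_mult cis_cnj case_prod_unfold add.assoc)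
  then show ?thesis unfolding fourier_def by (auto intro!: arg_cong[where f = "L2_lim _"] simp: fun_eq_iff)
qed

lemma inv_fourier_eq: "inv_fourier D g = L2_lim (spacetime D)
   (\<lambda>n z. complex_of_real (1 / (2 * pi) ^ 3) * synth3 D (\<lambda>z. indicator (cube3 n) z * g z) z)"
proof -
  have "set_lebesgue_integral (frequency D) (cube3 n) (\<lambda>(\<xi>, \<mu>, \<tau>). cis (x * \<xi> + y * \<mu> + t * \<tau>) * g (\<xi>, \<mu>, \<tau>)) =
     synth3 D (\<lambda>z. indicator (cube3 n) z * g z) (x, y, t)" for n x y t
    unfolding set_lebesgue_integral_def synth3_def ktrans_def char3_def
    by (rule Bochner_Integration.integral_cong)
       (auto simp: indicator_def cis_mult case_prod_unfold add.assoc)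
  note * = this
  show ?thesis unfolding inv_fourier_def * by (simp add: case_prod_unfold)
qed

lemma fourier_xy_eq: "fourier_xy D u = L2_lim (frequency D) (\<lambda>n. anal2 D (\<lambda>z. indicator (slab n) z * u z))"
proof -
  have "set_lebesgue_integral (lborel \<Otimes>\<^sub>M y_measure D) (cube2 n) (\<lambda>(x, y). cis (- (x * \<xi> + y * \<mu>)) * u (x, y, t)) =
     anal2 D (\<lambda>z. indicator (slab n) z * u z) (\<xi>, \<mu>, t)" for n \<xi> \<mu> t
    unfolding set_lebesgue_integral_def anal2_def ktrans_def char2_def xy_measure_def
    by (rule Bochner_Integration.integral_cong)
       (auto simp: indicator_def slab_def cis_mult cis_cnj case_prod_unfold)
  then show ?thesis unfolding fourier_xy_def by (auto intro!: arg_cong[where f = "L2_lim _"] simp: fun_eq_iff)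
qed

lemma inv_fourier_xy_eq: "inv_fourier_xy D g = L2_lim (spacetime D)
   (\<lambda>n z. complex_of_real (1 / (2 * pi) ^ 2) * synth2 D (\<lambda>z. indicator (slab n) z * g z) z)"
proof -
  have "set_lebesgue_integral (lborel \<Otimes>\<^sub>M mu_measure D) (cube2 n) (\<lambda>(\<xi>, \<mu>). cis (x * \<xi> + y * \<mu>) * g (\<xi>, \<mu>, t)) =
     synth2 D (\<lambda>z. indicator (slab n) z * g z) (x, y, t)" for n x y t
    unfolding set_lebesgue_integral_def synth2_def ktrans_def char2_def ximu_measure_def
    by (rule Bochner_Integration.integral_cong)
       (auto simp: indicator_def slab_def cis_mult case_prod_unfold)
  note * = this
  show ?thesis unfolding inv_fourier_xy_def * by (simp add: case_prod_unfold)
qed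

lemma fourier_tendsto:
  assumes "u \<in> L2_space (spacetime D)"
  shows "L2_tendsto (frequency D) (\<lambda>n. anal3 D (\<lambda>z. indicator (cube3 n) z * u z)) (fourier D u)"
  unfolding fourier_eq using I3.B_tendsto[OF assms] L2_lim_tendsto by blast

lemma fourier_xy_tendsto:
  assumes "u \<in> L2_space (spacetime D)"
  shows "L2_tendsto (frequency D) (\<lambda>n. anal2 D (\<lambda>z. indicator (slab n) z * u z)) (fourier_xy D u)"
  unfolding fourier_xy_eq using I2.B_tendsto[OF assms] L2_lim_tendsto by blast

lemma inv_fourier_tendsto:
  assumes "g \<in> L2_space (frequency D)"
  shows "L2_tendsto (spacetime D)
    (\<lambda>n z. complex_of_real (1 / (2 * pi) ^ 3) * synth3 D (\<lambda>z. indicator (cube3 n) z * g z) z) (inv_fourier D g)"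
  unfolding inv_fourier_eq using I3.A_tendsto[OF assms] L2_lim_tendsto L2_tendsto_cmult by blast

lemma inv_fourier_xy_tendsto:
  assumes "g \<in> L2_space (frequency D)"
  shows "L2_tendsto (spacetime D)
    (\<lambda>n z. complex_of_real (1 / (2 * pi) ^ 2) * synth2 D (\<lambda>z. indicator (slab n) z * g z) z) (inv_fourier_xy D g)"
  unfolding inv_fourier_xy_eq using I2.A_tendsto[OF assms] L2_lim_tendsto L2_tendsto_cmult by blast

section \<open>Composition of the partial transforms\<close>

definition synth_t :: "(real \<times> real \<times> real \<Rightarrow> complex) \<Rightarrow> real \<times> real \<times> real \<Rightarrow> complex" where
  "synth_t g \<zeta> = ktrans lborel (\<lambda>t \<tau>. cis (t * \<tau>)) (\<lambda>\<tau>. g (fst \<zeta>, fst (snd \<zeta>), \<tau>)) (snd (snd \<zeta>))"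

lemma truncated_cube3_integrable:
  assumes "g \<in> truncated (frequency D) cube3" shows "integrable (frequency D) g"
proof -
  obtain n where n: "\<And>z. z \<notin> cube3 n \<Longrightarrow> g z = 0" using assms by (auto simp: truncated_def)
  show ?thesis
    by (rule integrable_truncated_slice(1)[OF truncatedD(1)[OF assms] finitely_exhaustsD(2,3)[OF finitely_exhausts_cube3(2)[of D], of n]])
       (use n in auto)
qed

lemma synth_t_truncated:
  assumes g: "g \<in> truncated (frequency D) cube3"
  shows "synth_t g \<in> truncated (frequency D) slab"
proof -
  interpret L: plancherel_kernel lborel lborel "\<lambda>x \<xi>. cis (x * \<xi>)" "2 * pi" by (rule plancherel_kernel_line)
  interpret F2: sigma_finite_measure "ximu_measure D"
    unfolding ximu_measure_def by (intro sigma_finite_pair sigma_finite_lborel sigma_finite_mu)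
  interpret P: pair_sigma_finite "ximu_measure D" "lborel :: real measure" ..
  let ?j = "\<lambda>w::(real \<times> real) \<times> real. (fst (fst w), snd (fst w), snd w)"
  note iso = measure_iso_frequency[of D] and iD = measure_isoD[OF measure_iso_frequency[of D]]
  define f where "f = g \<circ> ?j"
  have fL: "f \<in> L2_space (ximu_measure D \<Otimes>\<^sub>M lborel)"
    unfolding f_def using measure_iso_L2_iff(1)[OF iso] truncatedD(1)[OF g] by blast
  note [measurable] = L2_spaceD(1)[OF fL]
  have fi: "integrable (ximu_measure D \<Otimes>\<^sub>M lborel) f"
    unfolding f_def o_def using truncated_cube3_integrable[OF g] truncatedD(2)[OF g] integrable_distr_eq[OF iD(2), of g] by (simp add: iD(5))
  define T where "T w = ktrans lborel (\<lambda>t \<tau>. cis (t * \<tau>)) (\<lambda>\<tau>. f (fst w, \<tau>)) (snd w)" for w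
  have [measurable]: "T \<in> borel_measurable (ximu_measure D \<Otimes>\<^sub>M lborel)" unfolding T_def by measurable
  have "L2_mass (ximu_measure D \<Otimes>\<^sub>M lborel) T =
     (\<integral>\<^sup>+\<xi>. \<integral>\<^sup>+t. ennreal ((cmod (T (\<xi>, t)))\<^sup>2) \<partial>lborel \<partial>(ximu_measure D))"
    by (rule lborel.nn_integral_fst[symmetric]) measurable
  also have "\<dots> = (\<integral>\<^sup>+\<xi>. ennreal (2 * pi) * L2_mass lborel (\<lambda>\<tau>. f (\<xi>, \<tau>)) \<partial>(ximu_measure D))"
  proof (rule nn_integral_cong_AE, use P.AE_integrable_fst'[OF fi] P.AE_integrable_fst'[OF L2_spaceD(2)[OF fL]] AE_space in eventually_elim)
    case (elim \<xi>)
    then have "(\<lambda>\<tau>. f (\<xi>, \<tau>)) \<in> L2_space lborel" by (auto simp: L2_space_def)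
    then show ?case using L.plancherel[OF elim(1)] by (simp add: T_def)
  qed
  also have "\<dots> = ennreal (2 * pi) * L2_mass (ximu_measure D \<Otimes>\<^sub>M lborel) f"
    by (subst nn_integral_cmult) (auto simp: lborel.nn_integral_fst[symmetric])
  also have "\<dots> = ennreal (2 * pi * (L2_norm (ximu_measure D \<Otimes>\<^sub>M lborel) f)\<^sup>2)"
    unfolding nn_integral_L2[OF fL] by (simp add: ennreal_mult)
  finally have "T \<in> L2_space (ximu_measure D \<Otimes>\<^sub>M lborel)"
    by (intro L2_spaceI[OF _ order_eq_refl]) auto
  moreover have "T = synth_t g \<circ> ?j" by (auto simp: T_def synth_t_def f_def)
  ultimately have L2: "synth_t g \<in> L2_space (frequency D)" using measure_iso_L2_iff(1)[OF iso] by simp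
  obtain n where n: "\<And>z. z \<notin> cube3 n \<Longrightarrow> g z = 0" using g by (auto simp: truncated_def)
  have "synth_t g \<zeta> = 0" if "\<zeta> \<notin> slab n" for \<zeta>
  proof -
    have "(fst \<zeta>, fst (snd \<zeta>), \<tau>) \<notin> cube3 n" for \<tau> using that by (auto simp: slab_def cube2_def cube3_def)
    then show ?thesis using n unfolding synth_t_def ktrans_def by simp
  qed
  with L2 show ?thesis by (auto simp: truncated_def)
qed

text \<open>The inverse transform in all variables is the inverse transform in \<open>(\<xi>,\<mu>)\<close> after the one in \<open>\<tau>\<close>.\<close>

lemma synth2_synth_t:
  assumes g: "g \<in> truncated (frequency D) cube3" and z: "z \<in> space (spacetime D)"
  shows "synth2 D (synth_t g) z = synth3 D g z"
proof -
  interpret K: plancherel_kernel "spacetime D" "frequency D" char3 "2 * pi * (2 * pi * (2 * pi))"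
    by (rule plancherel_kernel3)
  interpret F2: sigma_finite_measure "ximu_measure D"
    unfolding ximu_measure_def by (intro sigma_finite_pair sigma_finite_lborel sigma_finite_mu)
  interpret P: pair_sigma_finite "ximu_measure D" "lborel :: real measure" ..
  let ?j = "\<lambda>w::(real \<times> real) \<times> real. (fst (fst w), snd (fst w), snd w)"
  note iD = measure_isoD[OF measure_iso_frequency[of D]]
  have i: "integrable (frequency D) (\<lambda>\<zeta>. char3 z \<zeta> * g \<zeta>)"
    by (rule K.integrable_kernel_mult[OF truncated_cube3_integrable[OF g] z])
  have i': "integrable (ximu_measure D \<Otimes>\<^sub>M lborel) (\<lambda>w. char3 z (?j w) * g (?j w))"
    using i integrable_distr_eq[OF iD(2) borel_measurable_integrable[OF i]] by (simp add: iD(5))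
  have "synth3 D g z = (\<integral>w. char3 z (?j w) * g (?j w) \<partial>(ximu_measure D \<Otimes>\<^sub>M lborel))"
    unfolding synth3_def ktrans_def using integral_distr[OF iD(2) borel_measurable_integrable[OF i]] by (simp add: iD(5))
  also have "\<dots> = (\<integral>\<xi>. \<integral>\<tau>. char3 z (fst \<xi>, snd \<xi>, \<tau>) * g (fst \<xi>, snd \<xi>, \<tau>) \<partial>lborel \<partial>(ximu_measure D))"
    using P.integral_fst'[OF i'] by simp
  also have "\<dots> = (\<integral>\<xi>. \<integral>\<tau>. char2 (fst z, fst (snd z)) \<xi> * (cis (snd (snd z) * \<tau>) * g (fst \<xi>, snd \<xi>, \<tau>)) \<partial>lborel \<partial>(ximu_measure D))"
    by (intro Bochner_Integration.integral_cong) (auto simp: char3_def char2_def)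
  also have "\<dots> = synth2 D (synth_t g) z"
    unfolding synth2_def synth_t_def ktrans_def by simp
  finally show ?thesis ..
qed

section \<open>The localized functions\<close>

lemma frequency_coordinates [measurable]:
  "fst \<in> borel_measurable (frequency D)" "(\<lambda>\<zeta>. fst (snd \<zeta>)) \<in> borel_measurable (frequency D)"
  "(\<lambda>\<zeta>. snd (snd \<zeta>)) \<in> borel_measurable (frequency D)"
  using measurable_compose[OF measurable_compose[OF measurable_snd measurable_fst] coordinate_mu, of "lborel :: real measure" D "lborel :: real measure"]
  unfolding frequency_def by simp_all

lemma cutoff_measurable:
  assumes "cutoff \<eta>" shows "\<eta> \<in> borel_measurable borel"
proof -
  have "\<eta> differentiable (at r)" for r using assms unfolding cutoff_def by (metis funpow_0)
  then have "continuous_on UNIV \<eta>"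
    by (intro differentiable_imp_continuous_on) (auto simp: differentiable_on_def)
  then show ?thesis by (rule borel_measurable_continuous_onI)
qed

lemma cutoff_support:
  assumes "cutoff \<eta>" "\<eta> r \<noteq> 0" shows "\<bar>r\<bar> \<le> 8/5"
proof -
  have "r \<in> closure {r. \<eta> r \<noteq> 0}" using assms(2) by (intro subsetD[OF closure_subset]) simp
  moreover have "closure {r. \<eta> r \<noteq> 0} \<subseteq> {-8/5..8/5}" using assms(1) unfolding cutoff_def by (elim conjE)
  ultimately have "r \<in> {-8/5..8/5}" by blast
  then show ?thesis by auto
qed

lemma bump_support:
  assumes "cutoff \<eta>" "bump \<eta> r \<noteq> 0" shows "\<bar>r\<bar> \<le> 8/5" "5/8 \<le> \<bar>r\<bar>"
proof -
  have "\<eta> r \<noteq> 0 \<or> \<eta> (2 * r) \<noteq> 0" using assms(2) by (auto simp: bump_def)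
  then show "\<bar>r\<bar> \<le> 8/5" using cutoff_support[OF assms(1), of r] cutoff_support[OF assms(1), of "2 * r"] by auto
  show "5/8 \<le> \<bar>r\<bar>"
  proof (rule ccontr)
    assume "\<not> 5/8 \<le> \<bar>r\<bar>"
    then have "r \<in> {-5/4..5/4}" "2 * r \<in> {-5/4..5/4}" by auto
    then have "\<eta> r = 1" "\<eta> (2 * r) = 1" using assms(1) unfolding cutoff_def by blast+
    then show False using assms(2) by (simp add: bump_def)
  qed
qed

lemma bump_bounded:
  assumes "cutoff \<eta>" shows "\<bar>bump \<eta> r\<bar> \<le> 1"
proof -
  have "0 \<le> \<eta> r \<and> \<eta> r \<le> 1" "0 \<le> \<eta> (2 * r) \<and> \<eta> (2 * r) \<le> 1" using assms unfolding cutoff_def by blast+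
  then show ?thesis unfolding bump_def by linarith
qed

lemma dyadic_ge_1: "N \<in> dyadic \<Longrightarrow> 1 \<le> N"
  by (auto simp: dyadic_def)

lemma freq_size_nonneg: "0 \<le> freq_size \<xi> \<mu>"
  by (simp add: freq_size_def)

lemma phi_support:
  assumes "cutoff \<eta>" "1 \<le> N" "phi \<eta> N \<xi> \<mu> \<noteq> 0"
  shows "freq_size \<xi> \<mu> \<le> 8/5 * N" "N \<noteq> 1 \<Longrightarrow> 5/8 * N \<le> freq_size \<xi> \<mu>"
proof -
  show "freq_size \<xi> \<mu> \<le> 8/5 * N"
  proof (cases "N = 1")
    case True
    then show ?thesis using assms(3) cutoff_support[OF assms(1), of "freq_size \<xi> \<mu>"] by (simp add: phi_def)
  next
    case False
    then have "\<bar>freq_size \<xi> \<mu> / N\<bar> \<le> 8/5" using assms(3) by (intro bump_support(1)[OF assms(1)]) (simp add: phi_def)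
    then show ?thesis using assms(2) freq_size_nonneg[of \<xi> \<mu>] by (simp add: abs_of_nonneg pos_divide_le_eq)
  qed
  show "5/8 * N \<le> freq_size \<xi> \<mu>" if "N \<noteq> 1"
  proof -
    have "5/8 \<le> \<bar>freq_size \<xi> \<mu> / N\<bar>" using assms(3) that by (intro bump_support(2)[OF assms(1)]) (simp add: phi_def)
    then show ?thesis using assms(2) freq_size_nonneg[of \<xi> \<mu>] by (simp add: abs_of_nonneg pos_le_divide_eq)
  qed
qed

lemma psi_support:
  assumes "cutoff \<eta>" "1 \<le> L" "psi \<eta> L \<xi> \<mu> \<tau> \<noteq> 0"
  shows "\<bar>\<tau> - dispersion \<xi> \<mu>\<bar> \<le> 8/5 * L"
proof (cases "L = 1")
  case True
  then show ?thesis using assms(3) cutoff_support[OF assms(1), of "\<tau> - dispersion \<xi> \<mu>"] by (simp add: psi_def)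
next
  case False
  then have "\<bar>(\<tau> - dispersion \<xi> \<mu>) / L\<bar> \<le> 8/5" using assms(3) by (intro bump_support(1)[OF assms(1)]) (simp add: psi_def)
  then show ?thesis using assms(2) by (simp add: abs_divide pos_divide_le_eq)
qed

lemma cutoff_bounded: "cutoff \<eta> \<Longrightarrow> \<bar>\<eta> r\<bar> \<le> 1"
  unfolding cutoff_def by (metis abs_of_nonneg)

lemma phi_bounded: "cutoff \<eta> \<Longrightarrow> \<bar>phi \<eta> N \<xi> \<mu>\<bar> \<le> 1"
  by (simp add: phi_def bump_bounded cutoff_bounded)

lemma psi_bounded: "cutoff \<eta> \<Longrightarrow> \<bar>psi \<eta> L \<xi> \<mu> \<tau>\<bar> \<le> 1"
  by (simp add: psi_def bump_bounded cutoff_bounded)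

lemma phi_measurable:
  assumes "cutoff \<eta>" shows "(\<lambda>\<zeta>. phi \<eta> N (fst \<zeta>) (fst (snd \<zeta>))) \<in> borel_measurable (frequency D)"
proof -
  note [measurable] = cutoff_measurable[OF assms]
  show ?thesis unfolding phi_def bump_def freq_size_def by measurable
qed

lemma psi_measurable:
  assumes "cutoff \<eta>" shows "(\<lambda>\<zeta>. psi \<eta> L (fst \<zeta>) (fst (snd \<zeta>)) (snd (snd \<zeta>))) \<in> borel_measurable (frequency D)"
proof -
  note [measurable] = cutoff_measurable[OF assms]
  show ?thesis unfolding psi_def bump_def dispersion_def by measurable
qed

text \<open>The cutoffs bound \<open>\<xi>\<close> and \<open>\<mu>\<close>, hence \<open>w(\<xi>,\<mu>)\<close>, hence \<open>\<tau>\<close>.\<close>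

lemma localization_support_bounded:
  assumes "cutoff \<eta>" "1 \<le> N" "1 \<le> L"
  shows "\<exists>m. \<forall>\<zeta>. phi \<eta> N (fst \<zeta>) (fst (snd \<zeta>)) \<noteq> 0 \<and> psi \<eta> L (fst \<zeta>) (fst (snd \<zeta>)) (snd (snd \<zeta>)) \<noteq> 0 \<longrightarrow> \<zeta> \<in> cube3 m"
proof -
  define R where "R = 8/5 * N"
  \<comment> \<open>The sum dominates both \<open>R\<close>, which bounds \<open>\<xi>\<close> and \<open>\<mu>\<close>, and the bound for \<open>\<tau>\<close>.\<close>
  define m where "m = nat \<lceil>R + (8/5 * L + R ^ 3 + R * R\<^sup>2)\<rceil>"
  have R: "1 \<le> R" using assms by (simp add: R_def)
  then have m: "R + (8/5 * L + R ^ 3 + R * R\<^sup>2) \<le> real m" unfolding m_def using assms by (intro order_trans[OF _ of_nat_ceiling]) simp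
  have "(\<xi>, \<mu>, \<tau>) \<in> cube3 m" if "phi \<eta> N \<xi> \<mu> \<noteq> 0" "psi \<eta> L \<xi> \<mu> \<tau> \<noteq> 0" for \<xi> \<mu> \<tau>
  proof -
    have s: "freq_size \<xi> \<mu> \<le> R" using phi_support(1)[OF assms(1,2) that(1)] by (simp add: R_def)
    have "\<bar>\<xi>\<bar> \<le> freq_size \<xi> \<mu>" unfolding freq_size_def by (rule real_le_rsqrt) simp
    then have x: "\<bar>\<xi>\<bar> \<le> R" using s by simp
    have "\<bar>\<mu>\<bar> \<le> freq_size \<xi> \<mu>" unfolding freq_size_def by (rule real_le_rsqrt) simp
    then have y: "\<bar>\<mu>\<bar> \<le> R" using s by simp
    have "\<bar>dispersion \<xi> \<mu>\<bar> \<le> \<bar>\<xi>\<bar> ^ 3 + \<bar>\<xi>\<bar> * \<bar>\<mu>\<bar>\<^sup>2"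
      unfolding dispersion_def by (rule order_trans[OF abs_triangle_ineq]) (simp add: power_abs abs_mult)
    also have "\<dots> \<le> R ^ 3 + R * R\<^sup>2" using x y by (intro add_mono power_mono mult_mono) auto
    finally have "\<bar>\<tau>\<bar> \<le> 8/5 * L + R ^ 3 + R * R\<^sup>2"
      using psi_support[OF assms(1,3) that(2)] by linarith
    moreover have "0 \<le> R ^ 3 + R * R\<^sup>2" using R by simp
    ultimately show ?thesis using x y m assms(3) R by (auto simp: cube3_def abs_le_iff)
  qed
  then show ?thesis by auto
qed

lemma synth_t_mult:
  "synth_t (\<lambda>\<zeta>. a (fst \<zeta>) (fst (snd \<zeta>)) * g \<zeta>) \<zeta> = a (fst \<zeta>) (fst (snd \<zeta>)) * synth_t g \<zeta>"
  unfolding synth_t_def ktrans_def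
  by (simp add: mult.left_commute[of _ "a _ _"])

lemma synth_cmult: "synth3 D (\<lambda>\<zeta>. a * g \<zeta>) z = a * synth3 D g z" "synth2 D (\<lambda>\<zeta>. a * g \<zeta>) z = a * synth2 D g z"
  unfolding synth3_def synth2_def ktrans_def by (simp_all add: mult.left_commute[of _ a])

text \<open>With \<open>h\<close> the cut-off transform of \<open>u\<close>, the function \<open>w = Q u\<close> is the limit of the inverse transforms of the
  truncations \<open>hn n\<close> of \<open>h\<close>. Multiplying the transform of \<open>w\<close> in \<open>(x,y)\<close> by \<open>\<phi>\<close> cuts these down to bounded
  support, so from some \<open>n\<close> on the result no longer depends on \<open>n\<close>: up to powers of \<open>2 pi\<close> it is the
  inverse transform of \<open>G = \<phi> h\<close> in \<open>\<tau>\<close> alone. Undoing the transform in \<open>(x,y)\<close> then gives the inverse transform of \<open>G\<close> in all variables.\<close>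

lemma PQ_representation:
  assumes \<eta>: "cutoff \<eta>" and N: "1 \<le> N" and L: "1 \<le> L" and u: "u \<in> L2_space (spacetime D)"
  shows "P_proj \<eta> D N (Q_proj \<eta> D L u) \<in> L2_space (spacetime D)"
    "\<exists>G\<in>truncated (frequency D) cube3.
       (\<forall>\<zeta>. G \<zeta> \<noteq> 0 \<longrightarrow> phi \<eta> N (fst \<zeta>) (fst (snd \<zeta>)) \<noteq> 0 \<and> psi \<eta> L (fst \<zeta>) (fst (snd \<zeta>)) (snd (snd \<zeta>)) \<noteq> 0) \<and>
       (AE z in spacetime D. P_proj \<eta> D N (Q_proj \<eta> D L u) z = synth3 D G z)"
proof -
  define \<phi> where "\<phi> \<zeta> = complex_of_real (phi \<eta> N (fst \<zeta>) (fst (snd \<zeta>)))" for \<zeta> :: "real \<times> real \<times> real"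
  define h where "h \<zeta> = complex_of_real (psi \<eta> L (fst \<zeta>) (fst (snd \<zeta>)) (snd (snd \<zeta>))) * fourier D u \<zeta>" for \<zeta>
  define w where "w = Q_proj \<eta> D L u"
  define k where "k = fourier_xy D w"
  define G where "G \<zeta> = \<phi> \<zeta> * h \<zeta>" for \<zeta>
  define K3 where "K3 = complex_of_real (1 / (2 * pi) ^ 3)"
  define K2 where "K2 = complex_of_real (1 / (2 * pi) ^ 2)"
  define c2 where "c2 = complex_of_real (2 * pi * (2 * pi))"
  have K2c2: "K2 * c2 = 1" by (simp add: K2_def c2_def power2_eq_square)
  have \<phi>_meas [measurable]: "\<phi> \<in> borel_measurable (frequency D)"
    unfolding \<phi>_def using phi_measurable[OF \<eta>, of N D] by simp
  have \<phi>_le: "cmod (\<phi> \<zeta>) \<le> 1" for \<zeta> using phi_bounded[OF \<eta>] by (simp add: \<phi>_def)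
  have \<phi>_L2: "(\<lambda>\<zeta>. \<phi> \<zeta> * f \<zeta>) \<in> L2_space (frequency D)" if f: "f \<in> L2_space (frequency D)" for f
  proof -
    note [measurable] = L2_spaceD(1)[OF f]
    show ?thesis
      by (rule L2_space_bounded[OF f, of _ 1]) (auto simp: norm_mult intro!: AE_I2 mult_left_le_one_le \<phi>_le)
  qed
  have \<phi>_inner: "L2_inner (frequency D) q (\<lambda>\<zeta>. \<phi> \<zeta> * f \<zeta>) = L2_inner (frequency D) (\<lambda>\<zeta>. \<phi> \<zeta> * q \<zeta>) f" for q f
    unfolding L2_inner_def by (rule Bochner_Integration.integral_cong) (auto simp: \<phi>_def)
  have U: "fourier D u \<in> L2_space (frequency D)" by (rule L2_tendstoD(2)[OF fourier_tendsto[OF u]])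
  have hL: "h \<in> L2_space (frequency D)"
  proof -
    note [measurable] = L2_spaceD(1)[OF U] psi_measurable[OF \<eta>, of L D]
    show ?thesis unfolding h_def
      by (rule L2_space_bounded[OF U, of _ 1]) (auto simp: norm_mult intro!: AE_I2 mult_left_le_one_le psi_bounded \<eta>)
  qed
  have w_eq: "w = inv_fourier D h"
    unfolding w_def Q_proj_def multiplier_def h_def by (simp add: case_prod_unfold)
  note w_lim = inv_fourier_tendsto[OF hL, folded w_eq K3_def]
  have wL: "w \<in> L2_space (spacetime D)" by (rule L2_tendstoD(2)[OF w_lim])
  note k_lim = fourier_xy_tendsto[OF wL, folded k_def]
  have kL: "k \<in> L2_space (frequency D)" by (rule L2_tendstoD(2)[OF k_lim])
  have v_eq: "P_proj \<eta> D N (Q_proj \<eta> D L u) = inv_fourier_xy D (\<lambda>\<zeta>. \<phi> \<zeta> * k \<zeta>)"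
    unfolding P_proj_def multiplier_xy_def \<phi>_def k_def w_def by (simp add: case_prod_unfold)
  note v_lim = inv_fourier_xy_tendsto[OF \<phi>_L2[OF kL], folded v_eq K2_def]
  show vL: "P_proj \<eta> D N (Q_proj \<eta> D L u) \<in> L2_space (spacetime D)" by (rule L2_tendstoD(2)[OF v_lim])
  obtain m where m: "\<And>\<zeta>. phi \<eta> N (fst \<zeta>) (fst (snd \<zeta>)) \<noteq> 0 \<and> psi \<eta> L (fst \<zeta>) (fst (snd \<zeta>)) (snd (snd \<zeta>)) \<noteq> 0 \<Longrightarrow> \<zeta> \<in> cube3 m"
    using localization_support_bounded[OF \<eta> N L] by blast
  have G_supp: "\<zeta> \<in> cube3 m" if "G \<zeta> \<noteq> 0" for \<zeta> using m[of \<zeta>] that by (auto simp: G_def \<phi>_def h_def)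
  have GL: "G \<in> L2_space (frequency D)" unfolding G_def by (rule \<phi>_L2[OF hL])
  have G: "G \<in> truncated (frequency D) cube3" using GL G_supp by (auto simp: truncated_def)
  have cube_mono: "cube3 m \<subseteq> cube3 n" if "m \<le> n" for n using that by (auto simp: cube3_def)
  define hn where "hn n \<zeta> = indicator (cube3 n) \<zeta> * h \<zeta>" for n \<zeta>
  have hn: "hn n \<in> truncated (frequency D) cube3" for n
    unfolding hn_def by (rule truncated_indicator[OF I3.FS hL])
  have \<phi>hn: "\<phi> \<zeta> * synth_t (hn n) \<zeta> = synth_t G \<zeta>" if "m \<le> n" for n \<zeta>
  proof -
    have "(\<lambda>\<zeta>. \<phi> \<zeta> * hn n \<zeta>) = G"
      using G_supp cube_mono[OF that] by (fastforce simp: fun_eq_iff hn_def G_def indicator_def)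
    moreover have "\<phi> \<zeta> * synth_t (hn n) \<zeta> = synth_t (\<lambda>\<zeta>. \<phi> \<zeta> * hn n \<zeta>) \<zeta>"
      unfolding \<phi>_def by (rule synth_t_mult[of "\<lambda>\<xi> \<mu>. complex_of_real (phi \<eta> N \<xi> \<mu>)", symmetric])
    ultimately show ?thesis by simp
  qed
  have TG: "synth_t G \<in> truncated (frequency D) slab" by (rule synth_t_truncated[OF G])
  have \<phi>k: "AE \<zeta> in frequency D. \<phi> \<zeta> * k \<zeta> = (K3 * c2) * synth_t G \<zeta>"
  proof (rule truncated_inner_unique[OF I2.FS \<phi>_L2[OF kL]])
    show "(\<lambda>\<zeta>. (K3 * c2) * synth_t G \<zeta>) \<in> L2_space (frequency D)" by (intro L2_space_cmult truncatedD(1)[OF TG])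
    fix q assume q: "q \<in> truncated (frequency D) slab"
    have \<phi>q: "(\<lambda>\<zeta>. \<phi> \<zeta> * q \<zeta>) \<in> truncated (frequency D) slab"
      using q \<phi>_L2[OF truncatedD(1)[OF q]] by (auto simp: truncated_def)
    note Aq = I2.A_L2[OF \<phi>q]
    have "(\<lambda>n. L2_inner (spacetime D) (synth2 D (\<lambda>\<zeta>. \<phi> \<zeta> * q \<zeta>)) (\<lambda>z. K3 * synth3 D (hn n) z))
        \<longlonglongrightarrow> L2_inner (spacetime D) (synth2 D (\<lambda>\<zeta>. \<phi> \<zeta> * q \<zeta>)) w"
      unfolding hn_def by (rule L2_tendsto_inner_right[OF w_lim Aq])
    moreover have "L2_inner (spacetime D) (synth2 D (\<lambda>\<zeta>. \<phi> \<zeta> * q \<zeta>)) (\<lambda>z. K3 * synth3 D (hn n) z) =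
        L2_inner (frequency D) q (\<lambda>\<zeta>. (K3 * c2) * synth_t G \<zeta>)" if n: "m \<le> n" for n
    proof -
      have "L2_inner (spacetime D) (synth2 D (\<lambda>\<zeta>. \<phi> \<zeta> * q \<zeta>)) (\<lambda>z. K3 * synth3 D (hn n) z) =
          L2_inner (spacetime D) (synth2 D (\<lambda>\<zeta>. \<phi> \<zeta> * q \<zeta>)) (\<lambda>z. K3 * synth2 D (synth_t (hn n)) z)"
        unfolding L2_inner_def by (rule Bochner_Integration.integral_cong) (simp_all add: synth2_synth_t[OF hn])
      also have "\<dots> = K3 * (c2 * L2_inner (frequency D) (\<lambda>\<zeta>. \<phi> \<zeta> * q \<zeta>) (synth_t (hn n)))"
        unfolding L2_inner_cmult_right I2.A_inner[OF \<phi>q synth_t_truncated[OF hn]] by (simp add: K3_def c2_def)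
      also have "\<dots> = K3 * c2 * L2_inner (frequency D) q (synth_t G)"
        unfolding \<phi>_inner[symmetric] using \<phi>hn[OF n] by simp
      also have "\<dots> = L2_inner (frequency D) q (\<lambda>\<zeta>. (K3 * c2) * synth_t G \<zeta>)"
        unfolding L2_inner_cmult_right by (simp add: K3_def c2_def)
      finally show ?thesis .
    qed
    then have "(\<lambda>n. L2_inner (spacetime D) (synth2 D (\<lambda>\<zeta>. \<phi> \<zeta> * q \<zeta>)) (\<lambda>z. K3 * synth3 D (hn n) z))
        \<longlonglongrightarrow> L2_inner (frequency D) q (\<lambda>\<zeta>. (K3 * c2) * synth_t G \<zeta>)"
      by (intro tendsto_eventually eventually_sequentiallyI[of m])
    ultimately have "L2_inner (spacetime D) (synth2 D (\<lambda>\<zeta>. \<phi> \<zeta> * q \<zeta>)) w = L2_inner (frequency D) q (\<lambda>\<zeta>. (K3 * c2) * synth_t G \<zeta>)"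
      by (rule LIMSEQ_unique)
    then show "L2_inner (frequency D) q (\<lambda>\<zeta>. \<phi> \<zeta> * k \<zeta>) = L2_inner (frequency D) q (\<lambda>\<zeta>. (K3 * c2) * synth_t G \<zeta>)"
      unfolding \<phi>_inner I2.B_lim_inner[OF wL k_lim \<phi>q] .
  qed
  have scaled: "(\<lambda>\<zeta>. (K3 * c2) * synth_t G \<zeta>) \<in> truncated (frequency D) slab"
    by (rule truncated_cmult[OF TG])
  obtain m' where m': "\<And>\<zeta>. \<zeta> \<notin> slab m' \<Longrightarrow> synth_t G \<zeta> = 0" using TG by (auto simp: truncated_def)
  have slab_mono: "slab m' \<subseteq> slab n" if "m' \<le> n" for n using that by (auto simp: slab_def cube2_def)
  have "AE z in spacetime D. P_proj \<eta> D N (Q_proj \<eta> D L u) z = synth3 D (\<lambda>\<zeta>. K3 * G \<zeta>) z"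
  proof (rule L2_tendsto_eventually_AE[OF v_lim])
    have KG: "(\<lambda>\<zeta>. K3 * G \<zeta>) \<in> truncated (frequency D) cube3"
      by (rule truncated_cmult[OF G])
    show "synth3 D (\<lambda>\<zeta>. K3 * G \<zeta>) \<in> borel_measurable (spacetime D)"
      by (rule L2_spaceD(1)[OF I3.A_L2[OF KG]])
    show "eventually (\<lambda>n. AE z in spacetime D. K2 * synth2 D (\<lambda>z. indicator (slab n) z * (\<phi> z * k z)) z = synth3 D (\<lambda>\<zeta>. K3 * G \<zeta>) z) sequentially"
      using eventually_ge_at_top[of m']
    proof eventually_elim
      case (elim n)
      have t: "(\<lambda>z. indicator (slab n) z * (\<phi> z * k z)) \<in> truncated (frequency D) slab"
        by (rule truncated_indicator[OF I2.FS \<phi>_L2[OF kL]])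
      have "AE \<zeta> in frequency D. indicator (slab n) \<zeta> * (\<phi> \<zeta> * k \<zeta>) = (K3 * c2) * synth_t G \<zeta>"
        using \<phi>k
      proof eventually_elim
        case (elim \<zeta>) then show ?case using m'[of \<zeta>] slab_mono[OF \<open>m' \<le> n\<close>] by (auto simp: indicator_def)
      qed
      from I2.A_cong_AE[OF t scaled this] AE_space
      show ?case
      proof eventually_elim
        case (elim z)
        have "K2 * synth2 D (\<lambda>z. indicator (slab n) z * (\<phi> z * k z)) z = (K2 * c2) * (K3 * synth3 D G z)"
          unfolding elim(1) synth_cmult synth2_synth_t[OF G elim(2)] by simp
        then show ?case unfolding K2c2 synth_cmult by simp
      qed
    qed
  qed
  moreover have "(\<lambda>\<zeta>. K3 * G \<zeta>) \<in> truncated (frequency D) cube3"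
    by (rule truncated_cmult[OF G])
  moreover have "\<forall>\<zeta>. K3 * G \<zeta> \<noteq> 0 \<longrightarrow> phi \<eta> N (fst \<zeta>) (fst (snd \<zeta>)) \<noteq> 0 \<and> psi \<eta> L (fst \<zeta>) (fst (snd \<zeta>)) (snd (snd \<zeta>)) \<noteq> 0"
    by (auto simp: G_def \<phi>_def h_def)
  ultimately show "\<exists>G\<in>truncated (frequency D) cube3.
       (\<forall>\<zeta>. G \<zeta> \<noteq> 0 \<longrightarrow> phi \<eta> N (fst \<zeta>) (fst (snd \<zeta>)) \<noteq> 0 \<and> psi \<eta> L (fst \<zeta>) (fst (snd \<zeta>)) (snd (snd \<zeta>)) \<noteq> 0) \<and>
       (AE z in spacetime D. P_proj \<eta> D N (Q_proj \<eta> D L u) z = synth3 D G z)"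
    by (intro bexI[of _ "\<lambda>\<zeta>. K3 * G \<zeta>"] conjI)
qed


section \<open>Convolution on the dual group\<close>

lemma measurable_diff_mu: "(\<lambda>z. fst z - snd z) \<in> measurable (mu_measure D \<Otimes>\<^sub>M mu_measure D) (mu_measure D)"
proof (cases D)
  case Circle
  have c: "countable (\<int> :: real set)" by (simp add: Ints_def)
  have "count_space \<int> \<Otimes>\<^sub>M count_space \<int> = (count_space (\<int> \<times> \<int>) :: (real \<times> real) measure)"
    by (rule pair_measure_countable[OF c c])
  then show ?thesis using Circle by auto
qed simp

lemma distr_translate_mu:
  assumes "a \<in> space (mu_measure D)"
  shows "distr (mu_measure D) (mu_measure D) (\<lambda>x. x - a) = mu_measure D"
proof (cases D)
  case Line
  have "distr lborel lborel (\<lambda>x. x - a) = distr lborel borel ((+) (- a))"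
    by (rule distr_cong) auto
  then show ?thesis using Line lborel_distr_plus[of "- a"] by simp
next
  case Circle
  have "bij_betw (\<lambda>x. x - a) \<int> (\<int> :: real set)"
    by (rule bij_betw_byWitness[of _ "\<lambda>x. x + a"]) (use assms Circle in auto)
  then show ?thesis using Circle by (simp add: distr_bij_count_space)
qed

lemma measurable_diff_frequency:
  assumes [measurable]: "f \<in> measurable M (frequency D)" "g \<in> measurable M (frequency D)"
  shows "(\<lambda>z. f z - g z) \<in> measurable M (frequency D)"
proof -
  have f: "(\<lambda>z. fst (f z)) \<in> borel_measurable M" "(\<lambda>z. fst (snd (f z))) \<in> measurable M (mu_measure D)"
     "(\<lambda>z. snd (snd (f z))) \<in> borel_measurable M"
    using assms(1) unfolding frequency_def by measurable
  have g: "(\<lambda>z. fst (g z)) \<in> borel_measurable M" "(\<lambda>z. fst (snd (g z))) \<in> measurable M (mu_measure D)"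
     "(\<lambda>z. snd (snd (g z))) \<in> borel_measurable M"
    using assms(2) unfolding frequency_def by measurable
  have mu: "(\<lambda>z. fst (snd (f z)) - fst (snd (g z))) \<in> measurable M (mu_measure D)"
    using measurable_compose[OF measurable_Pair[OF f(2) g(2)] measurable_diff_mu] by simp
  have "(\<lambda>z. (fst (f z) - fst (g z), fst (snd (f z)) - fst (snd (g z)), snd (snd (f z)) - snd (snd (g z)))) \<in> measurable M (frequency D)"
    unfolding frequency_def
    by (intro measurable_Pair mu) (use f(1,3) g(1,3) in simp_all)
  moreover have "(\<lambda>z. (fst (f z) - fst (g z), fst (snd (f z)) - fst (snd (g z)), snd (snd (f z)) - snd (snd (g z)))) = (\<lambda>z. f z - g z)"
    by (simp add: fun_eq_iff prod_eq_iff)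
  ultimately show ?thesis by simp
qed

lemma distr_translate_frequency:
  assumes a: "a \<in> space (frequency D)"
  shows "distr (frequency D) (frequency D) (\<lambda>\<zeta>. \<zeta> - a) = frequency D"
proof -
  obtain a1 a2 a3 where a': "a = (a1, a2, a3)" by (cases a)
  have a2: "a2 \<in> space (mu_measure D)" using a unfolding a' frequency_def by (auto simp: space_pair_measure)
  have l: "distr lborel lborel (\<lambda>x. x - r) = (lborel :: real measure)" for r
  proof -
    have "distr lborel lborel (\<lambda>x. x - r) = distr lborel borel ((+) (- r))" by (rule distr_cong) auto
    then show ?thesis using lborel_distr_plus[of "- r"] by simp
  qed
  have m: "(\<lambda>x. x - a2) \<in> measurable (mu_measure D) (mu_measure D)"
    using measurable_compose[OF measurable_Pair[OF measurable_ident_sets[OF refl] measurable_const[OF a2]] measurable_diff_mu] by simp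
  have 1: "distr (mu_measure D \<Otimes>\<^sub>M lborel) (mu_measure D \<Otimes>\<^sub>M lborel) (\<lambda>(x, y). (x - a2, y - a3)) = mu_measure D \<Otimes>\<^sub>M lborel"
    using pair_measure_distr[OF m, of "\<lambda>x. x - a3" lborel lborel] by (simp add: l distr_translate_mu[OF a2] sigma_finite_lborel)
  have m': "(\<lambda>(x, y). (x - a2, y - a3)) \<in> measurable (mu_measure D \<Otimes>\<^sub>M lborel) (mu_measure D \<Otimes>\<^sub>M lborel)"
    using m by measurable
  have "distr (lborel \<Otimes>\<^sub>M (mu_measure D \<Otimes>\<^sub>M lborel)) (lborel \<Otimes>\<^sub>M (mu_measure D \<Otimes>\<^sub>M lborel))
     (\<lambda>(x, y). (x - a1, (\<lambda>(x, y). (x - a2, y - a3)) y)) = lborel \<Otimes>\<^sub>M (mu_measure D \<Otimes>\<^sub>M lborel)"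
    using pair_measure_distr[of "\<lambda>x. x - a1" lborel lborel, OF _ m']
    by (simp add: l 1 sigma_finite_pair sigma_finite_lborel sigma_finite_mu)
  moreover have "(\<lambda>(x, y). (x - a1, (\<lambda>(x, y). (x - a2, y - a3)) y)) = (\<lambda>\<zeta>. \<zeta> - a)"
    by (auto simp: fun_eq_iff a')
  ultimately show ?thesis unfolding frequency_def by simp
qed

lemma translate_frequency:
  assumes a: "a \<in> space (frequency D)"
  shows "f \<in> borel_measurable (frequency D) \<Longrightarrow> (\<integral>\<^sup>+\<zeta>. f (\<zeta> - a) \<partial>(frequency D)) = (\<integral>\<^sup>+\<zeta>. f \<zeta> \<partial>(frequency D))"
    "g \<in> borel_measurable (frequency D) \<Longrightarrow> (\<integral>\<zeta>. g (\<zeta> - a) \<partial>(frequency D)) = (\<integral>\<zeta>. g \<zeta> \<partial>(frequency D) :: complex)"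
proof -
  have m: "(\<lambda>\<zeta>. \<zeta> - a) \<in> measurable (frequency D) (frequency D)"
    by (intro measurable_diff_frequency measurable_ident_sets[OF refl] measurable_const a)
  show "(\<integral>\<^sup>+\<zeta>. f (\<zeta> - a) \<partial>(frequency D)) = (\<integral>\<^sup>+\<zeta>. f \<zeta> \<partial>(frequency D))" if "f \<in> borel_measurable (frequency D)"
    using nn_integral_distr[OF m, of f] that by (simp add: distr_translate_frequency[OF a])
  show "(\<integral>\<zeta>. g (\<zeta> - a) \<partial>(frequency D)) = (\<integral>\<zeta>. g \<zeta> \<partial>(frequency D))" if "g \<in> borel_measurable (frequency D)"
    using integral_distr[OF m that] by (simp add: distr_translate_frequency[OF a])
qed

definition convolution where
  "convolution D g1 g2 \<zeta> = (\<integral>\<zeta>1. g1 \<zeta>1 * g2 (\<zeta> - \<zeta>1) \<partial>(frequency D))" for g1 g2 :: "real \<times> real \<times> real \<Rightarrow> complex"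

interpretation K3: plancherel_kernel "spacetime D" "frequency D" char3 "2 * pi * (2 * pi * (2 * pi))" for D
  by (rule plancherel_kernel3)

interpretation FF: pair_sigma_finite "frequency D" "frequency D" for D ..

lemma convolution_integrable:
  assumes g1: "integrable (frequency D) g1" and g2: "integrable (frequency D) g2"
  shows "integrable (frequency D \<Otimes>\<^sub>M frequency D) (\<lambda>(\<zeta>1, \<zeta>). g1 \<zeta>1 * g2 (\<zeta> - \<zeta>1))"
    "integrable (frequency D) (convolution D g1 g2)"
proof -
  note [measurable] = borel_measurable_integrable[OF g1] borel_measurable_integrable[OF g2]
  have [measurable]: "(\<lambda>z. g2 (snd z - fst z)) \<in> borel_measurable (frequency D \<Otimes>\<^sub>M frequency D)"
    by (rule measurable_compose[OF measurable_diff_frequency borel_measurable_integrable[OF g2]]) measurable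
  have "(\<integral>\<^sup>+z. ennreal (norm (case z of (\<zeta>1, \<zeta>) \<Rightarrow> g1 \<zeta>1 * g2 (\<zeta> - \<zeta>1))) \<partial>(frequency D \<Otimes>\<^sub>M frequency D)) =
    (\<integral>\<^sup>+\<zeta>1. \<integral>\<^sup>+\<zeta>. ennreal (cmod (g1 \<zeta>1)) * ennreal (cmod (g2 (\<zeta> - \<zeta>1))) \<partial>(frequency D) \<partial>(frequency D))"
    by (subst K3.F.nn_integral_fst[symmetric]) (auto simp: norm_mult ennreal_mult case_prod_unfold)
  also have "\<dots> = (\<integral>\<^sup>+\<zeta>1. ennreal (cmod (g1 \<zeta>1)) * (\<integral>\<^sup>+\<zeta>. ennreal (cmod (g2 \<zeta>)) \<partial>(frequency D)) \<partial>(frequency D))"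
  proof (rule nn_integral_cong)
    fix \<zeta>1 assume \<zeta>1: "\<zeta>1 \<in> space (frequency D)"
    have [measurable]: "(\<lambda>\<zeta>. g2 (\<zeta> - \<zeta>1)) \<in> borel_measurable (frequency D)"
      by (rule measurable_compose[OF measurable_diff_frequency borel_measurable_integrable[OF g2]])
         (use \<zeta>1 in \<open>auto intro: measurable_ident_sets[OF refl] measurable_const\<close>)
    show "(\<integral>\<^sup>+\<zeta>. ennreal (cmod (g1 \<zeta>1)) * ennreal (cmod (g2 (\<zeta> - \<zeta>1))) \<partial>(frequency D)) =
        ennreal (cmod (g1 \<zeta>1)) * (\<integral>\<^sup>+\<zeta>. ennreal (cmod (g2 \<zeta>)) \<partial>(frequency D))"
      using translate_frequency(1)[OF \<zeta>1, of "\<lambda>\<zeta>. ennreal (cmod (g2 \<zeta>))"] by (subst nn_integral_cmult) auto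
  qed
  also have "\<dots> = (\<integral>\<^sup>+\<zeta>1. ennreal (cmod (g1 \<zeta>1)) \<partial>(frequency D)) * (\<integral>\<^sup>+\<zeta>. ennreal (cmod (g2 \<zeta>)) \<partial>(frequency D))"
    by (rule nn_integral_multc) measurable
  also have "\<dots> < \<infinity>" using g1 g2 by (auto simp: integrable_iff_bounded ennreal_mult_less_top)
  finally show i: "integrable (frequency D \<Otimes>\<^sub>M frequency D) (\<lambda>(\<zeta>1, \<zeta>). g1 \<zeta>1 * g2 (\<zeta> - \<zeta>1))"
    by (intro integrableI_bounded) (auto simp: case_prod_unfold)
  show "integrable (frequency D) (convolution D g1 g2)"
    unfolding convolution_def[abs_def] by (rule FF.integrable_snd[OF i])
qed

lemma char3_add: "char3 z \<zeta>1 * char3 z (\<zeta> - \<zeta>1) = char3 z \<zeta>"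
  unfolding char3_def by (simp add: cis_mult algebra_simps)

text \<open>Absolute convergence allows the double integral over \<open>(\<zeta>1, \<zeta> - \<zeta>1)\<close> to be read in both orders; the kernel is a
  character of the dual group.\<close>

lemma synth3_mult:
  assumes g1: "integrable (frequency D) g1" and g2: "integrable (frequency D) g2" and z: "z \<in> space (spacetime D)"
  shows "synth3 D g1 z * synth3 D g2 z = synth3 D (convolution D g1 g2) z"
proof -
  note [measurable] = borel_measurable_integrable[OF g1] borel_measurable_integrable[OF g2]
  note i = convolution_integrable[OF g1 g2]
  have [measurable]: "(\<lambda>z. g2 (snd z - fst z)) \<in> borel_measurable (frequency D \<Otimes>\<^sub>M frequency D)"
    by (rule measurable_compose[OF measurable_diff_frequency borel_measurable_integrable[OF g2]]) measurable
  have h: "integrable (frequency D \<Otimes>\<^sub>M frequency D) (\<lambda>(\<zeta>1, \<zeta>). char3 z \<zeta> * (g1 \<zeta>1 * g2 (\<zeta> - \<zeta>1)))"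
    by (rule Bochner_Integration.integrable_bound[OF i(1)])
       (use z in \<open>auto simp: norm_mult K3.kernel_norm case_prod_unfold\<close>)
  have "synth3 D (convolution D g1 g2) z = (\<integral>\<zeta>. \<integral>\<zeta>1. char3 z \<zeta> * (g1 \<zeta>1 * g2 (\<zeta> - \<zeta>1)) \<partial>(frequency D) \<partial>(frequency D))"
    unfolding synth3_def ktrans_def convolution_def by simp
  also have "\<dots> = (\<integral>\<zeta>1. \<integral>\<zeta>. char3 z \<zeta> * (g1 \<zeta>1 * g2 (\<zeta> - \<zeta>1)) \<partial>(frequency D) \<partial>(frequency D))"
    by (rule FF.Fubini_integral[OF h])
  also have "\<dots> = (\<integral>\<zeta>1. char3 z \<zeta>1 * g1 \<zeta>1 * synth3 D g2 z \<partial>(frequency D))"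
  proof (rule Bochner_Integration.integral_cong[OF refl])
    fix \<zeta>1 assume \<zeta>1: "\<zeta>1 \<in> space (frequency D)"
    have "char3 z \<zeta> * (g1 \<zeta>1 * g2 (\<zeta> - \<zeta>1)) = char3 z \<zeta>1 * g1 \<zeta>1 * (char3 z (\<zeta> - \<zeta>1) * g2 (\<zeta> - \<zeta>1))" for \<zeta>
      by (subst char3_add[of z \<zeta>1 \<zeta>, symmetric]) (simp only: mult_ac)
    then have "(\<integral>\<zeta>. char3 z \<zeta> * (g1 \<zeta>1 * g2 (\<zeta> - \<zeta>1)) \<partial>(frequency D)) =
        (\<integral>\<zeta>. char3 z \<zeta>1 * g1 \<zeta>1 * (char3 z (\<zeta> - \<zeta>1) * g2 (\<zeta> - \<zeta>1)) \<partial>(frequency D))"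
      by presburger
    also have "\<dots> = char3 z \<zeta>1 * g1 \<zeta>1 * (\<integral>\<zeta>. char3 z (\<zeta> - \<zeta>1) * g2 (\<zeta> - \<zeta>1) \<partial>(frequency D))"
      by (rule integral_mult_right_zero)
    also have "(\<integral>\<zeta>. char3 z (\<zeta> - \<zeta>1) * g2 (\<zeta> - \<zeta>1) \<partial>(frequency D)) = synth3 D g2 z"
      unfolding synth3_def ktrans_def
      by (rule translate_frequency(2)[OF \<zeta>1, of "\<lambda>\<zeta>. char3 z \<zeta> * g2 \<zeta>"]) (use z in measurable)
    finally show "(\<integral>\<zeta>. char3 z \<zeta> * (g1 \<zeta>1 * g2 (\<zeta> - \<zeta>1)) \<partial>(frequency D)) = char3 z \<zeta>1 * g1 \<zeta>1 * synth3 D g2 z" .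
  qed
  also have "\<dots> = synth3 D g1 z * synth3 D g2 z" unfolding synth3_def ktrans_def by simp
  finally show ?thesis ..
qed

text \<open>For fixed \<open>\<zeta>\<close> the convolution integral runs over the \<open>\<zeta>1\<close> where both factors are nonzero. The Cauchy-Schwarz
  inequality costs the measure of that set, and translation invariance evaluates what is left.\<close>

lemma convolution_L2_bound:
  assumes g1: "g1 \<in> L2_space (frequency D)" and g2: "g2 \<in> L2_space (frequency D)" and K: "0 \<le> K"
    and fibre: "\<And>\<zeta>. \<zeta> \<in> space (frequency D) \<Longrightarrow>
      emeasure (frequency D) {\<zeta>1 \<in> space (frequency D). g1 \<zeta>1 \<noteq> 0 \<and> g2 (\<zeta> - \<zeta>1) \<noteq> 0} \<le> ennreal K"
  shows "L2_mass (frequency D) (convolution D g1 g2) \<le>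
    ennreal (K * (L2_norm (frequency D) g1)\<^sup>2 * (L2_norm (frequency D) g2)\<^sup>2)"
proof -
  note [measurable] = L2_spaceD(1)[OF g1] L2_spaceD(1)[OF g2]
  have [measurable]: "(\<lambda>z. g2 (fst z - snd z)) \<in> borel_measurable (frequency D \<Otimes>\<^sub>M frequency D)"
    by (rule measurable_compose[OF measurable_diff_frequency L2_spaceD(1)[OF g2]]) measurable
  have m2: "(\<lambda>\<zeta>1. g2 (\<zeta> - \<zeta>1)) \<in> borel_measurable (frequency D)" if "\<zeta> \<in> space (frequency D)" for \<zeta>
    by (rule measurable_compose[OF measurable_diff_frequency L2_spaceD(1)[OF g2]]) (use that in \<open>auto intro: measurable_ident_sets[OF refl] measurable_const\<close>)
  have m2': "(\<lambda>\<zeta>. g2 (\<zeta> - \<zeta>1)) \<in> borel_measurable (frequency D)" if "\<zeta>1 \<in> space (frequency D)" for \<zeta>1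
    by (rule measurable_compose[OF measurable_diff_frequency L2_spaceD(1)[OF g2]]) (use that in \<open>auto intro: measurable_ident_sets[OF refl] measurable_const\<close>)
  have pw: "ennreal ((cmod (convolution D g1 g2 \<zeta>))\<^sup>2) \<le>
      ennreal K * (\<integral>\<^sup>+\<zeta>1. ennreal ((cmod (g1 \<zeta>1))\<^sup>2) * ennreal ((cmod (g2 (\<zeta> - \<zeta>1)))\<^sup>2) \<partial>(frequency D))"
    if \<zeta>: "\<zeta> \<in> space (frequency D)" for \<zeta>
  proof -
    note [measurable] = m2[OF \<zeta>]
    let ?S = "{\<zeta>1 \<in> space (frequency D). g1 \<zeta>1 \<noteq> 0 \<and> g2 (\<zeta> - \<zeta>1) \<noteq> 0}"
    let ?p = "\<lambda>\<zeta>1. ennreal (cmod (g1 \<zeta>1)) * ennreal (cmod (g2 (\<zeta> - \<zeta>1)))"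
    have "ennreal (cmod (convolution D g1 g2 \<zeta>)) \<le> (\<integral>\<^sup>+\<zeta>1. ennreal (cmod (g1 \<zeta>1 * g2 (\<zeta> - \<zeta>1))) \<partial>(frequency D))"
    proof (cases "integrable (frequency D) (\<lambda>\<zeta>1. g1 \<zeta>1 * g2 (\<zeta> - \<zeta>1))")
      case True then show ?thesis unfolding convolution_def by (rule integral_norm_bound_ennreal)
    next
      case False then show ?thesis unfolding convolution_def by (simp add: not_integrable_integral_eq)
    qed
    also have "\<dots> = (\<integral>\<^sup>+\<zeta>1. indicator ?S \<zeta>1 * ?p \<zeta>1 \<partial>(frequency D))"
      by (rule nn_integral_cong) (auto simp: indicator_def norm_mult ennreal_mult)
    finally have "(ennreal (cmod (convolution D g1 g2 \<zeta>)))\<^sup>2 \<le> (\<integral>\<^sup>+\<zeta>1. indicator ?S \<zeta>1 * ?p \<zeta>1 \<partial>(frequency D))\<^sup>2"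
      by (rule power_mono) simp
    also have "\<dots> \<le> (\<integral>\<^sup>+\<zeta>1. (indicator ?S \<zeta>1)\<^sup>2 \<partial>(frequency D)) * (\<integral>\<^sup>+\<zeta>1. (?p \<zeta>1)\<^sup>2 \<partial>(frequency D))"
      by (rule Cauchy_Schwarz_nn_integral) measurable
    also have "(\<integral>\<^sup>+\<zeta>1. (indicator ?S \<zeta>1)\<^sup>2 \<partial>(frequency D)) = (\<integral>\<^sup>+\<zeta>1. indicator ?S \<zeta>1 \<partial>(frequency D))"
      by (rule nn_integral_cong) (auto simp: indicator_def)
    also have "\<dots> = emeasure (frequency D) ?S" by (rule nn_integral_indicator) measurable
    also have "(\<integral>\<^sup>+\<zeta>1. (?p \<zeta>1)\<^sup>2 \<partial>(frequency D)) = (\<integral>\<^sup>+\<zeta>1. ennreal ((cmod (g1 \<zeta>1))\<^sup>2) * ennreal ((cmod (g2 (\<zeta> - \<zeta>1)))\<^sup>2) \<partial>(frequency D))"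
      by (simp add: power_mult_distrib ennreal_power)
    finally show ?thesis
      using order_trans[OF _ mult_right_mono[OF fibre[OF \<zeta>]]] by (simp add: ennreal_power)
  qed
  have "L2_mass (frequency D) (convolution D g1 g2) \<le>
     (\<integral>\<^sup>+\<zeta>. ennreal K * (\<integral>\<^sup>+\<zeta>1. ennreal ((cmod (g1 \<zeta>1))\<^sup>2) * ennreal ((cmod (g2 (\<zeta> - \<zeta>1)))\<^sup>2) \<partial>(frequency D)) \<partial>(frequency D))"
    by (rule nn_integral_mono[OF pw])
  also have "\<dots> = ennreal K * (\<integral>\<^sup>+\<zeta>. \<integral>\<^sup>+\<zeta>1. ennreal ((cmod (g1 \<zeta>1))\<^sup>2) * ennreal ((cmod (g2 (\<zeta> - \<zeta>1)))\<^sup>2) \<partial>(frequency D) \<partial>(frequency D))"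
    by (rule nn_integral_cmult) measurable
  also have "(\<integral>\<^sup>+\<zeta>. \<integral>\<^sup>+\<zeta>1. ennreal ((cmod (g1 \<zeta>1))\<^sup>2) * ennreal ((cmod (g2 (\<zeta> - \<zeta>1)))\<^sup>2) \<partial>(frequency D) \<partial>(frequency D)) =
     (\<integral>\<^sup>+\<zeta>1. \<integral>\<^sup>+\<zeta>. ennreal ((cmod (g1 \<zeta>1))\<^sup>2) * ennreal ((cmod (g2 (\<zeta> - \<zeta>1)))\<^sup>2) \<partial>(frequency D) \<partial>(frequency D))"
    by (rule FF.Fubini'[symmetric]) measurable
  also have "\<dots> = (\<integral>\<^sup>+\<zeta>1. ennreal ((cmod (g1 \<zeta>1))\<^sup>2) * L2_mass (frequency D) g2 \<partial>(frequency D))"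
  proof (rule nn_integral_cong)
    fix \<zeta>1 assume \<zeta>1: "\<zeta>1 \<in> space (frequency D)"
    note [measurable] = m2'[OF \<zeta>1]
    show "(\<integral>\<^sup>+\<zeta>. ennreal ((cmod (g1 \<zeta>1))\<^sup>2) * ennreal ((cmod (g2 (\<zeta> - \<zeta>1)))\<^sup>2) \<partial>(frequency D)) =
      ennreal ((cmod (g1 \<zeta>1))\<^sup>2) * L2_mass (frequency D) g2"
      using translate_frequency(1)[OF \<zeta>1, of "\<lambda>\<zeta>. ennreal ((cmod (g2 \<zeta>))\<^sup>2)"] by (subst nn_integral_cmult) auto
  qed
  also have "\<dots> = ennreal ((L2_norm (frequency D) g1)\<^sup>2) * ennreal ((L2_norm (frequency D) g2)\<^sup>2)"
    unfolding nn_integral_L2[OF g1, symmetric] nn_integral_L2[OF g2, symmetric] by (rule nn_integral_multc) measurable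
  finally show ?thesis using K by (simp add: ennreal_mult mult.assoc)
qed

text \<open>The passage to the frequency side: the product is the inverse transform of a convolution, and the isometry
  is used once for each factor and once for the product.\<close>

lemma product_L2_bound:
  assumes g1: "g1 \<in> truncated (frequency D) cube3" and g2: "g2 \<in> truncated (frequency D) cube3" and K: "0 \<le> K"
    and v1: "v1 \<in> L2_space (spacetime D)" "AE z in spacetime D. v1 z = synth3 D g1 z"
    and v2: "v2 \<in> L2_space (spacetime D)" "AE z in spacetime D. v2 z = synth3 D g2 z"
    and fibre: "\<And>\<zeta>. \<zeta> \<in> space (frequency D) \<Longrightarrow>
      emeasure (frequency D) {\<zeta>1 \<in> space (frequency D). g1 \<zeta>1 \<noteq> 0 \<and> g2 (\<zeta> - \<zeta>1) \<noteq> 0} \<le> ennreal K"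
  shows "(\<lambda>z. v1 z * v2 z) \<in> L2_space (spacetime D)"
    "L2_norm (spacetime D) (\<lambda>z. v1 z * v2 z) \<le> sqrt K * L2_norm (spacetime D) v1 * L2_norm (spacetime D) v2"
proof -
  note [measurable] = L2_spaceD(1)[OF v1(1)] L2_spaceD(1)[OF v2(1)]
  let ?c = "2 * pi * (2 * pi * (2 * pi))"
  define N1 where "N1 = L2_norm (frequency D) g1"
  define N2 where "N2 = L2_norm (frequency D) g2"
  have n1: "L2_norm (spacetime D) v1 = sqrt ?c * N1"
    unfolding N1_def I3.A_norm_eq[OF g1, symmetric] by (rule L2_norm_cong_AE[OF v1(2)]) (auto intro: L2_spaceD(1) I3.A_L2 g1 v1(1))
  have n2: "L2_norm (spacetime D) v2 = sqrt ?c * N2"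
    unfolding N2_def I3.A_norm_eq[OF g2, symmetric] by (rule L2_norm_cong_AE[OF v2(2)]) (auto intro: L2_spaceD(1) I3.A_L2 g2 v2(1))
  let ?h = "convolution D g1 g2"
  note i1 = truncated_cube3_integrable[OF g1] and i2 = truncated_cube3_integrable[OF g2]
  have hb: "L2_mass (frequency D) ?h \<le> ennreal (K * N1\<^sup>2 * N2\<^sup>2)"
    unfolding N1_def N2_def by (rule convolution_L2_bound[OF truncatedD(1)[OF g1] truncatedD(1)[OF g2] K fibre])
  note hi = convolution_integrable(2)[OF i1 i2]
  have hL: "?h \<in> L2_space (frequency D)" by (rule L2_spaceI[OF borel_measurable_integrable[OF hi] hb])
  have "L2_mass (spacetime D) (\<lambda>z. v1 z * v2 z) = L2_mass (spacetime D) (synth3 D ?h)"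
    by (rule nn_integral_cong_AE, use v1(2) v2(2) AE_space in eventually_elim) (simp add: synth3_mult[OF i1 i2])
  also have "\<dots> = ennreal ?c * L2_mass (frequency D) ?h"
    unfolding synth3_def by (rule K3.plancherel[OF hi hL])
  also have "\<dots> \<le> ennreal ?c * ennreal (K * N1\<^sup>2 * N2\<^sup>2)" by (rule mult_left_mono[OF hb]) simp
  also have "\<dots> = ennreal (?c * (K * N1\<^sup>2 * N2\<^sup>2))" by (rule ennreal_mult[symmetric]) (use K in auto)
  also have "\<dots> \<le> ennreal ((sqrt K * L2_norm (spacetime D) v1 * L2_norm (spacetime D) v2)\<^sup>2)"
  proof (rule ennreal_leI)
    have p: "1 \<le> 2 * pi" using pi_gt3 by simp
    have "1 * (1 * 1) \<le> ?c" by (intro mult_mono p) (use pi_gt3 in simp_all)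
    then have c1: "1 \<le> ?c" by simp
    have "?c * (K * N1\<^sup>2 * N2\<^sup>2) \<le> ?c * (?c * (K * N1\<^sup>2 * N2\<^sup>2))"
      using mult_right_mono[OF c1, of "?c * (K * N1\<^sup>2 * N2\<^sup>2)"] K by simp
    also have "\<dots> = (sqrt K)\<^sup>2 * ((sqrt ?c)\<^sup>2 * N1\<^sup>2) * ((sqrt ?c)\<^sup>2 * N2\<^sup>2)" using K by (simp add: mult_ac)
    also have "\<dots> = (sqrt K * L2_norm (spacetime D) v1 * L2_norm (spacetime D) v2)\<^sup>2"
      unfolding n1 n2 by (simp only: power_mult_distrib)
    finally show "?c * (K * N1\<^sup>2 * N2\<^sup>2) \<le> (sqrt K * L2_norm (spacetime D) v1 * L2_norm (spacetime D) v2)\<^sup>2" .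
  qed
  finally have *: "L2_mass (spacetime D) (\<lambda>z. v1 z * v2 z) \<le>
    ennreal ((sqrt K * L2_norm (spacetime D) v1 * L2_norm (spacetime D) v2)\<^sup>2)" .
  show "(\<lambda>z. v1 z * v2 z) \<in> L2_space (spacetime D)" by (rule L2_spaceI[OF _ *]) measurable
  show "L2_norm (spacetime D) (\<lambda>z. v1 z * v2 z) \<le> sqrt K * L2_norm (spacetime D) v1 * L2_norm (spacetime D) v2"
    by (rule L2_norm_leI[OF *]) (use K in auto)
qed


section \<open>The size of the resonant sets\<close>

text \<open>For fixed \<open>(\<xi>,\<mu>)\<close> the slice of \<open>S\<close> in \<open>\<tau>\<close> lies in an interval of length \<open>2 A\<close> and in one of length
  \<open>2 B\<close>.\<close>

lemma fibre_bound:
  assumes S: "S \<in> sets (frequency D)"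
    and P: "P \<in> sets (ximu_measure D)"
    and in_P: "\<And>\<xi> \<mu> \<tau>. (\<xi>, \<mu>, \<tau>) \<in> S \<Longrightarrow> (\<xi>, \<mu>) \<in> P"
    and A: "\<And>\<xi> \<mu> \<tau>. (\<xi>, \<mu>, \<tau>) \<in> S \<Longrightarrow> \<bar>\<tau> - p \<xi> \<mu>\<bar> \<le> A"
    and B: "\<And>\<xi> \<mu> \<tau>. (\<xi>, \<mu>, \<tau>) \<in> S \<Longrightarrow> \<bar>\<tau> - q \<xi> \<mu>\<bar> \<le> B"
    and nonneg: "0 \<le> A" "0 \<le> B"
  shows "emeasure (frequency D) S \<le> ennreal (2 * min A B) * emeasure (ximu_measure D) P"
proof -
  note iso = measure_isoD[OF measure_iso_frequency[of D]]
  let ?j = "\<lambda>w::(real \<times> real) \<times> real. (fst (fst w), snd (fst w), snd w)"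
  have S': "?j -` S \<inter> space (ximu_measure D \<Otimes>\<^sub>M lborel) \<in> sets (ximu_measure D \<Otimes>\<^sub>M lborel)" (is "?S' \<in> _")
    by (rule measurable_sets[OF iso(2) S])
  have slice: "emeasure lborel (Pair z -` ?S') \<le> ennreal (2 * min A B) * indicator P z" for z
  proof (cases "z \<in> P")
    case True
    let ?p = "p (fst z) (snd z)" and ?q = "q (fst z) (snd z)"
    have "Pair z -` ?S' \<subseteq> {?p - A..?p + A}" "Pair z -` ?S' \<subseteq> {?q - B..?q + B}"
      using A[of "fst z" "snd z"] B[of "fst z" "snd z"] by (force simp: abs_le_iff)+
    then have "emeasure lborel (Pair z -` ?S') \<le> emeasure lborel {?p - A..?p + A}"
      "emeasure lborel (Pair z -` ?S') \<le> emeasure lborel {?q - B..?q + B}"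
      by (auto intro!: emeasure_mono)
    then show ?thesis using True nonneg by (auto simp: min_def mult.commute)
  next
    case False
    then have "Pair z -` ?S' = {}" using in_P[of "fst z" "snd z"] by auto
    then show ?thesis by simp
  qed
  have "emeasure (frequency D) S = emeasure (distr (ximu_measure D \<Otimes>\<^sub>M lborel) (frequency D) ?j) S" by (simp only: iso(5))
  also have "\<dots> = emeasure (ximu_measure D \<Otimes>\<^sub>M lborel) ?S'" by (rule emeasure_distr[OF iso(2) S])
  also have "\<dots> = (\<integral>\<^sup>+z. emeasure lborel (Pair z -` ?S') \<partial>(ximu_measure D))"
    by (rule lborel.emeasure_pair_measure_alt[OF S'])
  also have "\<dots> \<le> (\<integral>\<^sup>+z. ennreal (2 * min A B) * indicator P z \<partial>(ximu_measure D))"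
    by (rule nn_integral_mono[OF slice])
  also have "\<dots> = ennreal (2 * min A B) * emeasure (ximu_measure D) P" by (rule nn_integral_cmult_indicator[OF P])
  finally show ?thesis .
qed

text \<open>An interval of length \<open>4 r\<close> contains at most \<open>4 r + 1\<close> integers, and \<open>r \<ge> 1\<close> absorbs the extra point.\<close>

lemma emeasure_mu_interval:
  assumes "1 \<le> r"
  shows "{q - 2 * r..q + 2 * r} \<inter> space (mu_measure D) \<in> sets (mu_measure D)"
    "emeasure (mu_measure D) ({q - 2 * r..q + 2 * r} \<inter> space (mu_measure D)) \<le> ennreal (5 * r)"
proof -
  have "emeasure (mu_measure D) ({q - 2 * r..q + 2 * r} \<inter> space (mu_measure D)) \<le> ennreal (5 * r) \<and>
    {q - 2 * r..q + 2 * r} \<inter> space (mu_measure D) \<in> sets (mu_measure D)"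
  proof (cases D)
    case Line
    then show ?thesis using assms by (auto intro!: ennreal_leI)
  next
    case Circle
    let ?I = "{q - 2 * r..q + 2 * r} \<inter> (\<int> :: real set)"
    have fin: "finite ?I" by (rule finite_Ints_interval)
    have "?I \<subseteq> real_of_int ` {\<lceil>q - 2 * r\<rceil>..\<lfloor>q + 2 * r\<rfloor>}"
      by (auto elim!: Ints_cases simp: ceiling_le_iff le_floor_iff)
    then have "card ?I \<le> card {\<lceil>q - 2 * r\<rceil>..\<lfloor>q + 2 * r\<rfloor>}"
      by (meson card_image_le card_mono finite_atLeastAtMost_int finite_imageI order_trans)
    then have "real (card ?I) \<le> real (nat (\<lfloor>q + 2 * r\<rfloor> - \<lceil>q - 2 * r\<rceil> + 1))" by simp
    also have "\<dots> \<le> 5 * r" using assms by linarith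
    finally have "ennreal (real (card ?I)) \<le> ennreal (5 * r)" by (rule ennreal_leI)
    then show ?thesis using Circle fin by (simp add: emeasure_count_space ennreal_of_nat_eq_real_of_nat)
  qed
  then show "{q - 2 * r..q + 2 * r} \<inter> space (mu_measure D) \<in> sets (mu_measure D)"
    "emeasure (mu_measure D) ({q - 2 * r..q + 2 * r} \<inter> space (mu_measure D)) \<le> ennreal (5 * r)" by auto
qed

lemma abs_le_freq_size: "\<bar>\<xi>\<bar> \<le> freq_size \<xi> \<mu>" "\<bar>\<mu>\<bar> \<le> freq_size \<xi> \<mu>"
  unfolding freq_size_def by (rule real_le_rsqrt, simp)+

text \<open>A square box of frequencies has measure quadratic in its size on both domains, because its side is at
  least one unit of the integer lattice.\<close>

lemma box_bound:
  assumes r: "1 \<le> r"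
  shows "({p - 2 * r..p + 2 * r} \<times> {q - 2 * r..q + 2 * r}) \<inter> space (ximu_measure D) \<in> sets (ximu_measure D)"
    "emeasure (ximu_measure D) (({p - 2 * r..p + 2 * r} \<times> {q - 2 * r..q + 2 * r}) \<inter> space (ximu_measure D)) \<le> ennreal (20 * r\<^sup>2)"
proof -
  interpret mu: sigma_finite_measure "mu_measure D" by (rule sigma_finite_mu)
  have eq: "({p - 2 * r..p + 2 * r} \<times> {q - 2 * r..q + 2 * r}) \<inter> space (ximu_measure D) =
    {p - 2 * r..p + 2 * r} \<times> ({q - 2 * r..q + 2 * r} \<inter> space (mu_measure D))"
    by (auto simp: ximu_measure_def space_pair_measure)
  note mu = emeasure_mu_interval[OF r, where q = q and D = D]
  show "({p - 2 * r..p + 2 * r} \<times> {q - 2 * r..q + 2 * r}) \<inter> space (ximu_measure D) \<in> sets (ximu_measure D)"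
    unfolding eq unfolding ximu_measure_def using mu(1) by auto
  have "emeasure (ximu_measure D) ({p - 2 * r..p + 2 * r} \<times> ({q - 2 * r..q + 2 * r} \<inter> space (mu_measure D))) =
    ennreal (4 * r) * emeasure (mu_measure D) ({q - 2 * r..q + 2 * r} \<inter> space (mu_measure D))"
    unfolding ximu_measure_def using mu(1) r by (subst mu.emeasure_pair_measure_Times) auto
  also have "\<dots> \<le> ennreal (4 * r) * ennreal (5 * r)" by (rule mult_left_mono[OF mu(2)]) simp
  also have "\<dots> = ennreal (20 * r\<^sup>2)" using r by (subst ennreal_mult[symmetric]) (auto simp: power2_eq_square)
  finally show "emeasure (ximu_measure D) (({p - 2 * r..p + 2 * r} \<times> {q - 2 * r..q + 2 * r}) \<inter> space (ximu_measure D)) \<le> ennreal (20 * r\<^sup>2)"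
    unfolding eq .
qed

text \<open>The box is the one of the smaller of the two frequencies: centred at the origin if this is the frequency
  \<open>(\<xi>,\<mu>)\<close> itself, at \<open>(a,b)\<close> if it is the difference.\<close>

lemma fibre_bound_box:
  assumes S: "S \<in> sets (frequency D)" and N: "1 \<le> N1" "1 \<le> N2" and L: "1 \<le> L1" "1 \<le> L2"
    and A: "\<And>\<xi> \<mu> \<tau>. (\<xi>, \<mu>, \<tau>) \<in> S \<Longrightarrow> freq_size \<xi> \<mu> \<le> 8/5 * N1 \<and> \<bar>\<tau> - dispersion \<xi> \<mu>\<bar> \<le> 8/5 * L1"
    and B: "\<And>\<xi> \<mu> \<tau>. (\<xi>, \<mu>, \<tau>) \<in> S \<Longrightarrow> freq_size (a - \<xi>) (b - \<mu>) \<le> 8/5 * N2 \<and>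
       \<bar>(s - \<tau>) - dispersion (a - \<xi>) (b - \<mu>)\<bar> \<le> 8/5 * L2"
  shows "emeasure (frequency D) S \<le> ennreal (64 * min L1 L2 * (min N1 N2)\<^sup>2)"
proof -
  define r where "r = min N1 N2"
  define p where "p = (if N1 \<le> N2 then 0 else a)"
  define q where "q = (if N1 \<le> N2 then 0 else b)"
  have r: "1 \<le> r" using N by (simp add: r_def)
  note box = box_bound[OF r, where p = p and q = q and D = D]
  have "emeasure (frequency D) S \<le> ennreal (2 * min (8/5 * L1) (8/5 * L2)) *
      emeasure (ximu_measure D) (({p - 2 * r..p + 2 * r} \<times> {q - 2 * r..q + 2 * r}) \<inter> space (ximu_measure D))"
  proof (rule fibre_bound[OF S box(1), where p = dispersion and q = "\<lambda>\<xi> \<mu>. s - dispersion (a - \<xi>) (b - \<mu>)"])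
    fix \<xi> \<mu> \<tau> assume z: "(\<xi>, \<mu>, \<tau>) \<in> S"
    have "(\<xi>, \<mu>) \<in> space (ximu_measure D)"
      using sets.sets_into_space[OF S] z by (auto simp: frequency_def ximu_measure_def space_pair_measure)
    moreover have "\<xi> \<in> {p - 2 * r..p + 2 * r} \<and> \<mu> \<in> {q - 2 * r..q + 2 * r}"
      using A[OF z] B[OF z] abs_le_freq_size(1)[of \<xi> \<mu>] abs_le_freq_size(2)[of \<mu> \<xi>]
        abs_le_freq_size(1)[of "a - \<xi>" "b - \<mu>"] abs_le_freq_size(2)[of "b - \<mu>" "a - \<xi>"] N
      by (cases "N1 \<le> N2") (auto simp: p_def q_def r_def min_def)
    ultimately show "(\<xi>, \<mu>) \<in> ({p - 2 * r..p + 2 * r} \<times> {q - 2 * r..q + 2 * r}) \<inter> space (ximu_measure D)" by auto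
    show "\<bar>\<tau> - dispersion \<xi> \<mu>\<bar> \<le> 8/5 * L1" using A[OF z] by simp
    show "\<bar>\<tau> - (s - dispersion (a - \<xi>) (b - \<mu>))\<bar> \<le> 8/5 * L2" using B[OF z] by linarith
  qed (use L in auto)
  also have "\<dots> \<le> ennreal (2 * min (8/5 * L1) (8/5 * L2)) * ennreal (20 * r\<^sup>2)"
    by (rule mult_left_mono[OF box(2)]) simp
  also have "\<dots> = ennreal (2 * min (8/5 * L1) (8/5 * L2) * (20 * r\<^sup>2))"
    using L by (intro ennreal_mult[symmetric]) auto
  also have "2 * min (8/5 * L1) (8/5 * L2) * (20 * r\<^sup>2) = 64 * min L1 L2 * (min N1 N2)\<^sup>2"
    by (simp add: r_def min_def)
  finally show ?thesis .
qed

text \<open>The resonance function \<open>\<xi> \<mapsto> w(\<xi>,\<mu>) + w(a-\<xi>,\<nu>)\<close> has derivative \<open>|(\<xi>,\<mu>)|\<^sup>2 - |(a-\<xi>,\<nu>)|\<^sup>2\<close>, which is at most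
  \<open>-N2\<^sup>2 / 5\<close> where the supports of the cutoffs leave room. The set of such \<open>\<xi>\<close> need not be an interval, so the
  mean value theorem is replaced by the exact difference quotient \<open>d\<close> of this cubic polynomial, which has the
  same lower bound as long as \<open>a - x\<close> and \<open>a - x'\<close> have the same sign.\<close>

lemma resonance_separation:
  assumes N: "1 \<le> N1" "4 * N1 \<le> N2"
    and x: "freq_size x \<mu> \<le> 8/5 * N1" "freq_size x' \<mu> \<le> 8/5 * N1"
    and y: "5/8 * N2 \<le> freq_size (a - x) \<nu>" "5/8 * N2 \<le> freq_size (a - x') \<nu>"
    and sign: "0 \<le> (a - x) * (a - x')"
  shows "N2\<^sup>2 / 5 * \<bar>x - x'\<bar> \<le> \<bar>(dispersion x \<mu> + dispersion (a - x) \<nu>) - (dispersion x' \<mu> + dispersion (a - x') \<nu>)\<bar>"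
proof -
  define d where "d = ((a - x)\<^sup>2 + (a - x) * (a - x') + (a - x')\<^sup>2 + \<nu>\<^sup>2) - (x\<^sup>2 + x * x' + x'\<^sup>2 + \<mu>\<^sup>2)"
  have fs: "(freq_size \<xi> \<zeta>)\<^sup>2 = 3 * \<xi>\<^sup>2 + \<zeta>\<^sup>2" for \<xi> \<zeta> by (simp add: freq_size_def)
  have X: "3 * x\<^sup>2 + \<mu>\<^sup>2 \<le> (8/5 * N1)\<^sup>2" "3 * x'\<^sup>2 + \<mu>\<^sup>2 \<le> (8/5 * N1)\<^sup>2"
    unfolding fs[symmetric] by (rule power_mono[OF x(1) freq_size_nonneg], rule power_mono[OF x(2) freq_size_nonneg])
  have Y: "(5/8 * N2)\<^sup>2 \<le> 3 * (a - x)\<^sup>2 + \<nu>\<^sup>2" "(5/8 * N2)\<^sup>2 \<le> 3 * (a - x')\<^sup>2 + \<nu>\<^sup>2"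
    unfolding fs[symmetric] by (rule power_mono[OF y(1)], use N in simp, rule power_mono[OF y(2)], use N in simp)
  have NN: "(4 * N1)\<^sup>2 \<le> N2\<^sup>2" using N by (intro power_mono) auto
  have "0 \<le> (x - x')\<^sup>2" by simp
  then have xx: "x\<^sup>2 + x * x' + x'\<^sup>2 + \<mu>\<^sup>2 \<le> (8/5 * N1)\<^sup>2"
    using X by (simp add: power2_eq_square algebra_simps)
  have yy: "(5/8 * N2)\<^sup>2 \<le> (a - x)\<^sup>2 + (a - x) * (a - x') + (a - x')\<^sup>2 + \<nu>\<^sup>2"
  proof (cases "\<bar>a - x\<bar> \<le> \<bar>a - x'\<bar>")
    case True
    have "\<bar>a - x\<bar> * \<bar>a - x\<bar> \<le> \<bar>a - x\<bar> * \<bar>a - x'\<bar>" "\<bar>a - x\<bar> * \<bar>a - x\<bar> \<le> \<bar>a - x'\<bar> * \<bar>a - x'\<bar>"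
      by (rule mult_left_mono[OF True abs_ge_zero], rule mult_mono[OF True True abs_ge_zero abs_ge_zero])
    moreover have "\<bar>a - x\<bar> * \<bar>a - x'\<bar> = (a - x) * (a - x')" using sign by (simp add: abs_mult[symmetric])
    ultimately show ?thesis using Y(1) by (simp add: power2_eq_square)
  next
    case False
    then have le: "\<bar>a - x'\<bar> \<le> \<bar>a - x\<bar>" by simp
    have "\<bar>a - x'\<bar> * \<bar>a - x'\<bar> \<le> \<bar>a - x\<bar> * \<bar>a - x'\<bar>" "\<bar>a - x'\<bar> * \<bar>a - x'\<bar> \<le> \<bar>a - x\<bar> * \<bar>a - x\<bar>"
      by (rule mult_right_mono[OF le abs_ge_zero], rule mult_mono[OF le le abs_ge_zero abs_ge_zero])
    moreover have "\<bar>a - x\<bar> * \<bar>a - x'\<bar> = (a - x) * (a - x')" using sign by (simp add: abs_mult[symmetric])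
    ultimately show ?thesis using Y(2) by (simp add: power2_eq_square)
  qed
  have d: "N2\<^sup>2 / 5 \<le> d"
  proof -
    have "(8/5 * N1)\<^sup>2 = 64/25 * N1\<^sup>2" "(5/8 * N2)\<^sup>2 = 25/64 * N2\<^sup>2" "(4 * N1)\<^sup>2 = 16 * N1\<^sup>2"
      by (simp_all add: power_mult_distrib power_divide)
    then show ?thesis using xx yy NN zero_le_power2[of N2] unfolding d_def by linarith
  qed
  have "(dispersion x \<mu> + dispersion (a - x) \<nu>) - (dispersion x' \<mu> + dispersion (a - x') \<nu>) = (x' - x) * d"
    unfolding dispersion_def d_def by (simp add: power2_eq_square power3_eq_cube algebra_simps)
  then have "\<bar>(dispersion x \<mu> + dispersion (a - x) \<nu>) - (dispersion x' \<mu> + dispersion (a - x') \<nu>)\<bar> = \<bar>x - x'\<bar> * \<bar>d\<bar>"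
    by (simp add: abs_mult abs_minus_commute)
  moreover have "\<bar>x - x'\<bar> * (N2\<^sup>2 / 5) \<le> \<bar>x - x'\<bar> * \<bar>d\<bar>"
    using d by (intro mult_left_mono) auto
  ultimately show ?thesis by (simp add: mult.commute)
qed

lemma emeasure_diameter:
  assumes "T \<in> sets lborel" "\<And>x x'. x \<in> T \<Longrightarrow> x' \<in> T \<Longrightarrow> \<bar>x - x'\<bar> \<le> d" "0 \<le> d"
  shows "emeasure lborel (T :: real set) \<le> ennreal (2 * d)"
proof (cases "T = {}")
  case False
  then obtain x where "x \<in> T" by blast
  then have "T \<subseteq> {x - d..x + d}" using assms(2)[OF \<open>x \<in> T\<close>] by (force simp: abs_le_iff)
  then have "emeasure lborel T \<le> emeasure lborel {x - d..x + d}" by (intro emeasure_mono) auto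
  then show ?thesis using assms(3) by simp
qed simp

text \<open>Combining the two conditions on \<open>\<tau>\<close> confines the resonance function to an interval of length \<open>32/5 M\<close> (the
  set \<open>P\<close>). For fixed \<open>\<mu>\<close>, \<open>resonance_separation\<close> bounds by \<open>\<delta>\<close> the diameter of the part of \<open>P\<close> on either
  side of \<open>\<xi> = a\<close>, where \<open>a - \<xi>\<close> changes sign.\<close>

lemma fibre_bound_separated:
  assumes S: "S \<in> sets (frequency D)" and N: "1 \<le> N1" "4 * N1 \<le> N2" and L: "1 \<le> L1" "1 \<le> L2"
    and A: "\<And>\<xi> \<mu> \<tau>. (\<xi>, \<mu>, \<tau>) \<in> S \<Longrightarrow> freq_size \<xi> \<mu> \<le> 8/5 * N1 \<and> \<bar>\<tau> - dispersion \<xi> \<mu>\<bar> \<le> 8/5 * L1"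
    and B: "\<And>\<xi> \<mu> \<tau>. (\<xi>, \<mu>, \<tau>) \<in> S \<Longrightarrow> 5/8 * N2 \<le> freq_size (a - \<xi>) (b - \<mu>) \<and>
       \<bar>(s - \<tau>) - dispersion (a - \<xi>) (b - \<mu>)\<bar> \<le> 8/5 * L2"
  shows "emeasure (frequency D) S \<le> ennreal (2048 * min L1 L2 * max L1 L2 * N1 / N2\<^sup>2)"
proof -
  interpret mu: sigma_finite_measure "mu_measure D" by (rule sigma_finite_mu)
  interpret pm: pair_sigma_finite "lborel :: real measure" "mu_measure D" ..
  define M where "M = max L1 L2"
  have M: "L1 \<le> M" "L2 \<le> M" "1 \<le> M" using L by (auto simp: M_def)
  define P where "P = {z \<in> space (ximu_measure D). freq_size (fst z) (snd z) \<le> 8/5 * N1 \<and>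
     5/8 * N2 \<le> freq_size (a - fst z) (b - snd z) \<and>
     \<bar>s - (dispersion (fst z) (snd z) + dispersion (a - fst z) (b - snd z))\<bar> \<le> 16/5 * M}"
  have [measurable]: "fst \<in> borel_measurable (ximu_measure D)" "snd \<in> borel_measurable (ximu_measure D)"
    using measurable_compose[OF measurable_snd coordinate_mu, of "lborel :: real measure" D]
    unfolding ximu_measure_def by simp_all
  have P: "P \<in> sets (ximu_measure D)"
    unfolding P_def freq_size_def dispersion_def by measurable
  define \<delta> where "\<delta> = 32 * M / N2\<^sup>2"
  have \<delta>: "0 \<le> \<delta>" using M by (simp add: \<delta>_def)
  have slice: "emeasure lborel ((\<lambda>\<xi>. (\<xi>, \<mu>)) -` P) \<le> ennreal (4 * \<delta>) * indicator ({0 - 2 * N1..0 + 2 * N1} \<inter> space (mu_measure D)) \<mu>"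
    if \<mu>: "\<mu> \<in> space (mu_measure D)" for \<mu>
  proof (cases "\<mu> \<in> {-2 * N1..2 * N1}")
    case False
    have "(\<lambda>\<xi>. (\<xi>, \<mu>)) -` P = {}"
    proof (rule ccontr)
      assume "(\<lambda>\<xi>. (\<xi>, \<mu>)) -` P \<noteq> {}"
      then obtain \<xi> where "(\<xi>, \<mu>) \<in> P" by auto
      then have "\<bar>\<mu>\<bar> \<le> 8/5 * N1" using abs_le_freq_size(2)[of \<mu> \<xi>] by (auto simp: P_def)
      then show False using False N by auto
    qed
    then show ?thesis by simp
  next
    case True
    let ?T = "(\<lambda>\<xi>. (\<xi>, \<mu>)) -` P"
    have T: "?T \<in> sets lborel" using sets_Pair2[OF P[unfolded ximu_measure_def]] .
    have diam: "\<bar>x - x'\<bar> \<le> \<delta>" if "x \<in> ?T" "x' \<in> ?T" "0 \<le> (a - x) * (a - x')" for x x'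
    proof -
      have "N2\<^sup>2 / 5 * \<bar>x - x'\<bar> \<le> \<bar>(dispersion x \<mu> + dispersion (a - x) (b - \<mu>)) - (dispersion x' \<mu> + dispersion (a - x') (b - \<mu>))\<bar>"
        using that by (intro resonance_separation[OF N]) (auto simp: P_def)
      also have "\<dots> \<le> 32/5 * M"
      proof -
        have "\<bar>s - (dispersion x \<mu> + dispersion (a - x) (b - \<mu>))\<bar> \<le> 16/5 * M"
          "\<bar>s - (dispersion x' \<mu> + dispersion (a - x') (b - \<mu>))\<bar> \<le> 16/5 * M"
          using that(1,2) by (simp_all add: P_def)
        then show ?thesis by linarith
      qed
      finally show ?thesis using N by (simp add: \<delta>_def field_simps)
    qed
    have "?T = (?T \<inter> {..a}) \<union> (?T \<inter> {a<..})" by auto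
    then have "emeasure lborel ?T \<le> emeasure lborel (?T \<inter> {..a}) + emeasure lborel (?T \<inter> {a<..})"
      using emeasure_subadditive[of "?T \<inter> {..a}" lborel "?T \<inter> {a<..}"] T by (simp add: sets.Int)
    also have "\<dots> \<le> ennreal (2 * \<delta>) + ennreal (2 * \<delta>)"
    proof (intro add_mono emeasure_diameter)
      show "\<bar>x - x'\<bar> \<le> \<delta>" if "x \<in> ?T \<inter> {..a}" "x' \<in> ?T \<inter> {..a}" for x x'
        using that by (intro diam mult_nonneg_nonneg) auto
      show "\<bar>x - x'\<bar> \<le> \<delta>" if "x \<in> ?T \<inter> {a<..}" "x' \<in> ?T \<inter> {a<..}" for x x'
        using that by (intro diam mult_nonpos_nonpos) auto
    qed (use T \<delta> in \<open>auto intro!: sets.Int\<close>)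
    also have "\<dots> = ennreal (4 * \<delta>)" using \<delta> by (simp add: ennreal_plus[symmetric] del: ennreal_plus)
    finally show ?thesis using True \<mu> by simp
  qed
  have "emeasure (frequency D) S \<le> ennreal (2 * min (8/5 * L1) (8/5 * L2)) * emeasure (ximu_measure D) P"
  proof (rule fibre_bound[OF S P, where p = dispersion and q = "\<lambda>\<xi> \<mu>. s - dispersion (a - \<xi>) (b - \<mu>)"])
    fix \<xi> \<mu> \<tau> assume z: "(\<xi>, \<mu>, \<tau>) \<in> S"
    have "(\<xi>, \<mu>) \<in> space (ximu_measure D)"
      using sets.sets_into_space[OF S] z by (auto simp: frequency_def ximu_measure_def space_pair_measure)
    moreover have "\<bar>s - (dispersion \<xi> \<mu> + dispersion (a - \<xi>) (b - \<mu>))\<bar> \<le> 16/5 * M"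
      using A[OF z] B[OF z] M by linarith
    ultimately show "(\<xi>, \<mu>) \<in> P" using A[OF z] B[OF z] by (simp add: P_def)
    show "\<bar>\<tau> - dispersion \<xi> \<mu>\<bar> \<le> 8/5 * L1" using A[OF z] by simp
    show "\<bar>\<tau> - (s - dispersion (a - \<xi>) (b - \<mu>))\<bar> \<le> 8/5 * L2" using B[OF z] by linarith
  qed (use L in auto)
  also have "\<dots> \<le> ennreal (2 * min (8/5 * L1) (8/5 * L2)) * (ennreal (4 * \<delta>) * ennreal (5 * N1))"
  proof (rule mult_left_mono)
    have "emeasure (ximu_measure D) P = (\<integral>\<^sup>+\<mu>. emeasure lborel ((\<lambda>\<xi>. (\<xi>, \<mu>)) -` P) \<partial>(mu_measure D))"
      unfolding ximu_measure_def by (rule pm.emeasure_pair_measure_alt2[OF P[unfolded ximu_measure_def]])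
    also have "\<dots> \<le> (\<integral>\<^sup>+\<mu>. ennreal (4 * \<delta>) * indicator ({0 - 2 * N1..0 + 2 * N1} \<inter> space (mu_measure D)) \<mu> \<partial>(mu_measure D))"
      by (rule nn_integral_mono[OF slice])
    also have "\<dots> = ennreal (4 * \<delta>) * emeasure (mu_measure D) ({0 - 2 * N1..0 + 2 * N1} \<inter> space (mu_measure D))"
      by (rule nn_integral_cmult_indicator[OF emeasure_mu_interval(1)[OF N(1)]])
    also have "\<dots> \<le> ennreal (4 * \<delta>) * ennreal (5 * N1)"
      by (rule mult_left_mono[OF emeasure_mu_interval(2)[OF N(1)]]) simp
    finally show "emeasure (ximu_measure D) P \<le> ennreal (4 * \<delta>) * ennreal (5 * N1)" .
  qed simp
  also have "\<dots> = ennreal (2 * min (8/5 * L1) (8/5 * L2) * (4 * \<delta> * (5 * N1)))"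
    using L N \<delta> by (subst ennreal_mult[symmetric], simp, simp, subst ennreal_mult[symmetric]) auto
  also have "2 * min (8/5 * L1) (8/5 * L2) * (4 * \<delta> * (5 * N1)) = 2048 * min L1 L2 * max L1 L2 * N1 / N2\<^sup>2"
    by (simp add: \<delta>_def M_def min_def)
  finally show ?thesis .
qed

section \<open>The bilinear estimates\<close>

lemma PQ_product_bounds:
  assumes \<eta>: "cutoff \<eta>" and N: "1 \<le> N1" "1 \<le> N2" and L: "1 \<le> L1" "1 \<le> L2"
    and u1: "u1 \<in> L2_space (spacetime D)" and u2: "u2 \<in> L2_space (spacetime D)"
  defines "v1 \<equiv> P_proj \<eta> D N1 (Q_proj \<eta> D L1 u1)" and "v2 \<equiv> P_proj \<eta> D N2 (Q_proj \<eta> D L2 u2)"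
  shows "(\<lambda>z. v1 z * v2 z) \<in> L2_space (spacetime D)"
    "L2_norm (spacetime D) (\<lambda>z. v1 z * v2 z)
       \<le> 64 * sqrt (min L1 L2) * min N1 N2 * L2_norm (spacetime D) v1 * L2_norm (spacetime D) v2"
    "4 * N1 \<le> N2 \<Longrightarrow> L2_norm (spacetime D) (\<lambda>z. v1 z * v2 z)
       \<le> 64 * (sqrt N1 / N2) * sqrt (max L1 L2) * sqrt (min L1 L2) * L2_norm (spacetime D) v1 * L2_norm (spacetime D) v2"
proof -
  obtain g1 where g1: "g1 \<in> truncated (frequency D) cube3"
    and s1: "\<And>\<zeta>. g1 \<zeta> \<noteq> 0 \<Longrightarrow> phi \<eta> N1 (fst \<zeta>) (fst (snd \<zeta>)) \<noteq> 0 \<and> psi \<eta> L1 (fst \<zeta>) (fst (snd \<zeta>)) (snd (snd \<zeta>)) \<noteq> 0"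
    and r1: "AE z in spacetime D. v1 z = synth3 D g1 z"
    using PQ_representation(2)[OF \<eta> N(1) L(1) u1] unfolding v1_def by auto
  obtain g2 where g2: "g2 \<in> truncated (frequency D) cube3"
    and s2: "\<And>\<zeta>. g2 \<zeta> \<noteq> 0 \<Longrightarrow> phi \<eta> N2 (fst \<zeta>) (fst (snd \<zeta>)) \<noteq> 0 \<and> psi \<eta> L2 (fst \<zeta>) (fst (snd \<zeta>)) (snd (snd \<zeta>)) \<noteq> 0"
    and r2: "AE z in spacetime D. v2 z = synth3 D g2 z"
    using PQ_representation(2)[OF \<eta> N(2) L(2) u2] unfolding v2_def by auto
  have v1: "v1 \<in> L2_space (spacetime D)" unfolding v1_def by (rule PQ_representation(1)[OF \<eta> N(1) L(1) u1])
  have v2: "v2 \<in> L2_space (spacetime D)" unfolding v2_def by (rule PQ_representation(1)[OF \<eta> N(2) L(2) u2])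
  let ?S = "\<lambda>\<zeta>. {\<zeta>1 \<in> space (frequency D). g1 \<zeta>1 \<noteq> 0 \<and> g2 (\<zeta> - \<zeta>1) \<noteq> 0}"
  have S: "?S \<zeta> \<in> sets (frequency D)" if "\<zeta> \<in> space (frequency D)" for \<zeta>
  proof -
    note [measurable] = truncatedD(2)[OF g1]
    have [measurable]: "(\<lambda>\<zeta>1. g2 (\<zeta> - \<zeta>1)) \<in> borel_measurable (frequency D)"
      by (rule measurable_compose[OF measurable_diff_frequency truncatedD(2)[OF g2]])
         (use that in \<open>auto intro: measurable_ident_sets[OF refl] measurable_const\<close>)
    show ?thesis by measurable
  qed
  have A: "freq_size \<xi> \<mu> \<le> 8/5 * N1 \<and> \<bar>\<tau> - dispersion \<xi> \<mu>\<bar> \<le> 8/5 * L1" if "(\<xi>, \<mu>, \<tau>) \<in> ?S \<zeta>" for \<xi> \<mu> \<tau> \<zeta>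
    using s1[of "(\<xi>, \<mu>, \<tau>)"] that phi_support(1)[OF \<eta> N(1)] psi_support[OF \<eta> L(1)] by auto
  have B: "freq_size (fst \<zeta> - \<xi>) (fst (snd \<zeta>) - \<mu>) \<le> 8/5 * N2 \<and>
      \<bar>(snd (snd \<zeta>) - \<tau>) - dispersion (fst \<zeta> - \<xi>) (fst (snd \<zeta>) - \<mu>)\<bar> \<le> 8/5 * L2"
    if "(\<xi>, \<mu>, \<tau>) \<in> ?S \<zeta>" for \<xi> \<mu> \<tau> \<zeta>
    using s2[of "\<zeta> - (\<xi>, \<mu>, \<tau>)"] that phi_support(1)[OF \<eta> N(2)] psi_support[OF \<eta> L(2)] by auto
  have B': "5/8 * N2 \<le> freq_size (fst \<zeta> - \<xi>) (fst (snd \<zeta>) - \<mu>)"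
    if "(\<xi>, \<mu>, \<tau>) \<in> ?S \<zeta>" "N2 \<noteq> 1" for \<xi> \<mu> \<tau> \<zeta>
    using s2[of "\<zeta> - (\<xi>, \<mu>, \<tau>)"] that phi_support(2)[OF \<eta> N(2)] by auto
  have n: "0 \<le> L2_norm (spacetime D) v1 * L2_norm (spacetime D) v2" by simp
  have f1: "emeasure (frequency D) (?S \<zeta>) \<le> ennreal (64 * min L1 L2 * (min N1 N2)\<^sup>2)"
    if \<zeta>: "\<zeta> \<in> space (frequency D)" for \<zeta>
    by (rule fibre_bound_box[OF S[OF \<zeta>] N L A B])
  have K1: "0 \<le> 64 * min L1 L2 * (min N1 N2)\<^sup>2" using L by simp
  note b1 = product_L2_bound[OF g1 g2 K1 v1 r1 v2 r2 f1]
  show "(\<lambda>z. v1 z * v2 z) \<in> L2_space (spacetime D)" by (rule b1(1))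
  have "sqrt (64 * min L1 L2 * (min N1 N2)\<^sup>2) = 8 * sqrt (min L1 L2) * min N1 N2"
    using N by (simp add: real_sqrt_mult)
  also have "\<dots> \<le> 64 * sqrt (min L1 L2) * min N1 N2" using N L by (intro mult_right_mono) auto
  finally have "sqrt (64 * min L1 L2 * (min N1 N2)\<^sup>2) \<le> 64 * sqrt (min L1 L2) * min N1 N2" .
  from mult_right_mono[OF this n] show "L2_norm (spacetime D) (\<lambda>z. v1 z * v2 z)
       \<le> 64 * sqrt (min L1 L2) * min N1 N2 * L2_norm (spacetime D) v1 * L2_norm (spacetime D) v2"
    using b1(2) by (simp add: mult.assoc)
  show "L2_norm (spacetime D) (\<lambda>z. v1 z * v2 z)
       \<le> 64 * (sqrt N1 / N2) * sqrt (max L1 L2) * sqrt (min L1 L2) * L2_norm (spacetime D) v1 * L2_norm (spacetime D) v2"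
    if sep: "4 * N1 \<le> N2"
  proof -
    have N2: "N2 \<noteq> 1" using sep N by auto
    \<comment> \<open>The high frequency is not in the lowest block, where the cutoff gives no lower bound.\<close>
    have f2: "emeasure (frequency D) (?S \<zeta>) \<le> ennreal (2048 * min L1 L2 * max L1 L2 * N1 / N2\<^sup>2)"
      if \<zeta>: "\<zeta> \<in> space (frequency D)" for \<zeta>
      by (rule fibre_bound_separated[OF S[OF \<zeta>] N(1) sep L A]) (use B B' N2 in blast)+
    have K2: "0 \<le> 2048 * min L1 L2 * max L1 L2 * N1 / N2\<^sup>2" using L N by simp
    note b2 = product_L2_bound(2)[OF g1 g2 K2 v1 r1 v2 r2 f2]
    have "sqrt (2048 * min L1 L2 * max L1 L2 * N1 / N2\<^sup>2) \<le> sqrt ((64::real)\<^sup>2 * min L1 L2 * max L1 L2 * N1 / N2\<^sup>2)"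
      using L N by (intro real_sqrt_le_mono divide_right_mono mult_right_mono) auto
    also have "\<dots> = 64 * (sqrt N1 / N2) * sqrt (max L1 L2) * sqrt (min L1 L2)"
      using N by (simp only: real_sqrt_mult real_sqrt_divide real_sqrt_abs) simp
    finally have "sqrt (2048 * min L1 L2 * max L1 L2 * N1 / N2\<^sup>2) \<le> 64 * (sqrt N1 / N2) * sqrt (max L1 L2) * sqrt (min L1 L2)" .
    from mult_right_mono[OF this n] show ?thesis using b2 by (simp add: mult.assoc)
  qed
qed

theorem proposition3p6:
  fixes \<eta> :: "real \<Rightarrow> real"
  assumes "cutoff \<eta>"
  shows "\<exists>C>0. \<forall>N1\<in>dyadic. \<forall>N2\<in>dyadic. \<forall>L1\<in>dyadic. \<forall>L2\<in>dyadic. \<forall>D.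
    \<forall>u1\<in>L2_space (spacetime D). \<forall>u2\<in>L2_space (spacetime D).
      (let v1 = P_proj \<eta> D N1 (Q_proj \<eta> D L1 u1);
           v2 = P_proj \<eta> D N2 (Q_proj \<eta> D L2 u2)
       in (\<lambda>z. v1 z * v2 z) \<in> L2_space (spacetime D) \<and>
          L2_norm (spacetime D) (\<lambda>z. v1 z * v2 z)
            \<le> C * sqrt (min L1 L2) * min N1 N2
               * L2_norm (spacetime D) v1 * L2_norm (spacetime D) v2 \<and>
          (N2 \<ge> 4 * N1 \<or> N1 \<ge> 4 * N2 \<longrightarrow>
             L2_norm (spacetime D) (\<lambda>z. v1 z * v2 z)
               \<le> C * (sqrt (min N1 N2) / max N1 N2) * sqrt (max L1 L2) * sqrt (min L1 L2)
                  * L2_norm (spacetime D) v1 * L2_norm (spacetime D) v2))"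
proof (rule exI[of _ 64], intro conjI ballI allI)
  fix N1 N2 L1 L2 :: real and D and u1 u2 :: "real \<times> real \<times> real \<Rightarrow> complex"
  assume dy: "N1 \<in> dyadic" "N2 \<in> dyadic" "L1 \<in> dyadic" "L2 \<in> dyadic"
    and u1: "u1 \<in> L2_space (spacetime D)" and u2: "u2 \<in> L2_space (spacetime D)"
  note ge = dy[THEN dyadic_ge_1]
  define v1 where "v1 = P_proj \<eta> D N1 (Q_proj \<eta> D L1 u1)"
  define v2 where "v2 = P_proj \<eta> D N2 (Q_proj \<eta> D L2 u2)"
  note b = PQ_product_bounds[OF assms ge u1 u2, folded v1_def v2_def]
  note b' = PQ_product_bounds(3)[OF assms ge(2,1,4,3) u2 u1, folded v1_def v2_def]
  have "L2_norm (spacetime D) (\<lambda>z. v1 z * v2 z)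
      \<le> 64 * (sqrt (min N1 N2) / max N1 N2) * sqrt (max L1 L2) * sqrt (min L1 L2)
          * L2_norm (spacetime D) v1 * L2_norm (spacetime D) v2"
    if "N2 \<ge> 4 * N1 \<or> N1 \<ge> 4 * N2"
    using that
  proof
    assume s: "N2 \<ge> 4 * N1"
    then have "min N1 N2 = N1" "max N1 N2 = N2" using ge by auto
    then show ?thesis using b(3)[OF s] by simp
  next
    assume s: "N1 \<ge> 4 * N2"
    then have "min N1 N2 = N2" "max N1 N2 = N1" using ge by auto
    then show ?thesis using b'[OF s] by (simp add: mult.commute[of "v2 _"] max.commute[of L2] min.commute[of L2] mult.assoc mult.commute[of "L2_norm (spacetime D) v2"])
  qed
  then show "let v1 = P_proj \<eta> D N1 (Q_proj \<eta> D L1 u1);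
           v2 = P_proj \<eta> D N2 (Q_proj \<eta> D L2 u2)
       in (\<lambda>z. v1 z * v2 z) \<in> L2_space (spacetime D) \<and>
          L2_norm (spacetime D) (\<lambda>z. v1 z * v2 z)
            \<le> 64 * sqrt (min L1 L2) * min N1 N2
               * L2_norm (spacetime D) v1 * L2_norm (spacetime D) v2 \<and>
          (N2 \<ge> 4 * N1 \<or> N1 \<ge> 4 * N2 \<longrightarrow>
             L2_norm (spacetime D) (\<lambda>z. v1 z * v2 z)
               \<le> 64 * (sqrt (min N1 N2) / max N1 N2) * sqrt (max L1 L2) * sqrt (min L1 L2)
                  * L2_norm (spacetime D) v1 * L2_norm (spacetime D) v2)"
    using b(1,2) unfolding Let_def v1_def v2_def by blast
qed simp

end
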